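(* Let $Y$ be a marked point process with mark space $\mathcal{E}=\{e_1,\ldots,e_K\}$ satisfying the standing assumptions in the context, let the directed graph $G=(V,E)$, $V=\{1,\ldots,K\}$, be a local independence graph of $Y$, and assume that $$\mathcal{F}_t^{A}\cap\mathcal{F}_t^{B}=\mathcal{F}_t^{A\cap B}\qquad\text{for all } A,B\subset V \text{ and all } t\in\mathcal{T},$$ where $\mathcal{F}_t^{\emptyset}=\{\emptyset,\Omega\}$. Then the likelihood process factorises as $$L(t\mid H_t)=\prod_{k\in V}L_k\bigl(t\mid H_t^{\mathrm{cl}(k)}\bigr),\qquad t\in\mathcal{T}.$$
   Context: Marked point process. $\mathcal{E}=\{e_1,\ldots,e_K\}$, $K<\infty$, is a finite mark space, $\mathcal{T}=[0,\tau]$ or $[0,\tau)$ with $\tau<\infty$. A marked point process (MPP) $Y$ on $(\Omega,\mathcal{F},P)$ consists of pairs $(T_s,E_s)$, $s=1,2,\ldots$, with times $0<T_1<T_2<\cdots$ in $\mathcal{T}$ and marks $E_s\in\mathcal{E}$. Its mark-specific counting processes are $N_k(t)=\sum_{T_s\le t}\mathbf{1}\{E_s=e_k\}$, $k\in V=\{1,\ldots,K\}$. For $A\subset V$, $\mathbf{N}_A=(N_k)_{k\in A}$ and $\mathcal{F}_t^A=\sigma\{\mathbf{N}_A(s)\mid s\le t\}$; $\mathcal{F}_t=\mathcal{F}_t^V$. Filtrations, equalities of $\sigma$-fields and measurability statements are understood up to $P$-null sets. Standing assumptions. The MPP is non-explosive: only finitely many events occur in $\mathcal{T}$. All $\mathcal{F}_t$-compensators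 are absolutely continuous, so that predictable $\mathcal{F}_t$-intensity processes $\lambda_k$ exist, i.e. $N_k-\int_0^{\cdot}\lambda_k(s)\,ds$ are $\mathcal{F}_t$-martingales; these martingales are orthogonal for different $k$ (no two of the $N_k$ jump at the same time). For $k\in A\subset V$, the $\mathcal{F}_t^A$-intensity of $N_k$ is the predictable intensity of $N_k$ with respect to the filtration $(\mathcal{F}_t^A)$. Local independence. For $A,B,C\subset V$, write $A\not\rightarrow B\mid C$ if for every $k\in B$ the $\mathcal{F}_t^{A\cup B\cup C}$-intensity $\lambda_k$ of $N_k$ is such that $\lambda_k(t)$ is measurable with respect to $\mathcal{F}_t^{B\cup C}$ for all $t\in\mathcal{T}$. Local independence graph. A directed graph is $G=(V,E)$ with $E\subset\{(j,k)\mid j,k\in V, j\neq k\}$; both $(j,k)$ and $(k,j)$ may be in $E$ and directed cycles are allowed. $G$ is a local independence graph of $Y$ if for all $j\ne k$ in $V$: $(j,k)\notin E$ implies $\{j\}\not\rightarrow\{k\}\mid V\setminus\{j,k\}$. $\mathrm{pa}(k)=\{j\in V\mid (j,k)\in E\}$ and $\mathrm{cl}(k)=\mathrm{pa}(k)\cup\{k\}$. Likelihood. The history process is $H_t=\{(T_s,E_s)\mid T_s\le t\}$, and for $A\subset V$, $H_t^A=\{(T_s,E_s)\mid T_s\le t,\ E_s=e_k \text{ for some } k\in A\}$. With $\lambda(t)=\sum_{k=1}^K\lambda_k(t)$, and writing $\lambda_{E_s}$ for $\lambda_k$ when $E_s=e_k$, the likelihood process is $$L(t\mid H_t)=\prod_{T_s\le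 t}\lambda_{E_s}(T_s)\cdot\exp\Bigl(-\int_0^t\lambda(s)\,ds\Bigr).$$ The mark-specific likelihood of mark $e_k$ is $$L_k(t\mid H_t)=\prod_{T_{s(k)}\le t}\lambda_k(T_{s(k)})\cdot\exp\Bigl(-\int_0^t\lambda_k(s)\,ds\Bigr),$$ where $T_{s(k)}$ (with $E_{s(k)}=e_k$) are the occurrence times of mark $e_k$. For $k\in A\subset V$, $L_k(t\mid H_t^{A})$ denotes the same expression based only on the restricted history $H_t^A$, i.e. with $\lambda_k$ replaced by the $\mathcal{F}_t^A$-intensity of $N_k$. *)

theory Defs
  imports "HOL-Probability.Probability"
begin

section \<open>Marked point processes\<close>

text \<open>
  The mark space is \<open>{mark 1, ..., mark (nmarks)}\<close>. The events are numbered from \<open>0\<close>, so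
  \<open>etime Y s\<close> and \<open>emark Y s\<close> are the mathematical \<open>T\<close> and \<open>E\<close> with index \<open>s + 1\<close>. If fewer than
  \<open>s + 1\<close> events occur, then \<open>etime Y s = \<infinity>\<close> and the mark \<open>emark Y s\<close> has no meaning.
\<close>

record ('w, 'e) mpp =
  base :: "'w measure"
  horizon :: "real set"
  nmarks :: nat
  mark :: "nat \<Rightarrow> 'e"
  etime :: "nat \<Rightarrow> 'w \<Rightarrow> ereal"
  emark :: "nat \<Rightarrow> 'w \<Rightarrow> 'e"

definition marks :: "('w, 'e, 'z) mpp_scheme \<Rightarrow> nat set" where
  "marks Y = {1..nmarks Y}"

locale marked_point_process = prob_space "base Y" for Y :: "('w, 'e) mpp" +
  assumes horizon: "\<exists>\<tau>>0. horizon Y = {0..\<tau>} \<or> horizon Y = {0..<\<tau>}"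
    and inj_mark: "inj_on (mark Y) (marks Y)"
    and etime_measurable: "etime Y s \<in> borel_measurable (base Y)"
    and emark_measurable: "emark Y s \<in> measurable (base Y) (count_space (mark Y ` marks Y))"
    and etime_pos: "\<omega> \<in> space (base Y) \<Longrightarrow> 0 < etime Y s \<omega>"
    and etime_in_horizon:
      "\<omega> \<in> space (base Y) \<Longrightarrow> etime Y s \<omega> \<in> ereal ` horizon Y \<union> {\<infinity>}"
    and etime_less:
      "\<omega> \<in> space (base Y) \<Longrightarrow> etime Y s \<omega> \<noteq> \<infinity> \<Longrightarrow> etime Y s \<omega> < etime Y (Suc s) \<omega>"
    and etime_infinity:
      "\<omega> \<in> space (base Y) \<Longrightarrow> etime Y s \<omega> = \<infinity> \<Longrightarrow> etime Y (Suc s) \<omega> = \<infinity>"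
begin

text \<open>
  Distinct events have distinct times, so no two of the counting processes jump at the same time.
\<close>

lemma etime_inj:
  assumes "\<omega> \<in> space (base Y)" "etime Y s \<omega> = etime Y s' \<omega>" "etime Y s \<omega> \<noteq> \<infinity>"
  shows "s = s'"
proof -
  have mono: "etime Y i \<omega> \<le> etime Y j \<omega>" if "i \<le> j" for i j
    using that
  proof (induction rule: dec_induct)
    case (step n)
    then show ?case
      using etime_less[OF assms(1), of n] etime_infinity[OF assms(1), of n]
      by (cases "etime Y n \<omega> = \<infinity>") auto
  qed simp
  have "etime Y i \<omega> < etime Y j \<omega>" if "i < j" "etime Y i \<omega> \<noteq> \<infinity>" for i j
    using etime_less[OF assms(1) that(2)] mono[of "Suc i" j] that(1) by auto
  then show ?thesis
    using assms(2,3) by (metis less_irrefl linorder_neqE_nat)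
qed

end

definition nonexplosive :: "('w, 'e) mpp \<Rightarrow> bool" where
  "nonexplosive Y \<longleftrightarrow> (AE \<omega> in base Y. finite {s. etime Y s \<omega> < \<infinity>})"

definition counting :: "('w, 'e) mpp \<Rightarrow> nat \<Rightarrow> real \<Rightarrow> 'w \<Rightarrow> nat" where
  "counting Y k t \<omega> = card {s. etime Y s \<omega> \<le> ereal t \<and> emark Y s \<omega> = mark Y k}"

text \<open>
  The internal history of the processes with index in \<open>A\<close>, augmented by all null sets of the
  probability space. As all histories are augmented, plain equality of \<open>\<sigma>\<close>-fields and plain
  measurability express equality and measurability up to null sets. For \<open>A = {}\<close> this is the
  trivial \<open>\<sigma>\<close>-field up to null sets.
\<close>

definition history :: "('w, 'e) mpp \<Rightarrow> nat set \<Rightarrow> real \<Rightarrow> 'w measure" where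
  "history Y A t = sigma (space (base Y))
     ({counting Y k s -` {n} \<inter> space (base Y) | k s n. k \<in> A \<and> s \<in> horizon Y \<and> s \<le> t}
       \<union> null_sets (base Y))"


section \<open>Intensities\<close>

definition martingale :: "'w measure \<Rightarrow> real set \<Rightarrow> (real \<Rightarrow> 'w measure) \<Rightarrow> (real \<Rightarrow> 'w \<Rightarrow> real) \<Rightarrow> bool"
  where
  "martingale M I F X \<longleftrightarrow>
     (\<forall>t\<in>I. X t \<in> borel_measurable (F t) \<and> integrable M (X t)) \<and>
     (\<forall>s\<in>I. \<forall>t\<in>I. s \<le> t \<longrightarrow> (AE \<omega> in M. real_cond_exp M (F s) (X t) \<omega> = X s \<omega>))"

definition predictable_sigma :: "'w measure \<Rightarrow> real set \<Rightarrow> (real \<Rightarrow> 'w measure) \<Rightarrow> (real \<times> 'w) measure"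
  where
  "predictable_sigma M I F = sigma (I \<times> space M)
     ({{0} \<times> B | B. B \<in> sets (F 0)} \<union>
      {{s<..t} \<times> B | s t B. s \<in> I \<and> t \<in> I \<and> s \<le> t \<and> B \<in> sets (F s)})"

definition predictable :: "'w measure \<Rightarrow> real set \<Rightarrow> (real \<Rightarrow> 'w measure) \<Rightarrow> (real \<Rightarrow> 'w \<Rightarrow> real) \<Rightarrow> bool"
  where
  "predictable M I F X \<longleftrightarrow>
     (\<lambda>(t, \<omega>). X t \<omega>) \<in> borel_measurable (predictable_sigma M I F)"

text \<open>
  \<open>intensity Y A k lam\<close>: the process \<open>lam\<close> is a version of the intensity of the \<open>k\<close>-th counting process
  with respect to the history of \<open>A\<close>. An intensity is determined only up to a null set of
  \<open>dt \<otimes> P\<close>, hence a predicate. Integrability of the paths is stated explicitly because the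
  integral of a non-integrable function is \<open>0\<close> by convention.
\<close>

definition intensity :: "('w, 'e) mpp \<Rightarrow> nat set \<Rightarrow> nat \<Rightarrow> (real \<Rightarrow> 'w \<Rightarrow> real) \<Rightarrow> bool" where
  "intensity Y A k lam \<longleftrightarrow>
     predictable (base Y) (horizon Y) (history Y A) lam \<and>
     (\<forall>t\<in>horizon Y. \<forall>\<omega>\<in>space (base Y). 0 \<le> lam t \<omega>) \<and>
     (AE \<omega> in base Y. \<forall>t\<in>horizon Y. set_integrable lborel {0..t} (\<lambda>u. lam u \<omega>)) \<and>
     martingale (base Y) (horizon Y) (history Y A)
       (\<lambda>t \<omega>. real (counting Y k t \<omega>) - (LBINT u:{0..t}. lam u \<omega>))"


section \<open>Local independence\<close>

text \<open>
  \<open>locally_independent Y A B C\<close> says that \<open>B\<close> is locally independent of \<open>A\<close> given \<open>C\<close>. Since an intensity may be changed arbitrarily (within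
  predictability) at any fixed time, measurability of \<open>lam t\<close> for every \<open>t\<close> can only be a property of
  a suitable version.
\<close>

definition locally_independent ::
  "('w, 'e) mpp \<Rightarrow> nat set \<Rightarrow> nat set \<Rightarrow> nat set \<Rightarrow> bool" where
  "locally_independent Y A B C \<longleftrightarrow>
     (\<forall>k\<in>B. \<exists>lam. intensity Y (A \<union> B \<union> C) k lam \<and>
        (\<forall>t\<in>horizon Y. lam t \<in> borel_measurable (history Y (B \<union> C) t)))"

definition local_independence_graph :: "('w, 'e) mpp \<Rightarrow> (nat \<times> nat) set \<Rightarrow> bool" where
  "local_independence_graph Y E \<longleftrightarrow>
     E \<subseteq> {(j, k). j \<in> marks Y \<and> k \<in> marks Y \<and> j \<noteq> k} \<and>
     (\<forall>j\<in>marks Y. \<forall>k\<in>marks Y. j \<noteq> k \<longrightarrow> (j, k) \<notin> E \<longrightarrow>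
        locally_independent Y {j} {k} (marks Y - {j, k}))"

definition pa :: "(nat \<times> nat) set \<Rightarrow> nat \<Rightarrow> nat set" where
  "pa E k = {j. (j, k) \<in> E}"

definition cl :: "(nat \<times> nat) set \<Rightarrow> nat \<Rightarrow> nat set" where
  "cl E k = pa E k \<union> {k}"


section \<open>Likelihood\<close>

text \<open>
  The intensities are arguments. In \<open>mark_likelihood Y k \<mu>\<close>, taking for \<open>\<mu>\<close> an intensity with
  respect to the history of \<open>A\<close> gives the mark-specific likelihood based on the restricted history.
\<close>

definition likelihood ::
  "('w, 'e) mpp \<Rightarrow> (nat \<Rightarrow> real \<Rightarrow> 'w \<Rightarrow> real) \<Rightarrow> real \<Rightarrow> 'w \<Rightarrow> real" where
  "likelihood Y lam t \<omega> =
     (\<Prod>s | etime Y s \<omega> \<le> ereal t.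
        lam (the_inv_into (marks Y) (mark Y) (emark Y s \<omega>)) (real_of_ereal (etime Y s \<omega>)) \<omega>) *
     exp (- (LBINT u:{0..t}. \<Sum>k\<in>marks Y. lam k u \<omega>))"

definition mark_likelihood ::
  "('w, 'e) mpp \<Rightarrow> nat \<Rightarrow> (real \<Rightarrow> 'w \<Rightarrow> real) \<Rightarrow> real \<Rightarrow> 'w \<Rightarrow> real" where
  "mark_likelihood Y k \<mu> t \<omega> =
     (\<Prod>s | etime Y s \<omega> \<le> ereal t \<and> emark Y s \<omega> = mark Y k. \<mu> (real_of_ereal (etime Y s \<omega>)) \<omega>) *
     exp (- (LBINT u:{0..t}. \<mu> u \<omega>))"

end

theory Submission
  imports Defs
begin

text \<open>
  Why the factorisation holds. Both sides of the claim are built from the same events and from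
  intensities of the same counting processes. Hence it suffices that, for every mark \<open>k\<close>, the
  intensity of the \<open>k\<close>-th process with respect to the full history agrees with its intensity with
  respect to the history of \<open>cl E k\<close>: almost everywhere for \<open>dt \<otimes> P\<close>, which gives the exponential
  factors, and almost surely at every event of mark \<open>k\<close>, which gives the product over the jumps.

  For each non-parent \<open>j\<close>, local independence supplies a version of the full intensity that is adapted
  to the history without \<open>j\<close>. The versions for different \<open>j\<close> are different functions, but an intensity
  is unique up to null sets (\<open>intensity_unique\<close>), and the histories contain all null sets. So for
  almost every time the given full intensity is measurable with respect to all these histories at
  once, hence with respect to their intersection, the history of \<open>cl E k\<close>
  (\<open>intensity_parents_adapted\<close>).

  Adaptedness is weaker than predictability. A jointly measurable adapted process nevertheless has a
  predictable modification up to a \<open>dt \<otimes> P\<close> null set (\<open>predictable_version\<close>): average the process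
  over a short grid interval strictly in the past; these averages are predictable, and converge to
  the process almost everywhere by Lebesgue's differentiation theorem. The modification has the same
  time integrals as the full intensity, so the tower property makes it an intensity for both
  histories (\<open>intensity_restrict\<close>), and uniqueness, applied in both of them, identifies it with any
  two given intensities.

  Uniqueness rests on the identity
  \<open>E (\<Sum>s. 1\<^sub>D (T\<^sub>s)) = E (\<integral> 1\<^sub>D \<lambda> dt)\<close> for predictable \<open>D\<close>. The expectation of \<open>N\<^sub>k(t)\<close> may be
  infinite although the compensated process is integrable, so the identity is proved for the events
  that are preceded by at most \<open>n\<close> events of the same mark (\<open>early_measures_agree\<close>). This needs the
  martingale stopped at the first time at which the count exceeds \<open>n\<close>; \<open>limit_stopping\<close> obtains it
  from stopping on finite grids. Applied to \<open>D = {\<lambda> < \<lambda>'}\<close> the identity forces \<open>D\<close> to be null for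
  \<open>dt \<otimes> P\<close>, and then to contain almost surely no event.
\<close>

section \<open>Averages over grid intervals in the past\<close>

lemma bounded_set_integrable:
  fixes f :: "real \<Rightarrow> real"
  assumes [measurable]: "f \<in> borel_measurable borel" and "\<And>x. \<bar>f x\<bar> \<le> C"
  shows "set_integrable lborel {a..b} f"
  unfolding set_integrable_def
proof (rule Bochner_Integration.integrable_bound)
  show "integrable lborel (\<lambda>x. indicator {a..b} x *\<^sub>R C)"
    by (intro integrable_real_indicator integrable_scaleR_left) (auto simp: emeasure_lborel_Icc_eq)
  show "AE x in lborel. norm (indicator {a..b} x *\<^sub>R f x) \<le> norm (indicator {a..b} x *\<^sub>R C)"
  proof (intro AE_I2)
    fix x show "norm (indicator {a..b} x *\<^sub>R f x) \<le> norm (indicator {a..b} x *\<^sub>R C)"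
      using assms(2)[of x] by (auto simp: indicator_def)
  qed
qed simp

text \<open>
  The right-sided differentiation theorem for Henstock-Kurzweil integrals, applied to the reflected
  function. Left-sided averages are needed because a predictable process may use the past only.
\<close>

lemma left_lebesgue_differentiation:
  fixes f :: "real \<Rightarrow> real"
  assumes meas [measurable]: "f \<in> borel_measurable borel" and bdd: "\<And>x. \<bar>f x\<bar> \<le> C"
  shows "AE x in lborel. \<forall>e>0. \<exists>d>0. \<forall>h. 0 < h \<and> h < d \<longrightarrow> \<bar>(LBINT s:{x - h..x}. f s) / h - f x\<bar> < e"
proof -
  have int: "set_integrable lborel {a..b} f" for a b
    by (rule bounded_set_integrable[OF meas bdd])
  have int': "set_integrable lborel {a..b} (\<lambda>x. f (- x))" for a b
    by (rule bounded_set_integrable[where C = C]) (auto intro: bdd)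
  have "(\<lambda>x. f (- x)) integrable_on cbox a b" for a b
    using set_borel_integral_eq_integral(1)[OF int'[of a b]] by simp
  then obtain N where N: "negligible N"
    "\<And>x e. \<lbrakk>x \<notin> N; 0 < e\<rbrakk> \<Longrightarrow> \<exists>d>0. \<forall>h. 0 < h \<and> h < d \<longrightarrow>
       norm (integral (cbox x (x + h *\<^sub>R One)) (\<lambda>x. f (- x)) /\<^sub>R h ^ DIM(real) - f (- x)) < e"
    using integrable_ccontinuous_explicit[of "\<lambda>x. f (- x)"] by blast
  have eq: "integral (cbox (- x) (- x + h *\<^sub>R One)) (\<lambda>x. f (- x)) = (LBINT s:{x - h..x}. f s)" for x h :: real
    using Henstock_Kurzweil_Integration.integral_reflect_real[of x "x - h" f] set_borel_integral_eq_integral(2)[OF int, of "x - h" x]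
    by simp
  have "negligible (uminus ` N)"
    by (rule negligible_differentiable_image_negligible[OF _ N(1)])
      (auto intro!: derivative_intros simp: differentiable_on_def)
  then have "AE x in lebesgue. x \<notin> uminus ` N"
    using AE_not_in negligible_iff_null_sets by blast
  then have "AE x in lborel. x \<notin> uminus ` N"
    by (simp add: AE_completion_iff)
  then show ?thesis
  proof (rule AE_mp, intro AE_I2 impI allI)
    fix x e :: real
    assume "x \<notin> uminus ` N" "0 < e"
    then have "- x \<notin> N"
      by (metis image_eqI minus_minus)
    from N(2)[OF this \<open>0 < e\<close>, unfolded eq]
    show "\<exists>d>0. \<forall>h. 0 < h \<and> h < d \<longrightarrow> \<bar>(LBINT s:{x - h..x}. f s) / h - f x\<bar> < e"
      by (simp add: divide_inverse mult.commute)
  qed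
qed

text \<open>
  The largest multiple of \<open>1 / (n + 1)\<close> that is strictly smaller than \<open>t\<close>. As a function of \<open>t\<close> it is
  a left-continuous step function, which is what makes averages ending there predictable.
\<close>

definition left_grid_point :: "nat \<Rightarrow> real \<Rightarrow> real" where
  "left_grid_point n t = of_int (\<lceil>t * real (Suc n)\<rceil> - 1) / real (Suc n)"

definition left_average :: "nat \<Rightarrow> (real \<Rightarrow> real) \<Rightarrow> real \<Rightarrow> real" where
  "left_average n f t = real (Suc n) * (LBINT s:{left_grid_point n t - 1 / real (Suc n)..left_grid_point n t}. f s)"

lemma left_grid_point_bounds: "left_grid_point n t < t" "t - 1 / real (Suc n) \<le> left_grid_point n t"
proof -
  have "t * real (Suc n) \<le> of_int \<lceil>t * real (Suc n)\<rceil>" "of_int \<lceil>t * real (Suc n)\<rceil> < t * real (Suc n) + 1"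
    by linarith+
  then show "left_grid_point n t < t" "t - 1 / real (Suc n) \<le> left_grid_point n t"
    by (simp_all add: left_grid_point_def field_simps del: of_nat_Suc)
qed

text \<open>
  The grid interval ends at some \<open>a < x\<close> with \<open>x - a \<le> h\<close> and has length \<open>h\<close>, so its integral is the
  difference of the integrals over \<open>[a - h, x]\<close> and \<open>[a, x]\<close>. Both have right end point \<open>x\<close> and length
  at most \<open>2 h\<close>; therefore left-sided differentiability at \<open>x\<close> controls the average with an error
  \<open>o(h) / h\<close>.
\<close>

lemma left_average_tendsto:
  fixes f :: "real \<Rightarrow> real"
  assumes meas [measurable]: "f \<in> borel_measurable borel" and bdd: "\<And>x. \<bar>f x\<bar> \<le> C"
  shows "AE x in lborel. (\<lambda>n. left_average n f x) \<longlonglongrightarrow> f x"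
  using left_lebesgue_differentiation[OF assms]
proof (rule AE_mp, intro AE_I2 impI)
  fix x assume diff: "\<forall>e>0. \<exists>d>0. \<forall>h. 0 < h \<and> h < d \<longrightarrow> \<bar>(LBINT s:{x - h..x}. f s) / h - f x\<bar> < e"
  have int: "set_integrable lborel {a..b} f" for a b
    by (rule bounded_set_integrable[OF meas bdd])
  show "(\<lambda>n. left_average n f x) \<longlonglongrightarrow> f x"
  proof (rule LIMSEQ_I)
    fix r :: real assume "0 < r"
    then obtain d where d: "d > 0"
      "\<And>h. 0 < h \<Longrightarrow> h < d \<Longrightarrow> \<bar>(LBINT s:{x - h..x}. f s) / h - f x\<bar> < r / 4"
      using diff by (metis zero_less_divide_iff zero_less_numeral)
    have d': "\<bar>(LBINT s:{x - h..x}. f s) - h * f x\<bar> \<le> r / 4 * h" if "0 < h" "h < d" for h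
    proof -
      have "\<bar>(LBINT s:{x - h..x}. f s) - h * f x\<bar> = \<bar>(LBINT s:{x - h..x}. f s) / h - f x\<bar> * h"
        using \<open>0 < h\<close> by (auto simp: field_simps abs_if)
      then show ?thesis
        using d(2)[OF that] \<open>0 < h\<close> by (simp add: mult_right_mono)
    qed
    obtain n0 where n0: "2 / d < real n0"
      using reals_Archimedean2 by blast
    show "\<exists>no. \<forall>n\<ge>no. norm (left_average n f x - f x) < r"
    proof (intro exI allI impI)
      fix n assume "n0 \<le> n"
      define h where "h = 1 / real (Suc n)"
      define a where "a = left_grid_point n x"
      have h: "0 < h" "2 * h < d" "real (Suc n) * h = 1"
      proof -
        have "2 < d * real n0"
          using n0 d(1) by (simp add: field_simps)
        also have "\<dots> \<le> d * real (Suc n)"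
          using \<open>n0 \<le> n\<close> d(1) by (intro mult_left_mono) auto
        finally show "2 * h < d"
          by (simp add: h_def field_simps)
      qed (auto simp: h_def)
      have a: "a < x" "x - h \<le> a"
        using left_grid_point_bounds[where n = n and t = x] by (auto simp: a_def h_def)
      have "(LBINT s:{a - h..x}. f s) = (LBINT s:{a - h..a}. f s) + (LBINT s:{a<..x}. f s)"
      proof -
        have "{a - h..x} = {a - h..a} \<union> {a<..x}"
          using a h by auto
        moreover have "set_integrable lborel {a<..x} f"
          by (rule set_integrable_subset[OF int[of a x]]) auto
        ultimately show ?thesis
          using set_integral_Un[of "{a - h..a}" "{a<..x}" lborel f] int[of "a - h" a] by force
      qed
      moreover have "(LBINT s:{a<..x}. f s) = (LBINT s:{a..x}. f s)"
        unfolding set_lebesgue_integral_def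
        by (rule integral_cong_AE; use AE_lborel_singleton[of a] in \<open>auto simp: indicator_def elim!: AE_mp\<close>)
      moreover have "\<bar>(LBINT s:{a - h..x}. f s) - (x - a + h) * f x\<bar> \<le> r / 4 * (x - a + h)"
        using d'[of "x - a + h"] a h by simp
      moreover have "\<bar>(LBINT s:{a..x}. f s) - (x - a) * f x\<bar> \<le> r / 4 * (x - a)"
        using d'[of "x - a"] a h by simp
      ultimately have "\<bar>(LBINT s:{a - h..a}. f s) - h * f x\<bar> \<le> r / 4 * (x - a + h) + r / 4 * (x - a)"
      proof -
        assume *: "(LBINT s:{a - h..x}. f s) = (LBINT s:{a - h..a}. f s) + (LBINT s:{a<..x}. f s)"
          "(LBINT s:{a<..x}. f s) = (LBINT s:{a..x}. f s)"
          "\<bar>(LBINT s:{a - h..x}. f s) - (x - a + h) * f x\<bar> \<le> r / 4 * (x - a + h)"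
          "\<bar>(LBINT s:{a..x}. f s) - (x - a) * f x\<bar> \<le> r / 4 * (x - a)"
        have "(LBINT s:{a - h..a}. f s) - h * f x
            = ((LBINT s:{a - h..x}. f s) - (x - a + h) * f x) - ((LBINT s:{a..x}. f s) - (x - a) * f x)"
          using *(1,2) by (simp add: algebra_simps)
        then show ?thesis
          using *(3,4) by linarith
      qed
      also have "\<dots> = r / 4 * (2 * (x - a) + h)"
        by (simp add: field_simps)
      also have "\<dots> \<le> r / 4 * (3 * h)"
        using a \<open>0 < r\<close> by (intro mult_left_mono) auto
      finally have "\<bar>(LBINT s:{a - h..a}. f s) - h * f x\<bar> \<le> r / 4 * (3 * h)" .
      then have le: "real (Suc n) * \<bar>(LBINT s:{a - h..a}. f s) - h * f x\<bar> \<le> real (Suc n) * (r / 4 * (3 * h))"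
        by (rule mult_left_mono) simp
      have "left_average n f x - f x = real (Suc n) * (LBINT s:{a - h..a}. f s) - (real (Suc n) * h) * f x"
        by (simp only: left_average_def a_def[symmetric] h_def[symmetric] h(3) mult_1)
      also have "\<dots> = real (Suc n) * ((LBINT s:{a - h..a}. f s) - h * f x)"
        by (simp only: right_diff_distrib mult.assoc)
      finally have "norm (left_average n f x - f x) = real (Suc n) * \<bar>(LBINT s:{a - h..a}. f s) - h * f x\<bar>"
        by (simp add: abs_mult del: of_nat_Suc)
      also have "\<dots> \<le> (r * (3 / 4)) * (real (Suc n) * h)"
        using le by (simp only: mult_ac times_divide_eq_right times_divide_eq_left)
      also have "\<dots> < r"
        using \<open>0 < r\<close> unfolding h(3) by simp
      finally show "norm (left_average n f x - f x) < r" .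
    qed
  qed
qed

section \<open>Augmented filtrations and predictable processes\<close>

text \<open>
  That every \<open>F t\<close> contains the null sets of \<open>M\<close> is what allows measurability to be transferred
  between almost surely equal random variables.
\<close>

locale augmented_filtration = prob_space M for M :: "'w measure" +
  fixes I :: "real set" and F :: "real \<Rightarrow> 'w measure"
  assumes time_interval: "\<exists>\<tau>>0. I = {0..\<tau>} \<or> I = {0..<\<tau>}"
    and subalgebra: "t \<in> I \<Longrightarrow> subalgebra M (F t)"
    and mono: "s \<in> I \<Longrightarrow> t \<in> I \<Longrightarrow> s \<le> t \<Longrightarrow> sets (F s) \<subseteq> sets (F t)"
    and null_sets_F: "t \<in> I \<Longrightarrow> null_sets M \<subseteq> sets (F t)"
begin

lemma space_F: "t \<in> I \<Longrightarrow> space (F t) = space M"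
  and sets_F: "t \<in> I \<Longrightarrow> sets (F t) \<subseteq> sets M"
  using subalgebra by (auto simp: subalgebra_def)

lemma measurable_F: "t \<in> I \<Longrightarrow> f \<in> measurable (F t) N \<Longrightarrow> f \<in> measurable M N"
  using measurable_from_subalg subalgebra by blast

lemma zero_in_I: "0 \<in> I" and nonneg_I: "t \<in> I \<Longrightarrow> 0 \<le> t"
  and downward_closed_I: "t \<in> I \<Longrightarrow> 0 \<le> s \<Longrightarrow> s \<le> t \<Longrightarrow> s \<in> I"
  and borel_I [measurable]: "I \<in> sets borel"
  using time_interval by auto

lemma cofinal_sequence:
  obtains c :: "nat \<Rightarrow> real" where "range c \<subseteq> I" "incseq c" "\<And>t. t \<in> I \<Longrightarrow> \<exists>n. t \<le> c n"
proof -
  obtain \<tau> where \<tau>: "\<tau> > 0" "I = {0..\<tau>} \<or> I = {0..<\<tau>}"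
    using time_interval by blast
  show thesis
  proof (cases "I = {0..\<tau>}")
    case True
    then show thesis
      using that[of "\<lambda>_. \<tau>"] \<tau> by auto
  next
    case False
    then have I: "I = {0..<\<tau>}"
      using \<tau> by simp
    show thesis
    proof (rule that[of "\<lambda>n. \<tau> - \<tau> / real (Suc n)"])
      show "range (\<lambda>n. \<tau> - \<tau> / real (Suc n)) \<subseteq> I"
        using \<tau> by (auto simp: I field_simps)
      show "incseq (\<lambda>n. \<tau> - \<tau> / real (Suc n))"
        using \<tau> by (auto simp: incseq_def intro!: divide_left_mono)
      fix t assume "t \<in> I"
      then have "\<tau> - t > 0"
        by (simp add: I)
      obtain n where "\<tau> / (\<tau> - t) < real n"
        using reals_Archimedean2 by blast
      then have "\<tau> / (\<tau> - t) \<le> real (Suc n)"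
        by simp
      then have "t \<le> \<tau> - \<tau> / real (Suc n)"
        using \<open>\<tau> - t > 0\<close> by (simp add: field_simps)
      then show "\<exists>n. t \<le> \<tau> - \<tau> / real (Suc n)" by blast
    qed
  qed
qed

lemma measurable_F_AE_eq:
  fixes f g :: "'w \<Rightarrow> real"
  assumes t: "t \<in> I" and f: "f \<in> borel_measurable (F t)" and g [measurable]: "g \<in> borel_measurable M"
    and eq: "AE \<omega> in M. f \<omega> = g \<omega>"
  shows "g \<in> borel_measurable (F t)"
proof (rule measurableI)
  fix A :: "real set" assume [measurable]: "A \<in> sets borel"
  have [measurable]: "f \<in> borel_measurable M"
    using measurable_F[OF t f] .
  define N where "N = {\<omega> \<in> space M. f \<omega> \<noteq> g \<omega>}"
  have N: "N \<in> null_sets M"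
    unfolding N_def using eq by (subst AE_iff_null[symmetric]) measurable
  have "(g -` A \<inter> space M) \<inter> N \<in> null_sets M"
    by (rule null_set_Int1[OF N]) measurable
  then have "((f -` A \<inter> space (F t)) - N) \<union> ((g -` A \<inter> space M) \<inter> N) \<in> sets (F t)"
    using null_sets_F[OF t] N by (intro sets.Un sets.Diff measurable_sets[OF f] subsetD[OF null_sets_F[OF t]]) auto
  also have "((f -` A \<inter> space (F t)) - N) \<union> ((g -` A \<inter> space M) \<inter> N) = g -` A \<inter> space (F t)"
    by (auto simp: N_def space_F[OF t])
  finally show "g -` A \<inter> space (F t) \<in> sets (F t)" .
qed simp

lemma sigma_finite_subalgebra_F: "t \<in> I \<Longrightarrow> sigma_finite_subalgebra M (F t)"
  using finite_measure_axioms subalgebra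
  by (intro finite_measure_subalgebra_is_sigma_finite)
     (simp add: finite_measure_subalgebra_def finite_measure_subalgebra_axioms_def)

text \<open>
  Adaptedness at single times does not say that \<open>f\<close> is measurable for the product with \<open>F t\<close>, so Fubini's
  theorem does not apply directly to the integral \<open>Z\<close>. Instead \<open>Z\<close> is compared with its conditional
  expectation \<open>R\<close>: each \<open>f s\<close> is orthogonal to \<open>Z - R\<close>, hence so is \<open>Z\<close> by Fubini's theorem over \<open>M\<close>,
  and so is \<open>R\<close>; thus \<open>Z - R\<close> vanishes almost surely.
\<close>

lemma time_integral_measurable_F:
  fixes f :: "real \<Rightarrow> 'w \<Rightarrow> real"
  assumes t: "t \<in> I"
    and meas: "(\<lambda>(s, \<omega>). f s \<omega>) \<in> borel_measurable (lborel \<Otimes>\<^sub>M M)"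
    and bdd: "\<And>s \<omega>. \<omega> \<in> space M \<Longrightarrow> \<bar>f s \<omega>\<bar> \<le> C"
    and adapted: "AE s in lborel. s \<in> {a..b} \<longrightarrow> f s \<in> borel_measurable (F t)"
  shows "(\<lambda>\<omega>. LBINT s:{a..b}. f s \<omega>) \<in> borel_measurable (F t)"
proof -
  interpret sigma_finite_subalgebra M "F t"
    by (rule sigma_finite_subalgebra_F[OF t])
  interpret pair: pair_sigma_finite lborel M
    by standard
  note meas [measurable]
  have [measurable]: "f s \<in> borel_measurable M" for s
    using measurable_Pair2[OF meas, of s] by simp
  define g where "g s \<omega> = indicator {a..b} s * f s \<omega>" for s \<omega>
  have g [measurable]: "(\<lambda>(s, \<omega>). g s \<omega>) \<in> borel_measurable (lborel \<Otimes>\<^sub>M M)"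
    unfolding g_def by measurable
  have g_bdd: "\<bar>g s \<omega>\<bar> \<le> indicator {a..b} s * C" if "\<omega> \<in> space M" for s \<omega>
    using bdd[OF that, of s] by (auto simp: g_def indicator_def)
  define Z where "Z \<omega> = (LBINT s. g s \<omega>)" for \<omega>
  have Z_eq: "Z \<omega> = (LBINT s:{a..b}. f s \<omega>)" for \<omega>
    by (simp add: Z_def g_def set_lebesgue_integral_def)
  have Z [measurable]: "Z \<in> borel_measurable M"
    unfolding Z_def
    by (rule lborel.borel_measurable_lebesgue_integral) measurable
  define B where "B = (LBINT s. indicator {a..b} s * C)"
  have C: "0 \<le> C"
    using bdd[of _ 0] not_empty by force
  have int_ind: "integrable lborel (\<lambda>s. indicator {a..b} s * C)"
    by (intro integrable_mult_left integrable_real_indicator) (auto simp: emeasure_lborel_Icc_eq)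
  have Z_bdd: "\<bar>Z \<omega>\<bar> \<le> B" if "\<omega> \<in> space M" for \<omega>
    unfolding Z_def B_def
    by (rule integral_abs_bound[THEN order_trans], rule integral_mono')
       (use g_bdd[OF that] int_ind C in auto)
  have Z_int: "integrable M Z"
    by (rule integrable_const_bound[of _ B]) (use Z_bdd in auto)
  define R where "R = real_cond_exp M (F t) Z"
  have R_F [measurable]: "R \<in> borel_measurable (F t)"
    by (simp add: R_def)
  have R [measurable]: "R \<in> borel_measurable M"
    using measurable_F[OF t R_F] .
  have R_int: "integrable M R"
    unfolding R_def by (rule real_cond_exp_int[OF Z_int])
  define W where "W \<omega> = Z \<omega> - R \<omega>" for \<omega>
  have W [measurable]: "W \<in> borel_measurable M" and W_int: "integrable M W"
    unfolding W_def using Z_int R_int by auto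
  have orth: "(\<integral>\<omega>. g s \<omega> * W \<omega> \<partial>M) = 0" if s: "s \<in> {a..b} \<longrightarrow> f s \<in> borel_measurable (F t)" for s
  proof -
    have gF: "g s \<in> borel_measurable (F t)"
      using s by (cases "s \<in> {a..b}") (auto simp: g_def[abs_def])
    have gM: "g s \<in> borel_measurable M"
      using measurable_F[OF t gF] .
    have *: "integrable M (\<lambda>\<omega>. g s \<omega> * X \<omega>)" if "integrable M X" for X
      by (rule Bochner_Integration.integrable_bound[of _ "\<lambda>\<omega>. (indicator {a..b} s * C) * X \<omega>"])
         (use that gM g_bdd C in \<open>auto simp: abs_mult intro!: AE_I2 mult_right_mono order_trans[OF g_bdd]\<close>)
    have "(\<integral>\<omega>. g s \<omega> * R \<omega> \<partial>M) = (\<integral>\<omega>. g s \<omega> * Z \<omega> \<partial>M)"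
      unfolding R_def by (rule real_cond_exp_intg[OF *[OF Z_int] gF Z])
    then show ?thesis
      using *[OF Z_int] *[OF R_int] by (simp add: W_def algebra_simps)
  qed
  have "integrable (lborel \<Otimes>\<^sub>M M) (\<lambda>(s, \<omega>). (indicator {a..b} s * C) * W \<omega>)"
    using W_int int_ind
    by (intro pair.Fubini_integrable) (auto simp: abs_mult)
  then have prod_int: "integrable (lborel \<Otimes>\<^sub>M M) (\<lambda>(s, \<omega>). g s \<omega> * W \<omega>)"
    by (rule Bochner_Integration.integrable_bound)
       (use C in \<open>auto simp: space_pair_measure abs_mult intro!: AE_I2 mult_right_mono order_trans[OF g_bdd]\<close>)
  have "(\<integral>\<omega>. Z \<omega> * W \<omega> \<partial>M) = (\<integral>\<omega>. (LBINT s. g s \<omega> * W \<omega>) \<partial>M)"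
    by (simp add: Z_def)
  also have "\<dots> = (LBINT s. (\<integral>\<omega>. g s \<omega> * W \<omega> \<partial>M))"
    by (rule pair.Fubini_integral[OF prod_int])
  also have "\<dots> = (LBINT (s::real). 0)"
  proof (rule integral_cong_AE)
    show "(\<lambda>s. \<integral>\<omega>. g s \<omega> * W \<omega> \<partial>M) \<in> borel_measurable lborel"
      by measurable
    show "AE s in lborel. (\<integral>\<omega>. g s \<omega> * W \<omega> \<partial>M) = 0"
      using adapted by eventually_elim (rule orth)
  qed simp
  finally have ZW: "(\<integral>\<omega>. Z \<omega> * W \<omega> \<partial>M) = 0"
    by simp
  have int_Z: "integrable M (\<lambda>\<omega>. Z \<omega> * X \<omega>)" if "integrable M X" for X
    by (rule Bochner_Integration.integrable_bound[of _ "\<lambda>\<omega>. B * X \<omega>"])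
       (use that Z_bdd in \<open>auto simp: abs_mult intro!: AE_I2 mult_right_mono order_trans[OF Z_bdd]\<close>)
  have RZ: "integrable M (\<lambda>\<omega>. R \<omega> * Z \<omega>)"
    using int_Z[OF R_int] by (simp add: mult.commute)
  have RR: "integrable M (\<lambda>\<omega>. R \<omega> * R \<omega>)" "(\<integral>\<omega>. R \<omega> * R \<omega> \<partial>M) = (\<integral>\<omega>. R \<omega> * Z \<omega> \<partial>M)"
    using real_cond_exp_intg[OF RZ R_F Z] by (simp_all add: R_def)
  have WW_eq: "W \<omega> * W \<omega> = Z \<omega> * W \<omega> - (R \<omega> * Z \<omega> - R \<omega> * R \<omega>)" for \<omega>
    by (simp add: W_def algebra_simps)
  have WW: "integrable M (\<lambda>\<omega>. W \<omega> * W \<omega>)" "(\<integral>\<omega>. W \<omega> * W \<omega> \<partial>M) = 0"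
    unfolding WW_eq using int_Z[OF W_int] RZ RR ZW by auto
  have "AE \<omega> in M. W \<omega> * W \<omega> = 0"
    using integral_nonneg_eq_0_iff_AE[OF WW(1)] WW(2) by simp
  then have "AE \<omega> in M. R \<omega> = Z \<omega>"
    by eventually_elim (simp add: W_def)
  from measurable_F_AE_eq[OF t R_F Z this] show ?thesis
    unfolding Z_eq[abs_def, symmetric] by simp
qed

abbreviation "\<P> \<equiv> predictable_sigma M I F"

lemma predictable_generators:
  "{{0} \<times> B | B. B \<in> sets (F 0)} \<union> {{s<..t} \<times> B | s t B. s \<in> I \<and> t \<in> I \<and> s \<le> t \<and> B \<in> sets (F s)}
    \<subseteq> Pow (I \<times> space M)"
proof -
  have "B \<subseteq> space M" if "B \<in> sets (F s)" "s \<in> I" for B s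
    using sets.sets_into_space[OF that(1)] space_F[OF that(2)] by simp
  moreover have "{s<..t} \<subseteq> I" if "s \<in> I" "t \<in> I" for s t
    using nonneg_I[OF that(1)] downward_closed_I[OF that(2)] by auto
  ultimately show ?thesis
    using zero_in_I by blast
qed

lemma space_predictable [simp]: "space \<P> = I \<times> space M"
  unfolding predictable_sigma_def by (rule space_measure_of[OF predictable_generators])

lemma sets_predictable: "sets \<P> = sigma_sets (I \<times> space M)
    ({{0} \<times> B | B. B \<in> sets (F 0)} \<union> {{s<..t} \<times> B | s t B. s \<in> I \<and> t \<in> I \<and> s \<le> t \<and> B \<in> sets (F s)})"
  unfolding predictable_sigma_def by (rule sets_measure_of[OF predictable_generators])

lemma predictable_zero: "B \<in> sets (F 0) \<Longrightarrow> {0} \<times> B \<in> sets \<P>"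
  unfolding sets_predictable by (rule sigma_sets.Basic) blast

lemma predictable_interval: "s \<in> I \<Longrightarrow> t \<in> I \<Longrightarrow> s \<le> t \<Longrightarrow> B \<in> sets (F s) \<Longrightarrow> {s<..t} \<times> B \<in> sets \<P>"
  unfolding sets_predictable by (rule sigma_sets.Basic) blast

lemma predictable_after:
  assumes "a \<in> I" "B \<in> sets (F a)"
  shows "(I \<inter> {a<..}) \<times> B \<in> sets \<P>"
proof -
  obtain c where c: "range c \<subseteq> I" "incseq c" "\<And>t. t \<in> I \<Longrightarrow> \<exists>n. t \<le> c n"
    using cofinal_sequence by blast
  have "I \<inter> {a<..} = (\<Union>n. {a<..max a (c n)})"
  proof (intro equalityI subsetI)
    have "u \<in> I" if "u \<in> {a<..max a (c n)}" for u n
    proof (rule downward_closed_I)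
      show "c n \<in> I"
        using c(1) by auto
    qed (use that nonneg_I[OF assms(1)] in \<open>auto simp: le_max_iff_disj\<close>)
    then show "u \<in> I \<inter> {a<..}" if "u \<in> (\<Union>n. {a<..max a (c n)})" for u
      using that by auto
    show "u \<in> (\<Union>n. {a<..max a (c n)})" if "u \<in> I \<inter> {a<..}" for u
      using c(3)[of u] that by (auto simp: le_max_iff_disj)
  qed
  then have "(I \<inter> {a<..}) \<times> B = (\<Union>n. {a<..max a (c n)} \<times> B)"
    by auto
  also have "\<dots> \<in> sets \<P>"
    using c(1) assms by (intro sets.countable_UN) (auto intro!: predictable_interval simp: max_def)
  finally show ?thesis .
qed

text \<open>
  Taking \<open>J = UNIV\<close> and \<open>G = M\<close> gives joint measurability, taking \<open>J = {..t}\<close> and \<open>G = F t\<close> gives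
  progressive measurability. A generating rectangle over \<open>(s, t]\<close> has its set in \<open>F s\<close>, and it misses \<open>J\<close>
  altogether unless \<open>s\<close> lies in \<open>J\<close>.
\<close>

lemma predictable_slice:
  assumes D: "D \<in> sets \<P>" and J [measurable]: "J \<in> sets borel"
    and down: "\<And>u s. u \<in> J \<Longrightarrow> s \<le> u \<Longrightarrow> s \<in> J"
    and G: "\<And>s. s \<in> I \<Longrightarrow> s \<in> J \<Longrightarrow> sets (F s) \<subseteq> sets G" and space_G: "space G = space M"
  shows "D \<inter> (J \<times> space M) \<in> sets (borel \<Otimes>\<^sub>M G)"
  using D unfolding sets_predictable
proof (induction rule: sigma_sets.induct)
  case (Basic D)
  show ?case
  proof (rule UnE[OF Basic])
    assume "D \<in> {{0} \<times> B | B. B \<in> sets (F 0)}"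
    then obtain B where B: "D = {0} \<times> B" "B \<in> sets (F 0)" by blast
    show ?case
    proof (cases "0 \<in> J")
      case True
      then have "D \<inter> (J \<times> space M) = {0} \<times> B" "B \<in> sets G"
        using B G[OF zero_in_I] sets.sets_into_space[OF B(2)] space_F[OF zero_in_I] by auto
      then show ?thesis by simp
    next
      case False
      then have "D \<inter> (J \<times> space M) = {}" using B by auto
      then show ?thesis by simp
    qed
  next
    assume "D \<in> {{s<..t} \<times> B | s t B. s \<in> I \<and> t \<in> I \<and> s \<le> t \<and> B \<in> sets (F s)}"
    then obtain s t B where B: "D = {s<..t} \<times> B" "B \<in> sets (F s)" "s \<in> I" by blast
    show ?case
    proof (cases "s \<in> J")
      case True
      then have "D \<inter> (J \<times> space M) = ({s<..t} \<inter> J) \<times> B" "B \<in> sets G"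
        using B G[OF B(3)] sets.sets_into_space[OF B(2)] space_F[OF B(3)] by auto
      then show ?thesis by simp
    next
      case False
      then have "D \<inter> (J \<times> space M) = {}"
        using B down by (auto intro: less_imp_le)
      then show ?thesis by simp
    qed
  qed
next
  case Empty
  then show ?case by simp
next
  case (Compl D)
  have "(I \<times> space M - D) \<inter> (J \<times> space M) = ((I \<inter> J) \<times> space G) - (D \<inter> (J \<times> space M))"
    by (auto simp: space_G)
  also have "\<dots> \<in> sets (borel \<Otimes>\<^sub>M G)"
    using Compl by (intro sets.Diff) auto
  finally show ?case .
next
  case (Union D)
  have "(\<Union>i. D i) \<inter> (J \<times> space M) = (\<Union>i. D i \<inter> (J \<times> space M))"
    by auto
  also have "\<dots> \<in> sets (borel \<Otimes>\<^sub>M G)"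
    using Union(2) by (intro sets.countable_UN) auto
  finally show ?case .
qed

lemma predictable_imp_jointly_measurable:
  assumes X: "predictable M I F X" and J [measurable]: "J \<in> sets borel"
    and down: "\<And>u s. u \<in> J \<Longrightarrow> s \<le> u \<Longrightarrow> s \<in> J"
    and G: "\<And>s. s \<in> I \<Longrightarrow> s \<in> J \<Longrightarrow> sets (F s) \<subseteq> sets G" and space_G: "space G = space M"
  shows "(\<lambda>(u, \<omega>). indicator (I \<inter> J) u * X u \<omega>) \<in> borel_measurable (borel \<Otimes>\<^sub>M G)"
proof -
  let ?R = "restrict_space (borel \<Otimes>\<^sub>M G) ((I \<inter> J) \<times> space M)"
  have "(\<lambda>x. case x of (u, \<omega>) \<Rightarrow> X u \<omega>) \<in> borel_measurable ?R"
  proof (rule measurableI)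
    fix A :: "real set" assume A: "A \<in> sets borel"
    let ?D = "(\<lambda>x. case x of (u, \<omega>) \<Rightarrow> X u \<omega>) -` A \<inter> space \<P>"
    have "?D \<in> sets \<P>"
      using X A unfolding predictable_def by (rule measurable_sets)
    from predictable_slice[OF this J down G space_G]
    have "?D \<inter> J \<times> space M \<in> sets (borel \<Otimes>\<^sub>M G)" .
    moreover have "(\<lambda>x. case x of (u, \<omega>) \<Rightarrow> X u \<omega>) -` A \<inter> space ?R = ((I \<inter> J) \<times> space M) \<inter> (?D \<inter> J \<times> space M)"
      by (auto simp: space_restrict_space space_pair_measure space_G)
    ultimately show "(\<lambda>x. case x of (u, \<omega>) \<Rightarrow> X u \<omega>) -` A \<inter> space ?R \<in> sets ?R"
      unfolding sets_restrict_space by blast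
  qed simp
  moreover have "(I \<inter> J) \<times> space M \<inter> space (borel \<Otimes>\<^sub>M G) \<in> sets (borel \<Otimes>\<^sub>M G)"
    by (auto simp: space_G[symmetric] space_pair_measure intro!: sets.Int)
  ultimately have "(\<lambda>x. indicator ((I \<inter> J) \<times> space M) x *\<^sub>R (case x of (u, \<omega>) \<Rightarrow> X u \<omega>)) \<in> borel_measurable (borel \<Otimes>\<^sub>M G)"
    using borel_measurable_restrict_space_iff by blast
  then show ?thesis
    by (rule measurable_cong[THEN iffD1, rotated]) (auto simp: space_pair_measure space_G indicator_def)
qed

lemma predictable_measurable_pair:
  assumes "predictable M I F X"
  shows "(\<lambda>(u, \<omega>). indicator I u * X u \<omega>) \<in> borel_measurable (borel \<Otimes>\<^sub>M M)"
  using predictable_imp_jointly_measurable[OF assms, of UNIV M] sets_F by simp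

lemma predictable_progressive:
  assumes "predictable M I F X" "t \<in> I"
  shows "(\<lambda>(u, \<omega>). indicator (I \<inter> {..t}) u * X u \<omega>) \<in> borel_measurable (borel \<Otimes>\<^sub>M F t)"
  by (rule predictable_imp_jointly_measurable[OF assms(1)])
     (use assms mono space_F in auto)

lemma predictable_adapted:
  assumes "predictable M I F X" "t \<in> I"
  shows "X t \<in> borel_measurable (F t)"
  using measurable_Pair2[OF predictable_progressive[OF assms], of t] assms(2) by simp

lemma predictable_time_integral:
  assumes "predictable M I F X" "t \<in> I"
  shows "(\<lambda>\<omega>. LBINT u:{0..t}. X u \<omega>) \<in> borel_measurable (F t)"
proof -
  have [measurable]: "(\<lambda>(u, \<omega>). indicator (I \<inter> {..t}) u * X u \<omega>) \<in> borel_measurable (borel \<Otimes>\<^sub>M F t)"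
    by (rule predictable_progressive[OF assms])
  have "(\<lambda>\<omega>. LBINT u. indicator (I \<inter> {..t}) u * X u \<omega>) \<in> borel_measurable (F t)"
    by (rule lborel.borel_measurable_lebesgue_integral) measurable
  moreover have "I \<inter> {..t} = {0..t}"
    using downward_closed_I[OF assms(2)] by (auto intro: nonneg_I)
  ultimately show ?thesis
    by (simp add: set_lebesgue_integral_def)
qed

lemma path_measurable:
  assumes "predictable M I F X" "\<omega> \<in> space M"
  shows "(\<lambda>u. indicator I u * X u \<omega>) \<in> borel_measurable borel"
  using measurable_Pair1[OF predictable_measurable_pair[OF assms(1)] assms(2)] by simp

lemma path_integral_cong:
  fixes f g :: "real \<Rightarrow> real"
  assumes f: "(\<lambda>u. indicator I u * f u) \<in> borel_measurable borel"
    and g: "(\<lambda>u. indicator I u * g u) \<in> borel_measurable borel"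
    and eq: "AE u in lborel. u \<in> I \<longrightarrow> f u = g u" and t: "t \<in> I"
  shows "set_integrable lborel {0..t} f \<longleftrightarrow> set_integrable lborel {0..t} g"
    and "(LBINT u:{0..t}. f u) = (LBINT u:{0..t}. g u)"
proof -
  have restrict: "(\<lambda>u. indicator {0..t} u *\<^sub>R h u) = (\<lambda>u. indicator {0..t} u * (indicator I u * h u))" for h :: "real \<Rightarrow> real"
    using downward_closed_I[OF t] by (auto simp: indicator_def fun_eq_iff)
  have meas: "(\<lambda>u. indicator {0..t} u *\<^sub>R f u) \<in> borel_measurable lborel"
    "(\<lambda>u. indicator {0..t} u *\<^sub>R g u) \<in> borel_measurable lborel"
    unfolding restrict using f g by simp_all
  have ae: "AE u in lborel. indicator {0..t} u *\<^sub>R f u = indicator {0..t} u *\<^sub>R g u"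
    using eq by eventually_elim (use downward_closed_I[OF t] in \<open>auto simp: indicator_def\<close>)
  show "set_integrable lborel {0..t} f \<longleftrightarrow> set_integrable lborel {0..t} g"
    unfolding set_integrable_def by (rule integrable_cong_AE[OF meas ae])
  show "(LBINT u:{0..t}. f u) = (LBINT u:{0..t}. g u)"
    unfolding set_lebesgue_integral_def by (rule integral_cong_AE[OF meas ae])
qed

text \<open>
  The generating rectangles are stable under intersection, because the base of an intersection lies in
  \<open>F (max s s')\<close>; so Dynkin's theorem applies to them.
\<close>

lemma predictable_emeasure_eqI:
  assumes sets: "sets \<mu> = sets (borel \<Otimes>\<^sub>M M)" "sets \<nu> = sets (borel \<Otimes>\<^sub>M M)"
    and zero: "\<And>B. B \<in> sets (F 0) \<Longrightarrow> emeasure \<mu> ({0} \<times> B) = emeasure \<nu> ({0} \<times> B)"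
    and rect: "\<And>s t B. s \<in> I \<Longrightarrow> t \<in> I \<Longrightarrow> s \<le> t \<Longrightarrow> B \<in> sets (F s) \<Longrightarrow>
      emeasure \<mu> ({s<..t} \<times> B) = emeasure \<nu> ({s<..t} \<times> B)"
    and fin: "emeasure \<mu> (I \<times> space M) < \<infinity>"
    and D: "D \<in> sets \<P>"
  shows "emeasure \<mu> D = emeasure \<nu> D"
proof -
  let ?G = "{{0} \<times> B | B. B \<in> sets (F 0)} \<union> {{s<..t} \<times> B | s t B. s \<in> I \<and> t \<in> I \<and> s \<le> t \<and> B \<in> sets (F s)}"
  have P_pair: "D \<in> sets (borel \<Otimes>\<^sub>M M)" if "D \<in> sets \<P>" for D
  proof -
    have "D \<inter> (UNIV \<times> space M) \<in> sets (borel \<Otimes>\<^sub>M M)"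
      by (rule predictable_slice[OF that]) (use sets_F in auto)
    moreover have "D \<inter> (UNIV \<times> space M) = D"
      using sets.sets_into_space[OF that] by auto
    ultimately show ?thesis by simp
  qed
  have P\<mu>: "D \<in> sets \<mu>" and P\<nu>: "D \<in> sets \<nu>" if "D \<in> sets \<P>" for D
    using P_pair[OF that] sets by auto
  have stable: "Int_stable ?G"
  proof (rule Int_stableI)
    fix X Y assume X: "X \<in> ?G" and Y: "Y \<in> ?G"
    have empty: "{} \<in> ?G"
      using zero_in_I by (intro UnI1) (auto intro!: exI[of _ "{}"])
    have zero_interval: "({0} \<times> B) \<inter> ({s<..t} \<times> C) = {}" if "s \<in> I" for s t :: real and B C :: "'w set"
      using nonneg_I[OF that] by auto
    consider (zz) B C where "X = {0} \<times> B" "Y = {0} \<times> C" "B \<in> sets (F 0)" "C \<in> sets (F 0)"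
      | (disj) "X \<inter> Y = {}"
      | (ii) s t B s' t' C where "X = {s<..t} \<times> B" "Y = {s'<..t'} \<times> C" "s \<in> I" "t \<in> I" "s' \<in> I" "t' \<in> I"
          "B \<in> sets (F s)" "C \<in> sets (F s')"
      using X Y zero_interval by (auto simp: Int_commute)
    then show "X \<inter> Y \<in> ?G"
    proof cases
      case zz
      then have "X \<inter> Y = {0} \<times> (B \<inter> C)" "B \<inter> C \<in> sets (F 0)"
        by auto
      then show ?thesis by blast
    next
      case disj
      then show ?thesis using empty by simp
    next
      case ii
      have eq: "X \<inter> Y = {max s s'<..min t t'} \<times> (B \<inter> C)"
        using ii by auto
      show ?thesis
      proof (cases "max s s' \<le> min t t'")
        case True
        have m: "max s s' \<in> I" "min t t' \<in> I"
          using ii by (auto simp: max_def min_def)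
        have "B \<inter> C \<in> sets (F (max s s'))"
          using ii mono[OF ii(3) m(1)] mono[OF ii(5) m(1)] by auto
        then show ?thesis
          unfolding eq using m True by blast
      next
        case False
        then have "{max s s'<..min t t'} = {}"
          by (intro greaterThanAtMost_empty) linarith
        then have "X \<inter> Y = {}"
          unfolding eq by (simp only: Sigma_empty1)
        then show ?thesis using empty by simp
      qed
    qed
  qed
  have space_F0: "space M \<in> sets (F s)" if "s \<in> I" for s
    using sets.top[of "F s"] space_F[OF that] by simp
  \<comment> \<open>The whole time set need not be a generator when the horizon is half open; it is exhausted
    by bounded intervals.\<close>
  have total: "emeasure \<mu> (I \<times> space M) = emeasure \<nu> (I \<times> space M)"
  proof -
    obtain c where c: "range c \<subseteq> I" "incseq c" "\<And>t. t \<in> I \<Longrightarrow> \<exists>n. t \<le> c n"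
      using cofinal_sequence by blast
    have cI: "c n \<in> I" "0 \<le> c n" for n
      using c(1) nonneg_I by auto
    let ?A = "\<lambda>n. {0<..c n} \<times> space M"
    have A: "?A n \<in> sets \<P>" for n
      by (rule predictable_interval[OF zero_in_I cI space_F0[OF zero_in_I]])
    have inc: "incseq ?A"
      using c(2) by (fastforce simp: incseq_def intro: order_trans)
    have "emeasure \<mu> (\<Union>n. ?A n) = (SUP n. emeasure \<mu> (?A n))"
      by (rule SUP_emeasure_incseq[symmetric]) (use inc P\<mu>[OF A] in auto)
    also have "\<dots> = (SUP n. emeasure \<nu> (?A n))"
      using rect[OF zero_in_I cI space_F0[OF zero_in_I]] by simp
    also have "\<dots> = emeasure \<nu> (\<Union>n. ?A n)"
      by (rule SUP_emeasure_incseq) (use inc P\<nu>[OF A] in auto)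
    finally have eqA: "emeasure \<mu> (\<Union>n. ?A n) = emeasure \<nu> (\<Union>n. ?A n)" .
    have U: "(\<Union>n. ?A n) \<in> sets \<P>"
      using A by blast
    have Z: "{0} \<times> space M \<in> sets \<P>"
      by (rule predictable_zero[OF space_F0[OF zero_in_I]])
    have disj: "({0} \<times> space M) \<inter> (\<Union>n. ?A n) = {}"
      by auto
    have split: "I \<times> space M = ({0} \<times> space M) \<union> (\<Union>n. ?A n)"
    proof (intro equalityI subsetI)
      fix x assume "x \<in> I \<times> space M"
      then obtain u \<omega> where x: "x = (u, \<omega>)" "u \<in> I" "\<omega> \<in> space M" by blast
      then show "x \<in> ({0} \<times> space M) \<union> (\<Union>n. ?A n)"
        using c(3)[OF x(2)] nonneg_I[OF x(2)] by (cases "u = 0") auto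
    next
      fix x assume "x \<in> ({0} \<times> space M) \<union> (\<Union>n. ?A n)"
      then show "x \<in> I \<times> space M"
        using zero_in_I downward_closed_I[OF cI(1)] by auto
    qed
    show ?thesis
      unfolding split
      using plus_emeasure[OF P\<mu>[OF Z] P\<mu>[OF U] disj] plus_emeasure[OF P\<nu>[OF Z] P\<nu>[OF U] disj]
        eqA zero[OF space_F0[OF zero_in_I]] by simp
  qed
  have top: "I \<times> space M \<in> sets \<P>"
    using sets.top[of \<P>] by simp
  from stable predictable_generators D[unfolded sets_predictable] show ?thesis
  proof (induction rule: sigma_sets_induct_disjoint)
    case (basic X)
    then show ?case
      using zero rect by blast
  next
    case empty
    show ?case by simp
  next
    case (compl X)
    then have X: "X \<in> sets \<P>"
      by (simp add: sets_predictable)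
    then have sub: "X \<subseteq> I \<times> space M"
      using sets.sets_into_space by fastforce
    have "emeasure \<mu> X \<noteq> \<infinity>"
      using emeasure_mono[OF sub P\<mu>[OF top]] fin by (auto simp: top_unique)
    then show ?case
      using emeasure_Diff[OF _ P\<mu>[OF top] P\<mu>[OF X] sub] emeasure_Diff[OF _ P\<nu>[OF top] P\<nu>[OF X] sub]
        compl(2) total by simp
  next
    case (union X)
    have X: "range X \<subseteq> sets \<P>"
      using union(2) by (simp add: sets_predictable)
    have "emeasure \<mu> (\<Union>i. X i) = (\<Sum>i. emeasure \<mu> (X i))"
      by (rule suminf_emeasure[symmetric]) (use union(1) X P\<mu> in auto)
    moreover have "emeasure \<nu> (\<Union>i. X i) = (\<Sum>i. emeasure \<nu> (X i))"
      by (rule suminf_emeasure[symmetric]) (use union(1) X P\<nu> in auto)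
    ultimately show ?case
      using union(3) by simp
  qed
qed

section \<open>Predictable versions of adapted processes\<close>

lemma predictable_step:
  fixes \<xi> :: "'w \<Rightarrow> real"
  assumes "a \<in> I" and \<xi>: "\<xi> \<in> borel_measurable (F a)"
  shows "(\<lambda>(t, \<omega>). if a < t then \<xi> \<omega> else 0) \<in> borel_measurable \<P>"
proof -
  let ?S = "(I \<inter> {a<..}) \<times> space M"
  let ?R = "restrict_space \<P> ?S"
  have S: "?S \<in> sets \<P>"
    using predictable_after[OF assms(1), of "space M"] space_F[OF assms(1)] sets.top[of "F a"] by simp
  have "(\<lambda>x. \<xi> (snd x)) \<in> borel_measurable ?R"
  proof (rule measurableI)
    fix A :: "real set" assume "A \<in> sets borel"
    then have "\<xi> -` A \<inter> space (F a) \<in> sets (F a)"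
      by (rule measurable_sets[OF \<xi>])
    then have "(I \<inter> {a<..}) \<times> (\<xi> -` A \<inter> space M) \<in> sets \<P>"
      using predictable_after[OF assms(1)] space_F[OF assms(1)] by simp
    moreover have "(\<lambda>x. \<xi> (snd x)) -` A \<inter> space ?R = ?S \<inter> ((I \<inter> {a<..}) \<times> (\<xi> -` A \<inter> space M))"
      by (auto simp: space_restrict_space)
    ultimately show "(\<lambda>x. \<xi> (snd x)) -` A \<inter> space ?R \<in> sets ?R"
      unfolding sets_restrict_space by blast
  qed simp
  then have "(\<lambda>x. indicator ?S x *\<^sub>R \<xi> (snd x)) \<in> borel_measurable \<P>"
    by (rule borel_measurable_restrict_space_iff[OF sets.Int[OF S sets.top], THEN iffD1])
  then show ?thesis
    by (rule measurable_cong[THEN iffD1, rotated]) (auto simp: indicator_def split: if_splits)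
qed

lemma predictable_time: "(\<lambda>(t, \<omega>). t) \<in> borel_measurable \<P>"
proof -
  have "{x \<in> space \<P>. c < fst x} \<in> sets \<P>" for c
  proof (cases "c \<in> I")
    case True
    have "{x \<in> space \<P>. c < fst x} = (I \<inter> {c<..}) \<times> space M"
      by auto
    then show ?thesis
      using predictable_after[OF True, of "space M"] space_F[OF True] sets.top[of "F c"] by simp
  next
    case False
    show ?thesis
    proof (cases "c < 0")
      case True
      then have "{x \<in> space \<P>. c < fst x} = space \<P>"
        using nonneg_I by fastforce
      then show ?thesis
        using sets.top[of \<P>] by simp
    next
      case c: False
      have "\<not> c < t" if "t \<in> I" for t
        using downward_closed_I[OF that, of c] False c by auto
      then have "{x \<in> space \<P>. c < fst x} = {}"
        by auto
      then show ?thesis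
        by (simp only: sets.empty_sets)
    qed
  qed
  then have "fst \<in> borel_measurable \<P>"
    by (subst borel_measurable_iff_greater) auto
  then show ?thesis
    by (simp add: case_prod_unfold)
qed

text \<open>
  On each grid interval the average is constant in time, with a value that is known at the left end
  point of the interval. The values of \<open>f\<close> outside the time interval must be \<open>0\<close> because averages
  near time \<open>0\<close> reach into negative times.
\<close>

lemma predictable_left_average:
  fixes f :: "real \<Rightarrow> 'w \<Rightarrow> real"
  assumes meas: "(\<lambda>(s, \<omega>). f s \<omega>) \<in> borel_measurable (lborel \<Otimes>\<^sub>M M)"
    and bdd: "\<And>s \<omega>. \<omega> \<in> space M \<Longrightarrow> \<bar>f s \<omega>\<bar> \<le> C"
    and zero: "\<And>s \<omega>. s \<notin> I \<Longrightarrow> f s \<omega> = 0"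
    and adapted: "AE s in lborel. s \<in> I \<longrightarrow> f s \<in> borel_measurable (F s)"
  shows "predictable M I F (\<lambda>t \<omega>. left_average n (\<lambda>s. f s \<omega>) t)"
proof -
  define a where "a i = real_of_int i / real (Suc n)" for i :: int
  define \<xi> where "\<xi> i \<omega> = real (Suc n) * (LBINT s:{a i - 1 / real (Suc n)..a i}. f s \<omega>)" for i \<omega>
  have \<xi>: "\<xi> i \<in> borel_measurable (F (a i))" if "a i \<in> I" for i
    unfolding \<xi>_def
  proof (intro borel_measurable_times borel_measurable_const time_integral_measurable_F[OF that meas bdd])
    show "AE s in lborel. s \<in> {a i - 1 / real (Suc n)..a i} \<longrightarrow> f s \<in> borel_measurable (F (a i))"
      using adapted
    proof (rule AE_mp, intro AE_I2 impI)
      fix s assume s: "s \<in> I \<longrightarrow> f s \<in> borel_measurable (F s)" "s \<in> {a i - 1 / real (Suc n)..a i}"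
      show "f s \<in> borel_measurable (F (a i))"
      proof (cases "s \<in> I")
        case True
        have "subalgebra (F (a i)) (F s)"
          using mono[OF True that] s(2) space_F[OF that] space_F[OF True] by (simp add: subalgebra_def)
        then show ?thesis
          using s(1) True measurable_from_subalg by blast
      next
        case False
        then have "f s = (\<lambda>\<omega>. 0)"
          using zero by blast
        then show ?thesis by simp
      qed
    qed
  qed
  define h where "h i = (\<lambda>(t :: real, \<omega>). if a i \<in> I \<and> a i < t then \<xi> i \<omega> else 0)" for i
  have h: "h i \<in> borel_measurable \<P>" for i
  proof (cases "a i \<in> I")
    case True
    then show ?thesis
      using predictable_step[OF True \<xi>[OF True]] by (simp add: h_def)
  next
    case False
    then have "h i = (\<lambda>_. 0)"
      by (auto simp: h_def)
    then show ?thesis by simp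
  qed
  \<comment> \<open>The number of the grid interval that contains the time; it is negative only at time 0.\<close>
  define k where "k = (\<lambda>(t, \<omega> :: 'w). \<lceil>t * real (Suc n)\<rceil> - 1)"
  have "k \<in> measurable \<P> (count_space UNIV)"
  proof -
    have "(\<lambda>x. fst x) \<in> borel_measurable \<P>"
      using predictable_time by (simp add: case_prod_unfold)
    then have "(\<lambda>x. \<lceil>fst x * real (Suc n)\<rceil> - 1) \<in> measurable \<P> (count_space UNIV)"
      by measurable
    then show ?thesis
      by (simp add: k_def case_prod_unfold)
  qed
  then have "(\<lambda>x. h (k x) x) \<in> borel_measurable \<P>"
    by (rule measurable_compose_countable[OF h])
  moreover have "h (k x) x = (case x of (t, \<omega>) \<Rightarrow> left_average n (\<lambda>s. f s \<omega>) t)" if x: "x \<in> space \<P>" for x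
  proof -
    obtain t \<omega> where t: "x = (t, \<omega>)" "t \<in> I"
      using x by auto
    have a: "a (k x) = left_grid_point n t"
      by (simp add: t k_def a_def left_grid_point_def)
    have less: "a (k x) < t"
      using left_grid_point_bounds(1) by (simp add: a)
    show ?thesis
    proof (cases "0 \<le> a (k x)")
      case True
      then have "a (k x) \<in> I"
        using downward_closed_I[OF t(2), of "a (k x)"] less by simp
      then show ?thesis
        using less by (simp add: t(1) h_def \<xi>_def left_average_def a[unfolded t(1)])
    next
      case False
      then have "a (k x) \<notin> I"
        using nonneg_I by blast
      moreover have "(LBINT s:{left_grid_point n t - 1 / real (Suc n)..left_grid_point n t}. f s \<omega>) = (LBINT (s::real). 0)"
        unfolding set_lebesgue_integral_def
      proof (rule Bochner_Integration.integral_cong[OF refl])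
        fix s :: real
        show "indicator {left_grid_point n t - 1 / real (Suc n)..left_grid_point n t} s *\<^sub>R f s \<omega> = 0"
        proof (cases "s \<le> left_grid_point n t")
          case True
          then have "s \<notin> I"
            using False nonneg_I[of s] by (auto simp: a)
          then show ?thesis
            by (simp add: zero)
        qed simp
      qed
      ultimately show ?thesis
        by (simp add: t(1) h_def left_average_def)
    qed
  qed
  ultimately show ?thesis
    unfolding predictable_def by (rule measurable_cong[THEN iffD1, rotated])
qed

lemma bounded_predictable_version:
  fixes f :: "real \<Rightarrow> 'w \<Rightarrow> real"
  assumes meas: "(\<lambda>(s, \<omega>). f s \<omega>) \<in> borel_measurable (lborel \<Otimes>\<^sub>M M)"
    and bdd: "\<And>s \<omega>. \<omega> \<in> space M \<Longrightarrow> \<bar>f s \<omega>\<bar> \<le> C"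
    and zero: "\<And>s \<omega>. s \<notin> I \<Longrightarrow> f s \<omega> = 0"
    and adapted: "AE s in lborel. s \<in> I \<longrightarrow> f s \<in> borel_measurable (F s)"
  shows "\<exists>g. predictable M I F g \<and> (\<forall>\<omega>\<in>space M. AE t in lborel. g t \<omega> = f t \<omega>)"
proof (intro exI conjI ballI)
  let ?g = "\<lambda>t \<omega>. lim (\<lambda>n. left_average n (\<lambda>s. f s \<omega>) t)"
  show "predictable M I F ?g"
  proof -
    have "predictable M I F (\<lambda>t \<omega>. left_average n (\<lambda>s. f s \<omega>) t)" for n
      by (rule predictable_left_average) fact+
    then show ?thesis
      unfolding predictable_def case_prod_unfold by (rule borel_measurable_lim_metric)
  qed
  fix \<omega> assume \<omega>: "\<omega> \<in> space M"
  have "(\<lambda>s. f s \<omega>) \<in> borel_measurable borel"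
    using measurable_Pair1[OF meas \<omega>] by simp
  from left_average_tendsto[OF this bdd[OF \<omega>]]
  show "AE t in lborel. ?g t \<omega> = f t \<omega>"
    by eventually_elim (rule limI)
qed

text \<open>
  The transform \<open>f / (1 + f)\<close> is injective on nonnegative numbers and reduces the claim to bounded
  processes, whose averages over grid intervals exist.
\<close>

lemma predictable_version:
  fixes f :: "real \<Rightarrow> 'w \<Rightarrow> real"
  assumes meas: "(\<lambda>(s, \<omega>). indicator I s * f s \<omega>) \<in> borel_measurable (lborel \<Otimes>\<^sub>M M)"
    and nonneg: "\<And>s \<omega>. s \<in> I \<Longrightarrow> \<omega> \<in> space M \<Longrightarrow> 0 \<le> f s \<omega>"
    and adapted: "AE s in lborel. s \<in> I \<longrightarrow> f s \<in> borel_measurable (F s)"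
  shows "\<exists>g. predictable M I F g \<and> (\<forall>t \<omega>. 0 \<le> g t \<omega>) \<and>
    (\<forall>\<omega>\<in>space M. AE t in lborel. t \<in> I \<longrightarrow> g t \<omega> = f t \<omega>)"
proof -
  define f' where "f' s \<omega> = (indicator I s * f s \<omega>) / (1 + \<bar>indicator I s * f s \<omega>\<bar>)" for s \<omega>
  have "\<exists>g. predictable M I F g \<and> (\<forall>\<omega>\<in>space M. AE t in lborel. g t \<omega> = f' t \<omega>)"
  proof (rule bounded_predictable_version)
    show "(\<lambda>(s, \<omega>). f' s \<omega>) \<in> borel_measurable (lborel \<Otimes>\<^sub>M M)"
      using meas unfolding f'_def case_prod_unfold by measurable
    show "\<bar>f' s \<omega>\<bar> \<le> 1" for s \<omega>
      unfolding f'_def abs_divide by (subst divide_le_eq_1_pos) linarith+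
    show "f' s \<omega> = 0" if "s \<notin> I" for s \<omega>
      using that by (simp add: f'_def)
    show "AE s in lborel. s \<in> I \<longrightarrow> f' s \<in> borel_measurable (F s)"
      using adapted
    proof eventually_elim
      case (elim s)
      show ?case
      proof
        assume "s \<in> I"
        then have [measurable]: "f s \<in> borel_measurable (F s)"
          using elim by blast
        show "f' s \<in> borel_measurable (F s)"
          unfolding f'_def[abs_def] by measurable
      qed
    qed
  qed
  then obtain g where g: "predictable M I F g"
    "\<And>\<omega>. \<omega> \<in> space M \<Longrightarrow> AE t in lborel. g t \<omega> = f' t \<omega>"
    by blast
  \<comment> \<open>The inverse of the transform, with an arbitrary nonnegative value off its range.\<close>
  define \<psi> :: "real \<Rightarrow> real" where "\<psi> x = (if 0 \<le> x \<and> x < 1 then x / (1 - x) else 0)" for x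
  have [measurable]: "\<psi> \<in> borel_measurable borel"
    unfolding \<psi>_def by measurable
  have inv: "\<psi> (f' t \<omega>) = f t \<omega>" if "t \<in> I" "\<omega> \<in> space M" for t \<omega>
    using nonneg[OF that] that(1) by (simp add: \<psi>_def f'_def field_simps)
  show ?thesis
  proof (intro exI conjI allI ballI)
    show "predictable M I F (\<lambda>t \<omega>. \<psi> (g t \<omega>))"
      using g(1) unfolding predictable_def case_prod_unfold by measurable
    show "0 \<le> \<psi> (g t \<omega>)" for t \<omega>
      by (simp add: \<psi>_def)
    show "AE t in lborel. t \<in> I \<longrightarrow> \<psi> (g t \<omega>) = f t \<omega>" if "\<omega> \<in> space M" for \<omega>
      using g(2)[OF that] by eventually_elim (simp add: inv that)
  qed
qed

section \<open>Stopped martingales\<close>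

text \<open>
  The martingale property against a bounded test variable known at the earlier time, free of
  conditional expectations.
\<close>

lemma martingale_test:
  assumes X: "martingale M I F X" and r: "r \<in> I" and t: "t \<in> I" and "r \<le> t"
    and g [measurable]: "g \<in> borel_measurable (F r)" and bdd: "\<And>\<omega>. \<omega> \<in> space M \<Longrightarrow> \<bar>g \<omega>\<bar> \<le> C"
  shows "integrable M (\<lambda>\<omega>. g \<omega> * X r \<omega>)" "integrable M (\<lambda>\<omega>. g \<omega> * X t \<omega>)"
    and "(\<integral>\<omega>. g \<omega> * X t \<omega> \<partial>M) = (\<integral>\<omega>. g \<omega> * X r \<omega> \<partial>M)"
proof -
  interpret sigma_finite_subalgebra M "F r"
    by (rule sigma_finite_subalgebra_F[OF r])
  have gM [measurable]: "g \<in> borel_measurable M"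
    using measurable_F[OF r g] .
  have Xint: "integrable M (X u)" if "u \<in> I" for u
    using X that by (simp add: martingale_def)
  have C: "0 \<le> C"
    using bdd not_empty by force
  have *: "integrable M (\<lambda>\<omega>. g \<omega> * X u \<omega>)" if "u \<in> I" for u
    by (rule Bochner_Integration.integrable_bound[of _ "\<lambda>\<omega>. C * X u \<omega>"])
       (use Xint[OF that] C in \<open>auto simp: abs_mult intro!: AE_I2 mult_right_mono bdd\<close>)
  show "integrable M (\<lambda>\<omega>. g \<omega> * X r \<omega>)" "integrable M (\<lambda>\<omega>. g \<omega> * X t \<omega>)"
    using *[OF r] *[OF t] .
  have "(\<integral>\<omega>. g \<omega> * X t \<omega> \<partial>M) = (\<integral>\<omega>. g \<omega> * real_cond_exp M (F r) (X t) \<omega> \<partial>M)"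
    using real_cond_exp_intg(2)[OF *[OF t] g] Xint[OF t] by simp
  also have "\<dots> = (\<integral>\<omega>. g \<omega> * X r \<omega> \<partial>M)"
  proof (rule integral_cong_AE)
    have "AE \<omega> in M. real_cond_exp M (F r) (X t) \<omega> = X r \<omega>"
      using X r t \<open>r \<le> t\<close> by (simp add: martingale_def)
    then show "AE \<omega> in M. g \<omega> * real_cond_exp M (F r) (X t) \<omega> = g \<omega> * X r \<omega>"
      by eventually_elim simp
  qed (use Xint[OF r] in auto)
  finally show "(\<integral>\<omega>. g \<omega> * X t \<omega> \<partial>M) = (\<integral>\<omega>. g \<omega> * X r \<omega> \<partial>M)" .
qed

text \<open>
  Optional sampling at a stopping time with finitely many values, tested against a function \<open>\<phi>\<close> of the
  sampled value \<open>S\<close> itself, which is known at the time of sampling. This extra test function replaces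
  uniform integrability in the passage to the limit.
\<close>

lemma grid_stopping:
  fixes r :: "nat \<Rightarrow> real" and idx :: "'w \<Rightarrow> nat"
  assumes X: "martingale M I F X" and s: "s \<in> I" and t: "t \<in> I" and B: "B \<in> sets (F s)"
    and r: "\<And>i. i \<le> m \<Longrightarrow> s \<le> r i \<and> r i \<le> t"
    and idx: "\<And>\<omega>. \<omega> \<in> space M \<Longrightarrow> idx \<omega> \<le> m"
      "\<And>i. i \<le> m \<Longrightarrow> {\<omega> \<in> space M. idx \<omega> = i} \<in> sets (F (r i))"
    and \<phi> [measurable]: "\<phi> \<in> borel_measurable borel" and bdd: "\<And>x :: real. \<bar>\<phi> x\<bar> \<le> C"
  defines "S \<equiv> \<lambda>\<omega>. X (r (idx \<omega>)) \<omega>"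
  shows "S \<in> borel_measurable M"
    and "(\<integral>\<omega>. indicator B \<omega> * \<phi> (S \<omega>) * S \<omega> \<partial>M) = (\<integral>\<omega>. indicator B \<omega> * \<phi> (S \<omega>) * X t \<omega> \<partial>M)"
    and "integrable M (\<lambda>\<omega>. indicator B \<omega> * \<phi> (S \<omega>) * S \<omega>)"
proof -
  have rI: "r i \<in> I" "s \<le> r i" "r i \<le> t" if "i \<le> m" for i
    using downward_closed_I[OF t, of "r i"] r[OF that] nonneg_I[OF s] by auto
  have XF: "X (r i) \<in> borel_measurable (F (r i))" if "i \<le> m" for i
    using X rI[OF that] by (simp add: martingale_def)
  define A where "A i = {\<omega> \<in> space M. idx \<omega> = i}" for i
  have AF: "A i \<in> sets (F (r i))" if "i \<le> m" for i
    using idx(2)[OF that] by (simp add: A_def)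
  have pick: "(\<Sum>i\<le>m. indicator (A i) \<omega> * h i) = h (idx \<omega>)" if "\<omega> \<in> space M" for h :: "nat \<Rightarrow> real" and \<omega>
  proof -
    have "(\<Sum>i\<le>m. indicator (A i) \<omega> * h i) = (\<Sum>i\<le>m. if i = idx \<omega> then h i else 0)"
      using that by (intro sum.cong) (auto simp: A_def)
    then show ?thesis
      using idx(1)[OF that] by (simp add: sum.delta)
  qed
  have "(\<lambda>\<omega>. \<Sum>i\<le>m. indicator (A i) \<omega> * X (r i) \<omega>) \<in> borel_measurable M"
  proof (intro borel_measurable_sum borel_measurable_times)
    fix i assume "i \<in> {..m}"
    then have i: "i \<le> m" by simp
    show "X (r i) \<in> borel_measurable M"
      using measurable_F[OF rI(1) XF] i by simp
    show "indicator (A i) \<in> borel_measurable M"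
      using AF[OF i] sets_F[OF rI(1)[OF i]] by auto
  qed
  then show S: "S \<in> borel_measurable M"
    by (rule measurable_cong[THEN iffD1, rotated]) (simp only: pick S_def)
  define g where "g i \<omega> = indicator B \<omega> * indicator (A i) \<omega> * \<phi> (X (r i) \<omega>)" for i \<omega>
  have gF: "g i \<in> borel_measurable (F (r i))" if i: "i \<le> m" for i
  proof -
    have [measurable]: "B \<in> sets (F (r i))" "A i \<in> sets (F (r i))" "X (r i) \<in> borel_measurable (F (r i))"
      using B mono[OF s rI(1)[OF i] rI(2)[OF i]] AF[OF i] XF[OF i] by auto
    show ?thesis
      unfolding g_def by measurable
  qed
  have C: "0 \<le> C"
    using bdd[of 0] by linarith
  have g_bdd: "\<bar>g i \<omega>\<bar> \<le> C" for i \<omega>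
    using bdd C by (simp add: g_def indicator_def)
  note test = martingale_test[OF X rI(1) t rI(3) gF g_bdd]
  have sum_S: "(\<Sum>i\<le>m. g i \<omega> * X (r i) \<omega>) = indicator B \<omega> * \<phi> (S \<omega>) * S \<omega>"
    if "\<omega> \<in> space M" for \<omega>
    using pick[OF that, of "\<lambda>i. indicator B \<omega> * \<phi> (X (r i) \<omega>) * X (r i) \<omega>"]
    by (simp add: g_def S_def mult_ac)
  have sum_X: "(\<Sum>i\<le>m. g i \<omega> * X t \<omega>) = indicator B \<omega> * \<phi> (S \<omega>) * X t \<omega>"
    if "\<omega> \<in> space M" for \<omega>
    using pick[OF that, of "\<lambda>i. indicator B \<omega> * \<phi> (X (r i) \<omega>) * X t \<omega>"]
    by (simp add: g_def S_def mult_ac)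
  have "(\<integral>\<omega>. indicator B \<omega> * \<phi> (S \<omega>) * S \<omega> \<partial>M) = (\<integral>\<omega>. (\<Sum>i\<le>m. g i \<omega> * X (r i) \<omega>) \<partial>M)"
    by (rule Bochner_Integration.integral_cong) (simp_all add: sum_S)
  also have "\<dots> = (\<Sum>i\<le>m. \<integral>\<omega>. g i \<omega> * X (r i) \<omega> \<partial>M)"
    using test(1) by (intro Bochner_Integration.integral_sum) auto
  also have "\<dots> = (\<Sum>i\<le>m. \<integral>\<omega>. g i \<omega> * X t \<omega> \<partial>M)"
    using test(3) by (intro sum.cong) auto
  also have "\<dots> = (\<integral>\<omega>. (\<Sum>i\<le>m. g i \<omega> * X t \<omega>) \<partial>M)"
    using test(2) by (intro Bochner_Integration.integral_sum[symmetric]) auto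
  also have "\<dots> = (\<integral>\<omega>. indicator B \<omega> * \<phi> (S \<omega>) * X t \<omega> \<partial>M)"
    by (rule Bochner_Integration.integral_cong) (simp_all add: sum_X)
  finally show "(\<integral>\<omega>. indicator B \<omega> * \<phi> (S \<omega>) * S \<omega> \<partial>M) = (\<integral>\<omega>. indicator B \<omega> * \<phi> (S \<omega>) * X t \<omega> \<partial>M)" .
  have "integrable M (\<lambda>\<omega>. \<Sum>i\<le>m. g i \<omega> * X (r i) \<omega>)"
    using test(1) by (intro Bochner_Integration.integrable_sum) auto
  then show "integrable M (\<lambda>\<omega>. indicator B \<omega> * \<phi> (S \<omega>) * S \<omega>)"
    by (rule Bochner_Integration.integrable_cong[THEN iffD1, rotated 2]) (simp_all add: sum_S)
qed

text \<open>
  Sampled values converge only almost surely, and they need not be dominated. With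
  \<open>\<phi> x = max 0 (1 - \<bar>x\<bar> / (n + 1))\<close> both \<open>\<phi> (S) S\<close> and \<open>\<phi> (S) X t\<close> are dominated, so the sampling identity
  passes to the limit for each truncation level; removing the truncation requires only that \<open>Z\<close> is
  integrable, which follows by Fatou's lemma from the test function \<open>sgn\<close>.
\<close>

lemma limit_stopping:
  fixes r :: "nat \<Rightarrow> nat \<Rightarrow> real" and idx :: "nat \<Rightarrow> 'w \<Rightarrow> nat" and c :: "nat \<Rightarrow> nat"
  assumes X: "martingale M I F X" and s: "s \<in> I" and t: "t \<in> I" and "s \<le> t" and B: "B \<in> sets (F s)"
    and r: "\<And>m i. i \<le> c m \<Longrightarrow> s \<le> r m i \<and> r m i \<le> t"
    and idx: "\<And>m \<omega>. \<omega> \<in> space M \<Longrightarrow> idx m \<omega> \<le> c m"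
      "\<And>m i. i \<le> c m \<Longrightarrow> {\<omega> \<in> space M. idx m \<omega> = i} \<in> sets (F (r m i))"
    and Z [measurable]: "Z \<in> borel_measurable M"
    and lim: "AE \<omega> in M. (\<lambda>m. X (r m (idx m \<omega>)) \<omega>) \<longlonglongrightarrow> Z \<omega>"
  shows "integrable M Z" "(\<integral>\<omega>. indicator B \<omega> * Z \<omega> \<partial>M) = (\<integral>\<omega>. indicator B \<omega> * X s \<omega> \<partial>M)"
proof -
  define S where "S m \<omega> = X (r m (idx m \<omega>)) \<omega>" for m \<omega>
  have stop: "S m \<in> borel_measurable M"
    "(\<integral>\<omega>. indicator A \<omega> * \<psi> (S m \<omega>) * S m \<omega> \<partial>M) = (\<integral>\<omega>. indicator A \<omega> * \<psi> (S m \<omega>) * X t \<omega> \<partial>M)"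
    "integrable M (\<lambda>\<omega>. indicator A \<omega> * \<psi> (S m \<omega>) * S m \<omega>)"
    if "A \<in> sets (F s)" "\<psi> \<in> borel_measurable borel" "\<And>x. \<bar>\<psi> x\<bar> \<le> C"
    for A m C and \<psi> :: "real \<Rightarrow> real"
    unfolding S_def by (rule grid_stopping[OF X s t that(1) r idx that(2,3)]; assumption)+
  have S [measurable]: "S m \<in> borel_measurable M" for m
    by (rule stop(1)[OF B, of "\<lambda>_. 0" 0]) auto
  have BM [measurable]: "B \<in> sets M"
    using B sets_F[OF s] by blast
  have Xt: "integrable M (X t)"
    using X t by (simp add: martingale_def)
  have limS: "AE \<omega> in M. (\<lambda>m. S m \<omega>) \<longlonglongrightarrow> Z \<omega>"
    using lim by (simp add: S_def)
  have space: "space M \<in> sets (F s)"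
    using space_F[OF s] sets.top[of "F s"] by simp
  show Zint: "integrable M Z"
  proof (rule integrableI_bounded)
    have "(\<integral>\<^sup>+\<omega>. norm (S m \<omega>) \<partial>M) \<le> ennreal (\<integral>\<omega>. \<bar>X t \<omega>\<bar> \<partial>M)" for m
    proof -
      have sgn_bdd: "\<bar>sgn x\<bar> \<le> 1" for x :: real
        by (simp add: sgn_real_def)
      have eq: "indicator (space M) \<omega> * sgn (S m \<omega>) * S m \<omega> = \<bar>S m \<omega>\<bar>" if "\<omega> \<in> space M" for \<omega>
        using that by (simp add: sgn_real_def)
      have "integrable M (\<lambda>\<omega>. indicator (space M) \<omega> * sgn (S m \<omega>) * S m \<omega>)"
        by (rule stop(3)[OF space _ sgn_bdd]) measurable
      then have int: "integrable M (\<lambda>\<omega>. \<bar>S m \<omega>\<bar>)"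
        by (rule Bochner_Integration.integrable_cong[THEN iffD1, rotated 2]) (simp_all only: eq)
      have "(\<integral>\<omega>. \<bar>S m \<omega>\<bar> \<partial>M) = (\<integral>\<omega>. indicator (space M) \<omega> * sgn (S m \<omega>) * S m \<omega> \<partial>M)"
        by (rule Bochner_Integration.integral_cong) (simp_all only: eq)
      also have "\<dots> = (\<integral>\<omega>. indicator (space M) \<omega> * sgn (S m \<omega>) * X t \<omega> \<partial>M)"
        by (rule stop(2)[OF space _ sgn_bdd]) measurable
      also have "\<dots> \<le> (\<integral>\<omega>. \<bar>X t \<omega>\<bar> \<partial>M)"
        by (rule integral_mono') (use Xt in \<open>auto simp: sgn_real_def indicator_def\<close>)
      finally show ?thesis
        using int by (simp add: nn_integral_eq_integral)
    qed
    then have bound: "liminf (\<lambda>m. \<integral>\<^sup>+\<omega>. norm (S m \<omega>) \<partial>M) \<le> ennreal (\<integral>\<omega>. \<bar>X t \<omega>\<bar> \<partial>M)"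
      by (intro order_trans[OF Liminf_le_Limsup] Limsup_bounded) auto
    have "(\<integral>\<^sup>+\<omega>. norm (Z \<omega>) \<partial>M) = (\<integral>\<^sup>+\<omega>. liminf (\<lambda>m. ennreal (norm (S m \<omega>))) \<partial>M)"
    proof (rule nn_integral_cong_AE)
      show "AE \<omega> in M. ennreal (norm (Z \<omega>)) = liminf (\<lambda>m. ennreal (norm (S m \<omega>)))"
        using limS
      proof eventually_elim
        case (elim \<omega>)
        then have "(\<lambda>m. ennreal (norm (S m \<omega>))) \<longlonglongrightarrow> ennreal (norm (Z \<omega>))"
          by (intro tendsto_ennrealI tendsto_norm)
        then show ?case
          by (metis lim_imp_Liminf sequentially_bot)
      qed
    qed
    also have "\<dots> \<le> liminf (\<lambda>m. \<integral>\<^sup>+\<omega>. norm (S m \<omega>) \<partial>M)"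
      by (rule nn_integral_liminf) measurable
    also note bound
    finally show "(\<integral>\<^sup>+\<omega>. norm (Z \<omega>) \<partial>M) < \<infinity>"
      by (simp add: order_le_less_trans)
  qed simp
  define \<phi> where "\<phi> n x = max 0 (1 - \<bar>x\<bar> / real (Suc n))" for n and x :: real
  have [measurable]: "\<phi> n \<in> borel_measurable borel" for n
    unfolding \<phi>_def by measurable
  have cont: "isCont (\<phi> n) x" for n x
    unfolding \<phi>_def by (intro continuous_intros) auto
  have \<phi>_bdd: "\<bar>\<phi> n x\<bar> \<le> 1" for n x
    by (auto simp: \<phi>_def)
  have \<phi>_mult: "\<bar>\<phi> n x * x\<bar> \<le> real (Suc n)" for n x
  proof (cases "\<bar>x\<bar> \<le> real (Suc n)")
    case True
    then show ?thesis
      using mult_mono[OF \<phi>_bdd[of n x] True] by (simp add: abs_mult)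
  next
    case False
    then have "1 \<le> \<bar>x\<bar> / real (Suc n)"
      by (subst le_divide_eq_1_pos) auto
    then have "\<phi> n x = 0"
      by (simp add: \<phi>_def)
    then show ?thesis
      by simp
  qed
  have trunc: "(\<integral>\<omega>. indicator B \<omega> * \<phi> n (Z \<omega>) * Z \<omega> \<partial>M) = (\<integral>\<omega>. indicator B \<omega> * \<phi> n (Z \<omega>) * X t \<omega> \<partial>M)" for n
  proof (rule LIMSEQ_unique)
    show "(\<lambda>m. \<integral>\<omega>. indicator B \<omega> * \<phi> n (S m \<omega>) * S m \<omega> \<partial>M) \<longlonglongrightarrow> (\<integral>\<omega>. indicator B \<omega> * \<phi> n (Z \<omega>) * Z \<omega> \<partial>M)"
    proof (rule integral_dominated_convergence[where w = "\<lambda>_. real (Suc n)"])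
      show "AE \<omega> in M. (\<lambda>m. indicator B \<omega> * \<phi> n (S m \<omega>) * S m \<omega>) \<longlonglongrightarrow> indicator B \<omega> * \<phi> n (Z \<omega>) * Z \<omega>"
        using limS by eventually_elim (intro tendsto_intros isCont_tendsto_compose[OF cont])
      show "AE \<omega> in M. norm (indicator B \<omega> * \<phi> n (S m \<omega>) * S m \<omega>) \<le> real (Suc n)" for m
        using \<phi>_mult[of n] by (intro AE_I2) (auto simp: indicator_def simp del: of_nat_Suc)
    qed auto
    show "(\<lambda>m. \<integral>\<omega>. indicator B \<omega> * \<phi> n (S m \<omega>) * S m \<omega> \<partial>M) \<longlonglongrightarrow> (\<integral>\<omega>. indicator B \<omega> * \<phi> n (Z \<omega>) * X t \<omega> \<partial>M)"
      unfolding stop(2)[OF B \<open>\<phi> n \<in> borel_measurable borel\<close> \<phi>_bdd]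
    proof (rule integral_dominated_convergence[where w = "\<lambda>\<omega>. \<bar>X t \<omega>\<bar>"])
      show "AE \<omega> in M. (\<lambda>m. indicator B \<omega> * \<phi> n (S m \<omega>) * X t \<omega>) \<longlonglongrightarrow> indicator B \<omega> * \<phi> n (Z \<omega>) * X t \<omega>"
        using limS by eventually_elim (intro tendsto_intros isCont_tendsto_compose[OF cont])
      show "AE \<omega> in M. norm (indicator B \<omega> * \<phi> n (S m \<omega>) * X t \<omega>) \<le> \<bar>X t \<omega>\<bar>" for m
        using mult_right_mono[OF \<phi>_bdd[of n], of "\<bar>X t _\<bar>"]
        by (intro AE_I2) (auto simp: indicator_def abs_mult)
    qed (use Xt in auto)
  qed
  have \<phi>_lim: "(\<lambda>n. \<phi> n x) \<longlonglongrightarrow> 1" for x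
  proof -
    have "(\<lambda>n. \<bar>x\<bar> * inverse (real (Suc n))) \<longlonglongrightarrow> \<bar>x\<bar> * 0"
      by (intro tendsto_intros LIMSEQ_inverse_real_of_nat)
    then have "(\<lambda>n. \<bar>x\<bar> / real (Suc n)) \<longlonglongrightarrow> 0"
      by (simp add: divide_inverse)
    then have "(\<lambda>n. max 0 (1 - \<bar>x\<bar> / real (Suc n))) \<longlonglongrightarrow> max 0 (1 - 0)"
      by (intro tendsto_intros)
    then show ?thesis
      by (simp add: \<phi>_def)
  qed
  have conv: "(\<lambda>n. \<integral>\<omega>. indicator B \<omega> * \<phi> n (Z \<omega>) * W \<omega> \<partial>M) \<longlonglongrightarrow> (\<integral>\<omega>. indicator B \<omega> * W \<omega> \<partial>M)"
    if W: "integrable M W" for W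
  proof (rule integral_dominated_convergence[where w = "\<lambda>\<omega>. \<bar>W \<omega>\<bar>"])
    show "AE \<omega> in M. (\<lambda>n. indicator B \<omega> * \<phi> n (Z \<omega>) * W \<omega>) \<longlonglongrightarrow> indicator B \<omega> * W \<omega>"
    proof (intro AE_I2)
      fix \<omega>
      have "(\<lambda>n. indicator B \<omega> * \<phi> n (Z \<omega>) * W \<omega>) \<longlonglongrightarrow> indicator B \<omega> * 1 * W \<omega>"
        by (intro tendsto_intros \<phi>_lim)
      then show "(\<lambda>n. indicator B \<omega> * \<phi> n (Z \<omega>) * W \<omega>) \<longlonglongrightarrow> indicator B \<omega> * W \<omega>"
        by simp
    qed
    show "AE \<omega> in M. norm (indicator B \<omega> * \<phi> n (Z \<omega>) * W \<omega>) \<le> \<bar>W \<omega>\<bar>" for n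
      using mult_right_mono[OF \<phi>_bdd[of n], of "\<bar>W _\<bar>"]
      by (intro AE_I2) (auto simp: indicator_def abs_mult)
  qed (use W in auto)
  have "(\<integral>\<omega>. indicator B \<omega> * Z \<omega> \<partial>M) = (\<integral>\<omega>. indicator B \<omega> * X t \<omega> \<partial>M)"
    by (rule LIMSEQ_unique[OF conv[OF Zint]]) (use conv[OF Xt] in \<open>simp add: trunc\<close>)
  also have "\<dots> = (\<integral>\<omega>. indicator B \<omega> * X s \<omega> \<partial>M)"
    by (rule martingale_test(3)[OF X s t \<open>s \<le> t\<close>, of _ 1]) (use B in \<open>auto simp: indicator_def\<close>)
  finally show "(\<integral>\<omega>. indicator B \<omega> * Z \<omega> \<partial>M) = (\<integral>\<omega>. indicator B \<omega> * X s \<omega> \<partial>M)" .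
qed

end

section \<open>The time at which a counting function exceeds a level\<close>

text \<open>
  The mesh has \<open>m + 1\<close> steps, to avoid division by zero.
\<close>

definition grid :: "real \<Rightarrow> real \<Rightarrow> nat \<Rightarrow> nat \<Rightarrow> real" where
  "grid s t m i = s + (t - s) * (real i / real (Suc m))"

text \<open>
  The index \<open>m + 1\<close>, which belongs to the end point \<open>t\<close>, also serves as the value when \<open>N\<close> never
  exceeds \<open>n\<close>; so the sampling time is always defined and bounded by \<open>t\<close>.
\<close>

definition hitting_index :: "(real \<Rightarrow> nat) \<Rightarrow> nat \<Rightarrow> real \<Rightarrow> real \<Rightarrow> nat \<Rightarrow> nat" where
  "hitting_index N n s t m = (LEAST i. Suc m \<le> i \<or> n < N (grid s t m i))"

lemma grid_bounds:
  assumes "s \<le> t" "i \<le> Suc m"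
  shows "s \<le> grid s t m i" "grid s t m i \<le> t"
proof -
  have "real i / real (Suc m) \<le> 1"
    using assms(2) by simp
  then have "(t - s) * (real i / real (Suc m)) \<le> (t - s) * 1"
    using assms(1) by (intro mult_left_mono) auto
  then show "grid s t m i \<le> t"
    by (simp add: grid_def)
  show "s \<le> grid s t m i"
    using assms(1) by (simp add: grid_def)
qed

lemma hitting_index_le: "hitting_index N n s t m \<le> Suc m"
  unfolding hitting_index_def by (rule Least_le) simp

lemma hitting_index_eq_iff:
  assumes "i \<le> Suc m"
  shows "hitting_index N n s t m = i \<longleftrightarrow>
    (\<forall>j<i. N (grid s t m j) \<le> n) \<and> (i = Suc m \<or> n < N (grid s t m i))"
proof
  let ?P = "\<lambda>i. Suc m \<le> i \<or> n < N (grid s t m i)"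
  assume eq: "hitting_index N n s t m = i"
  have "?P (hitting_index N n s t m)"
    unfolding hitting_index_def by (rule LeastI[of ?P "Suc m"]) simp
  moreover have "\<not> ?P j" if "j < i" for j
    using that eq not_less_Least unfolding hitting_index_def by blast
  ultimately show "(\<forall>j<i. N (grid s t m j) \<le> n) \<and> (i = Suc m \<or> n < N (grid s t m i))"
    using eq assms by (auto simp: not_less)
next
  assume "(\<forall>j<i. N (grid s t m j) \<le> n) \<and> (i = Suc m \<or> n < N (grid s t m i))"
  then show "hitting_index N n s t m = i"
    unfolding hitting_index_def using assms
    by (intro Least_equality) (auto simp: not_le[symmetric] intro: leI)
qed

text \<open>
  Grid hitting times approach the hitting time \<open>\<sigma>\<close> from the right, where \<open>N\<close> is continuous. If the
  level is not exceeded before \<open>t\<close> then \<open>\<sigma> = t\<close>.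
\<close>

lemma hitting_time:
  fixes N :: "real \<Rightarrow> nat"
  assumes "s < t"
    and mono: "\<And>u v. u \<le> v \<Longrightarrow> N u \<le> N v"
    and right: "\<And>u. \<exists>\<delta>>0. \<forall>v. u \<le> v \<and> v < u + \<delta> \<longrightarrow> N v = N u"
  obtains \<sigma> where "s \<le> \<sigma>" "\<sigma> \<le> t" "\<And>u. s \<le> u \<Longrightarrow> u < \<sigma> \<Longrightarrow> N u \<le> n" "\<sigma> < t \<Longrightarrow> n < N \<sigma>"
    "\<And>m. \<sigma> \<le> grid s t m (hitting_index N n s t m)"
    "(\<lambda>m. grid s t m (hitting_index N n s t m)) \<longlonglongrightarrow> \<sigma>"
proof -
  define S where "S = {u \<in> {s..t}. n < N u \<or> u = t}"
  define \<sigma> where "\<sigma> = Inf S"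
  have "t \<in> S" and bdd: "bdd_below S"
    using \<open>s < t\<close> by (auto simp: S_def bdd_below_def)
  have low: "\<sigma> \<le> u" if "u \<in> S" for u
    unfolding \<sigma>_def by (rule cInf_lower[OF that bdd])
  have "s \<le> \<sigma>"
    unfolding \<sigma>_def by (rule cInf_greatest) (use \<open>t \<in> S\<close> in \<open>auto simp: S_def\<close>)
  have "\<sigma> \<le> t"
    using low[OF \<open>t \<in> S\<close>] .
  have jump: "n < N \<sigma>" if "\<sigma> < t"
  proof -
    obtain \<delta> where \<delta>: "\<delta> > 0" "\<And>v. \<sigma> \<le> v \<Longrightarrow> v < \<sigma> + \<delta> \<Longrightarrow> N v = N \<sigma>"
      using right by blast
    have "Inf S < min t (\<sigma> + \<delta>)"
      using \<delta>(1) that by (simp add: \<sigma>_def)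
    then obtain u where u: "u \<in> S" "u < min t (\<sigma> + \<delta>)"
      using cInf_lessD \<open>t \<in> S\<close> by blast
    then have "n < N u"
      by (auto simp: S_def)
    then show ?thesis
      using \<delta>(2)[OF low[OF u(1)]] u(2) by simp
  qed
  let ?r = "\<lambda>m. grid s t m (hitting_index N n s t m)"
  have r_S: "?r m \<in> S" for m
    using hitting_index_eq_iff[where N = N and n = n and s = s and t = t and m = m and i = "hitting_index N n s t m"]
      grid_bounds[of s t _ m] \<open>s < t\<close> hitting_index_le[of N n s t m]
    by (auto simp: S_def grid_def)
  have r_le: "?r m \<le> \<sigma> + (t - s) / real (Suc m)" for m
  proof -
    \<comment> \<open>Rounding \<open>\<sigma>\<close> up to the grid gives a grid point that already qualifies.\<close>
    define q where "q = (\<sigma> - s) / (t - s) * real (Suc m)"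
    define j where "j = nat \<lceil>q\<rceil>"
    have q: "0 \<le> q" "q \<le> real (Suc m)"
      using \<open>s \<le> \<sigma>\<close> \<open>\<sigma> \<le> t\<close> \<open>s < t\<close> mult_right_mono[of "(\<sigma> - s) / (t - s)" 1 "real (Suc m)"]
      by (simp_all add: q_def)
    have "real j = of_int \<lceil>q\<rceil>"
      using q(1) by (simp add: j_def)
    then have j: "q \<le> real j" "real j \<le> q + 1"
      by linarith+
    have "j \<le> Suc m"
      using q(2) unfolding j_def by (simp add: nat_le_iff ceiling_le_iff)
    have q_eq: "s + (t - s) * (q / real (Suc m)) = \<sigma>"
      using \<open>s < t\<close> by (simp add: q_def)
    have "s + (t - s) * (q / real (Suc m)) \<le> grid s t m j"
      unfolding grid_def using j \<open>s < t\<close> by (intro add_left_mono mult_left_mono divide_right_mono) auto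
    then have g1: "\<sigma> \<le> grid s t m j"
      unfolding q_eq .
    have "grid s t m j \<le> s + (t - s) * ((q + 1) / real (Suc m))"
      unfolding grid_def using j \<open>s < t\<close> by (intro add_left_mono mult_left_mono divide_right_mono) auto
    also have "\<dots> = \<sigma> + (t - s) / real (Suc m)"
      by (subst q_eq[symmetric]) (simp add: add_divide_distrib algebra_simps)
    finally have g2: "grid s t m j \<le> \<sigma> + (t - s) / real (Suc m)" .
    have "hitting_index N n s t m \<le> j"
      unfolding hitting_index_def
    proof (rule Least_le)
      show "Suc m \<le> j \<or> n < N (grid s t m j)"
      proof (cases "\<sigma> < t")
        case True
        then show ?thesis
          using jump mono[OF g1] by simp
      next
        case False
        then have "\<sigma> = t"
          using \<open>\<sigma> \<le> t\<close> by simp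
        then have "q = real (Suc m)"
          using \<open>s < t\<close> by (simp add: q_def)
        then show ?thesis
          using j(1) by simp
      qed
    qed
    then have "?r m \<le> grid s t m j"
      unfolding grid_def using \<open>s < t\<close> by (intro add_left_mono mult_left_mono divide_right_mono) auto
    then show ?thesis
      using g2 by simp
  qed
  have upper: "(\<lambda>m. \<sigma> + (t - s) / real (Suc m)) \<longlonglongrightarrow> \<sigma>"
  proof -
    have "(\<lambda>m. \<sigma> + (t - s) * inverse (real (Suc m))) \<longlonglongrightarrow> \<sigma> + (t - s) * 0"
      by (intro tendsto_intros LIMSEQ_inverse_real_of_nat)
    then show ?thesis
      by (simp add: divide_inverse)
  qed
  have lim: "?r \<longlonglongrightarrow> \<sigma>"
    by (rule tendsto_sandwich[OF _ _ tendsto_const upper]) (intro always_eventually allI r_le low r_S)+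
  show thesis
  proof (rule that)
    show "N u \<le> n" if "s \<le> u" "u < \<sigma>" for u
    proof (rule ccontr)
      assume "\<not> N u \<le> n"
      then have "u \<in> S"
        using that \<open>\<sigma> \<le> t\<close> by (auto simp: S_def)
      then show False
        using low that(2) by fastforce
    qed
  qed (use \<open>s \<le> \<sigma>\<close> \<open>\<sigma> \<le> t\<close> jump low r_S lim in auto)
qed

text \<open>
  The points preceded by at most \<open>n\<close> points, and the times with this property, are exactly those up to
  the hitting time. So stopping can be expressed by \<open>P\<close>, which is jointly measurable by inspection, and
  the hitting time need never be treated as a random variable.
\<close>

lemma finite_points_hitting_time:
  fixes T :: "'i \<Rightarrow> real" and J :: "'i set" and s t :: real
  assumes fin: "finite J" and "s < t"
  defines "N \<equiv> \<lambda>u. card {i \<in> J. T i \<le> u}" and "P \<equiv> \<lambda>u. card {i \<in> J. T i < u}"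
  obtains \<sigma> where "s \<le> \<sigma>" "\<sigma> \<le> t"
    "\<And>u. s < u \<Longrightarrow> u \<le> t \<Longrightarrow> P u \<le> n \<longleftrightarrow> u \<le> \<sigma>"
    "card {i \<in> J. s < T i \<and> T i \<le> t \<and> P (T i) \<le> n} + N s = N \<sigma>"
    "\<forall>\<^sub>F m in sequentially. N (grid s t m (hitting_index N n s t m)) = N \<sigma>"
    "(\<lambda>m. grid s t m (hitting_index N n s t m)) \<longlonglongrightarrow> \<sigma>"
proof -
  have mono: "N u \<le> N v" if "u \<le> v" for u v
    unfolding N_def by (rule card_mono) (use fin that in auto)
  have right: "\<exists>\<delta>>0. \<forall>v. u \<le> v \<and> v < u + \<delta> \<longrightarrow> N v = N u" for u
  proof -
    define \<delta> where "\<delta> = Min (insert 1 ((\<lambda>i. T i - u) ` {i \<in> J. u < T i}))"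
    have "\<delta> > 0"
      unfolding \<delta>_def using fin by (subst Min_gr_iff) auto
    moreover have "N v = N u" if "u \<le> v" "v < u + \<delta>" for v
    proof -
      have "T i \<le> u" if "i \<in> J" "T i \<le> v" for i
      proof (rule ccontr)
        assume "\<not> T i \<le> u"
        then have "\<delta> \<le> T i - u"
          unfolding \<delta>_def using fin \<open>i \<in> J\<close> by (intro Min_le) auto
        then show False
          using \<open>v < u + \<delta>\<close> \<open>T i \<le> v\<close> by simp
      qed
      then have "{i \<in> J. T i \<le> v} = {i \<in> J. T i \<le> u}"
        using \<open>u \<le> v\<close> by force
      then show ?thesis
        by (simp add: N_def)
    qed
    ultimately show ?thesis by blast
  qed
  obtain \<sigma> where \<sigma>: "s \<le> \<sigma>" "\<sigma> \<le> t" "\<And>u. s \<le> u \<Longrightarrow> u < \<sigma> \<Longrightarrow> N u \<le> n" "\<sigma> < t \<Longrightarrow> n < N \<sigma>"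
    "\<And>m. \<sigma> \<le> grid s t m (hitting_index N n s t m)"
    "(\<lambda>m. grid s t m (hitting_index N n s t m)) \<longlonglongrightarrow> \<sigma>"
    using hitting_time[of s t N n, OF \<open>s < t\<close> mono right] by blast
  have P_iff: "P u \<le> n \<longleftrightarrow> u \<le> \<sigma>" if u: "s < u" "u \<le> t" for u
  proof
    assume "P u \<le> n"
    show "u \<le> \<sigma>"
    proof (rule ccontr)
      assume "\<not> u \<le> \<sigma>"
      then have "n < N \<sigma>" "\<sigma> < u"
        using \<sigma>(4) u by auto
      moreover have "N \<sigma> \<le> P u"
        unfolding N_def P_def by (rule card_mono) (use fin \<open>\<sigma> < u\<close> in auto)
      ultimately show False
        using \<open>P u \<le> n\<close> by simp
    qed
  next
    assume "u \<le> \<sigma>"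
    define v where "v = Max (insert s (T ` {i \<in> J. T i < u}))"
    have "v < u"
      unfolding v_def using fin u by (subst Max_less_iff) auto
    moreover have "s \<le> v"
      unfolding v_def using fin by (intro Max_ge) auto
    ultimately have "N v \<le> n"
      using \<sigma>(3) \<open>u \<le> \<sigma>\<close> by simp
    moreover have "T i \<le> v" if "i \<in> J" "T i < u" for i
      unfolding v_def using fin that by (intro Max_ge) auto
    then have "P u \<le> N v"
      unfolding N_def P_def by (intro card_mono) (use fin in auto)
    ultimately show "P u \<le> n" by simp
  qed
  have "{i \<in> J. s < T i \<and> T i \<le> t \<and> P (T i) \<le> n} = {i \<in> J. s < T i \<and> T i \<le> \<sigma>}"
    using P_iff \<sigma>(2) by force
  moreover have "card ({i \<in> J. s < T i \<and> T i \<le> \<sigma>} \<union> {i \<in> J. T i \<le> s})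
      = card {i \<in> J. s < T i \<and> T i \<le> \<sigma>} + card {i \<in> J. T i \<le> s}"
    using fin by (intro card_Un_disjoint) auto
  moreover have "{i \<in> J. s < T i \<and> T i \<le> \<sigma>} \<union> {i \<in> J. T i \<le> s} = {i \<in> J. T i \<le> \<sigma>}"
    using \<sigma>(1) by auto
  ultimately have card: "card {i \<in> J. s < T i \<and> T i \<le> t \<and> P (T i) \<le> n} + N s = N \<sigma>"
    by (simp add: N_def)
  obtain \<delta> where \<delta>: "\<delta> > 0" "\<And>v. \<sigma> \<le> v \<Longrightarrow> v < \<sigma> + \<delta> \<Longrightarrow> N v = N \<sigma>"
    using right by blast
  have "\<forall>\<^sub>F m in sequentially. grid s t m (hitting_index N n s t m) < \<sigma> + \<delta>"
    using order_tendstoD(2)[OF \<sigma>(6)] \<delta>(1) by simp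
  then have "\<forall>\<^sub>F m in sequentially. N (grid s t m (hitting_index N n s t m)) = N \<sigma>"
    by eventually_elim (rule \<delta>(2)[OF \<sigma>(5)])
  then show thesis
    using that[OF \<sigma>(1,2) P_iff card _ \<sigma>(6)] by blast
qed

section \<open>Events and histories of a marked point process\<close>

definition event_time :: "('w, 'e) mpp \<Rightarrow> nat \<Rightarrow> 'w \<Rightarrow> real" where
  "event_time Y i \<omega> = real_of_ereal (etime Y i \<omega>)"

definition mark_events :: "('w, 'e) mpp \<Rightarrow> nat \<Rightarrow> 'w \<Rightarrow> nat set" where
  "mark_events Y k \<omega> = {i. etime Y i \<omega> < \<infinity> \<and> emark Y i \<omega> = mark Y k}"

text \<open>
  The left limit \<open>N\<^sub>k(u-)\<close> of the counting process.
\<close>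

definition prior :: "('w, 'e) mpp \<Rightarrow> nat \<Rightarrow> real \<Rightarrow> 'w \<Rightarrow> nat" where
  "prior Y k u \<omega> = card {i. etime Y i \<omega> < ereal u \<and> emark Y i \<omega> = mark Y k}"

lemma history_generators:
  "{counting Y k s -` {n} \<inter> space (base Y) | k s n. k \<in> A \<and> s \<in> horizon Y \<and> s \<le> t} \<union> null_sets (base Y)
    \<subseteq> Pow (space (base Y))"
  using sets.sets_into_space[of _ "base Y"] by (auto simp: null_sets_def)

lemma space_history [simp]: "space (history Y A t) = space (base Y)"
  unfolding history_def by (rule space_measure_of[OF history_generators])

lemma sets_history: "sets (history Y A t) = sigma_sets (space (base Y))
    ({counting Y k s -` {n} \<inter> space (base Y) | k s n. k \<in> A \<and> s \<in> horizon Y \<and> s \<le> t} \<union> null_sets (base Y))"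
  unfolding history_def by (rule sets_measure_of[OF history_generators])

lemma history_mono:
  assumes "A \<subseteq> B" "s \<le> t"
  shows "sets (history Y A s) \<subseteq> sets (history Y B t)"
  unfolding sets_history
proof (rule sigma_sets_mono', rule Un_mono[OF _ order_refl], rule subsetI)
  fix X assume "X \<in> {counting Y k u -` {n} \<inter> space (base Y) | k u n. k \<in> A \<and> u \<in> horizon Y \<and> u \<le> s}"
  then obtain k u n where X: "X = counting Y k u -` {n} \<inter> space (base Y)" "k \<in> A" "u \<in> horizon Y" "u \<le> s"
    by blast
  have "k \<in> B" "u \<le> t"
    using X(2,4) assms by auto
  with X(1,3) show "X \<in> {counting Y k u -` {n} \<inter> space (base Y) | k u n. k \<in> B \<and> u \<in> horizon Y \<and> u \<le> t}"
    by blast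
qed

context marked_point_process
begin

lemma etime_ereal:
  assumes "\<omega> \<in> space (base Y)" "etime Y i \<omega> < \<infinity>"
  shows "etime Y i \<omega> = ereal (event_time Y i \<omega>)" "0 < event_time Y i \<omega>" "event_time Y i \<omega> \<in> horizon Y"
proof -
  have pos: "0 < etime Y i \<omega>"
    using etime_pos[OF assms(1)] .
  show eq: "etime Y i \<omega> = ereal (event_time Y i \<omega>)"
    using assms(2) pos by (cases "etime Y i \<omega>") (auto simp: event_time_def)
  show "0 < event_time Y i \<omega>"
    using pos eq by simp
  show "event_time Y i \<omega> \<in> horizon Y"
    using etime_in_horizon[OF assms(1), of i] eq by auto
qed

lemma etime_le_iff:
  assumes "\<omega> \<in> space (base Y)"
  shows "etime Y i \<omega> \<le> ereal u \<longleftrightarrow> etime Y i \<omega> < \<infinity> \<and> event_time Y i \<omega> \<le> u"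
    and "etime Y i \<omega> < ereal u \<longleftrightarrow> etime Y i \<omega> < \<infinity> \<and> event_time Y i \<omega> < u"
  using etime_ereal(1)[OF assms, of i] by (cases "etime Y i \<omega> < \<infinity>"; simp)+

lemma pred_emark [measurable]: "Measurable.pred (base Y) (\<lambda>\<omega>. emark Y i \<omega> = mark Y k)"
proof -
  have "emark Y i -` ({mark Y k} \<inter> mark Y ` marks Y) \<inter> space (base Y) \<in> sets (base Y)"
    by (rule measurable_sets[OF emark_measurable]) auto
  moreover have "emark Y i \<omega> \<in> {mark Y k} \<inter> mark Y ` marks Y \<longleftrightarrow> emark Y i \<omega> = mark Y k"
    if "\<omega> \<in> space (base Y)" for \<omega>
    using measurable_space[OF emark_measurable that, of i] by auto
  then have "emark Y i -` ({mark Y k} \<inter> mark Y ` marks Y) \<inter> space (base Y)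
      = {\<omega> \<in> space (base Y). emark Y i \<omega> = mark Y k}"
    by blast
  ultimately show ?thesis
    by (simp add: pred_def)
qed

declare etime_measurable [measurable]

lemma event_time_measurable [measurable]: "event_time Y i \<in> borel_measurable (base Y)"
  unfolding event_time_def by measurable

lemma counting_measurable [measurable]: "counting Y k t \<in> measurable (base Y) (count_space UNIV)"
  unfolding counting_def by measurable

lemma prior_measurable [measurable]:
  "(\<lambda>x. prior Y k (fst x) (snd x)) \<in> measurable (borel \<Otimes>\<^sub>M base Y) (count_space UNIV)"
  unfolding prior_def by measurable

lemma finite_events: "finite {s. etime Y s \<omega> < \<infinity>} \<Longrightarrow> finite (mark_events Y k \<omega>)"
  unfolding mark_events_def by (erule rev_finite_subset) auto

lemma counting_eq:
  assumes "\<omega> \<in> space (base Y)"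
  shows "counting Y k u \<omega> = card {i \<in> mark_events Y k \<omega>. event_time Y i \<omega> \<le> u}"
  unfolding counting_def
proof (rule arg_cong[where f = card])
  show "{i. etime Y i \<omega> \<le> ereal u \<and> emark Y i \<omega> = mark Y k} = {i \<in> mark_events Y k \<omega>. event_time Y i \<omega> \<le> u}"
    by (auto simp: mark_events_def etime_le_iff[OF assms])
qed

lemma prior_eq:
  assumes "\<omega> \<in> space (base Y)"
  shows "prior Y k u \<omega> = card {i \<in> mark_events Y k \<omega>. event_time Y i \<omega> < u}"
  unfolding prior_def
proof (rule arg_cong[where f = card])
  show "{i. etime Y i \<omega> < ereal u \<and> emark Y i \<omega> = mark Y k} = {i \<in> mark_events Y k \<omega>. event_time Y i \<omega> < u}"
    by (auto simp: mark_events_def etime_le_iff[OF assms])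
qed

lemma inj_on_event_time:
  assumes "\<omega> \<in> space (base Y)"
  shows "inj_on (\<lambda>i. event_time Y i \<omega>) (mark_events Y k \<omega>)"
proof (rule inj_onI)
  fix i j assume "i \<in> mark_events Y k \<omega>" "j \<in> mark_events Y k \<omega>" "event_time Y i \<omega> = event_time Y j \<omega>"
  then have "etime Y i \<omega> = etime Y j \<omega>" "etime Y i \<omega> \<noteq> \<infinity>"
    using etime_ereal(1)[OF assms, of i] etime_ereal(1)[OF assms, of j] by (auto simp: mark_events_def)
  then show "i = j"
    using etime_inj[OF assms] by blast
qed

text \<open>
  Distinct events of the same mark are preceded by different numbers of such events.
\<close>

lemma card_early_events:
  assumes \<omega>: "\<omega> \<in> space (base Y)" and fin: "finite {s. etime Y s \<omega> < \<infinity>}"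
  shows "card {i \<in> mark_events Y k \<omega>. prior Y k (event_time Y i \<omega>) \<omega> \<le> n} \<le> Suc n"
proof -
  let ?J = "mark_events Y k \<omega>" and ?T = "\<lambda>i. event_time Y i \<omega>"
  have strict: "prior Y k (?T i) \<omega> < prior Y k (?T j) \<omega>" if "i \<in> ?J" "?T i < ?T j" for i j
    unfolding prior_eq[OF \<omega>] by (rule psubset_card_mono) (use that finite_events[OF fin] in auto)
  have "inj_on (\<lambda>i. prior Y k (?T i) \<omega>) ?J"
  proof (rule inj_onI)
    fix i j assume ij: "i \<in> ?J" "j \<in> ?J" "prior Y k (?T i) \<omega> = prior Y k (?T j) \<omega>"
    then have "?T i = ?T j"
      using strict[of i j] strict[of j i] by (cases "?T i" "?T j" rule: linorder_cases) auto
    then show "i = j"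
      using inj_on_event_time[OF \<omega>] ij(1,2) by (auto dest: inj_onD)
  qed
  then have "card {i \<in> ?J. prior Y k (?T i) \<omega> \<le> n} \<le> card {..n}"
    by (intro card_inj_on_le[where f = "\<lambda>i. prior Y k (?T i) \<omega>"]) (auto intro: inj_on_subset)
  then show ?thesis
    by simp
qed

lemma filtration: "augmented_filtration (base Y) (horizon Y) (history Y A)"
proof unfold_locales
  show "\<exists>\<tau>>0. horizon Y = {0..\<tau>} \<or> horizon Y = {0..<\<tau>}"
    by (rule horizon)
  show "null_sets (base Y) \<subseteq> sets (history Y A t)" for t
    unfolding sets_history by auto
  show "sets (history Y A s) \<subseteq> sets (history Y A t)" if "s \<le> t" for s t
    by (rule history_mono) (use that in auto)
  show "subalgebra (base Y) (history Y A t)" for t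
    unfolding subalgebra_def sets_history
  proof (intro conjI sets.sigma_sets_subset)
    show "{counting Y k s -` {n} \<inter> space (base Y) | k s n. k \<in> A \<and> s \<in> horizon Y \<and> s \<le> t} \<union> null_sets (base Y)
        \<subseteq> sets (base Y)"
      using measurable_sets[OF counting_measurable] by auto
  qed simp
qed

lemma counting_adapted:
  assumes "k \<in> A" "t \<in> horizon Y"
  shows "counting Y k t \<in> measurable (history Y A t) (count_space UNIV)"
  unfolding measurable_count_space_eq2_countable
  using assms by (auto simp: sets_history intro!: sigma_sets.Basic)

end

section \<open>The compensator identity for early events\<close>

lemma indefinite_integral_tendsto:
  fixes f :: "real \<Rightarrow> real"
  assumes f: "set_integrable lborel {a..b} f" and r: "\<And>m. r m \<in> {a..b}" and lim: "r \<longlonglongrightarrow> \<sigma>" and \<sigma>: "\<sigma> \<in> {a..b}"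
  shows "(\<lambda>m. LBINT u:{a..r m}. f u) \<longlonglongrightarrow> (LBINT u:{a..\<sigma>}. f u)"
proof -
  have eq: "(LBINT u:{a..x}. f u) = integral {a..x} f" if "x \<in> {a..b}" for x
    by (rule set_borel_integral_eq_integral(2)) (rule set_integrable_subset[OF f], use that in auto)
  have "continuous_on {a..b} (\<lambda>x. integral {a..x} f)"
    by (rule indefinite_integral_continuous_1) (rule set_borel_integral_eq_integral(1)[OF f])
  from continuous_on_tendsto_compose[OF this lim \<sigma>] r
  show ?thesis
    by (simp add: eq[OF \<sigma>] eq[OF r] always_eventually)
qed

text \<open>
  The two sides of the compensator identity as measures on time and sample space, restricted to the
  times before which at most \<open>n\<close> events of mark \<open>k\<close> have occurred. This restriction makes both finite.
\<close>

definition early_event_measure :: "('w, 'e) mpp \<Rightarrow> nat \<Rightarrow> nat \<Rightarrow> (real \<times> 'w) measure" where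
  "early_event_measure Y k n = distr
     (density (count_space UNIV \<Otimes>\<^sub>M base Y)
       (indicator {(i, \<omega>). i \<in> mark_events Y k \<omega> \<and> prior Y k (event_time Y i \<omega>) \<omega> \<le> n}))
     (borel \<Otimes>\<^sub>M base Y) (\<lambda>(i, \<omega>). (event_time Y i \<omega>, \<omega>))"

definition early_intensity_measure ::
  "('w, 'e) mpp \<Rightarrow> nat \<Rightarrow> nat \<Rightarrow> (real \<Rightarrow> 'w \<Rightarrow> real) \<Rightarrow> (real \<times> 'w) measure" where
  "early_intensity_measure Y k n lam = density (lborel \<Otimes>\<^sub>M base Y)
     (\<lambda>x. ennreal (indicator (horizon Y) (fst x) * lam (fst x) (snd x)) *
       indicator {x. prior Y k (fst x) (snd x) \<le> n} x)"

context marked_point_process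
begin

lemma mark_events_pred [measurable]: "Measurable.pred (base Y) (\<lambda>\<omega>. i \<in> mark_events Y k \<omega>)"
  unfolding mark_events_def by measurable

lemma prior_event_time_measurable [measurable]:
  "(\<lambda>\<omega>. prior Y k (event_time Y i \<omega>) \<omega>) \<in> measurable (base Y) (count_space UNIV)"
proof -
  have "(\<lambda>\<omega>. (event_time Y i \<omega>, \<omega>)) \<in> measurable (base Y) (borel \<Otimes>\<^sub>M base Y)"
    by measurable
  from measurable_compose[OF this prior_measurable[of k]] show ?thesis
    by simp
qed

lemma sets_early_event_measure [simp]: "sets (early_event_measure Y k n) = sets (borel \<Otimes>\<^sub>M base Y)"
  and sets_early_intensity_measure [simp]:
    "sets (early_intensity_measure Y k n lam) = sets (borel \<Otimes>\<^sub>M base Y)"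
proof -
  show "sets (early_event_measure Y k n) = sets (borel \<Otimes>\<^sub>M base Y)"
    by (simp add: early_event_measure_def)
  have "sets (lborel \<Otimes>\<^sub>M base Y) = sets (borel \<Otimes>\<^sub>M base Y)"
    by (rule sets_pair_measure_cong) auto
  then show "sets (early_intensity_measure Y k n lam) = sets (borel \<Otimes>\<^sub>M base Y)"
    by (simp add: early_intensity_measure_def)
qed

lemma emeasure_early_event_measure:
  assumes D [measurable]: "D \<in> sets (borel \<Otimes>\<^sub>M base Y)"
  shows "emeasure (early_event_measure Y k n) D = (\<integral>\<^sup>+\<omega>. emeasure (count_space UNIV)
    {i \<in> mark_events Y k \<omega>. prior Y k (event_time Y i \<omega>) \<omega> \<le> n \<and> (event_time Y i \<omega>, \<omega>) \<in> D} \<partial>base Y)"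
proof -
  interpret C: sigma_finite_measure "count_space (UNIV :: nat set)"
    by (rule sigma_finite_measure_count_space_countable) simp
  interpret pair: pair_sigma_finite "count_space (UNIV :: nat set)" "base Y"
    by standard
  let ?V = "{(i, \<omega>). i \<in> mark_events Y k \<omega> \<and> prior Y k (event_time Y i \<omega>) \<omega> \<le> n}"
  have T [measurable]: "(\<lambda>(i, \<omega>). (event_time Y i \<omega>, \<omega>)) \<in> measurable (count_space UNIV \<Otimes>\<^sub>M base Y) (borel \<Otimes>\<^sub>M base Y)"
    by (rule measurable_pair_measure_countable1) auto
  have V [measurable]: "Measurable.pred (count_space UNIV \<Otimes>\<^sub>M base Y) (\<lambda>x. x \<in> ?V)"
  proof -
    let ?f = "\<lambda>i x. i \<in> mark_events Y k (snd x) \<and> prior Y k (event_time Y i (snd x)) (snd x) \<le> n"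
    have "Measurable.pred (count_space UNIV \<Otimes>\<^sub>M base Y) (?f i)" for i :: nat
      by measurable
    then have "(\<lambda>x. ?f (fst x) x) \<in> measurable (count_space UNIV \<Otimes>\<^sub>M base Y) (count_space UNIV)"
      by (rule measurable_compose_countable) measurable
    then show ?thesis
      by (simp add: case_prod_unfold)
  qed
  have indV: "(indicator ?V :: _ \<Rightarrow> ennreal) \<in> borel_measurable (count_space UNIV \<Otimes>\<^sub>M base Y)"
    by (rule borel_measurable_indicator') (rule V[unfolded pred_def])
  let ?S = "(\<lambda>(i, \<omega>). (event_time Y i \<omega>, \<omega>)) -` D \<inter> space (count_space UNIV \<Otimes>\<^sub>M base Y)"
  have S: "?S \<in> sets (count_space UNIV \<Otimes>\<^sub>M base Y)"
    by (rule measurable_sets[OF T D])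
  have T': "(\<lambda>(i, \<omega>). (event_time Y i \<omega>, \<omega>))
      \<in> measurable (density (count_space UNIV \<Otimes>\<^sub>M base Y) (indicator ?V)) (borel \<Otimes>\<^sub>M base Y)"
    using T by (subst measurable_cong_sets[OF sets_density refl])
  have "emeasure (early_event_measure Y k n) D
      = emeasure (density (count_space UNIV \<Otimes>\<^sub>M base Y) (indicator ?V)) ?S"
    unfolding early_event_measure_def using emeasure_distr[OF T' D] by (simp only: space_density)
  also have "\<dots> = (\<integral>\<^sup>+x. indicator ?V x * indicator ?S x \<partial>(count_space UNIV \<Otimes>\<^sub>M base Y))"
    by (rule emeasure_density[OF indV S])
  also have "\<dots> = (\<integral>\<^sup>+\<omega>. (\<integral>\<^sup>+i. indicator ?V (i, \<omega>) * indicator ?S (i, \<omega>) \<partial>count_space UNIV) \<partial>base Y)"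
    by (rule pair.nn_integral_snd[symmetric]) (intro borel_measurable_times_ennreal indV borel_measurable_indicator S)
  also have "\<dots> = (\<integral>\<^sup>+\<omega>. emeasure (count_space UNIV)
    {i \<in> mark_events Y k \<omega>. prior Y k (event_time Y i \<omega>) \<omega> \<le> n \<and> (event_time Y i \<omega>, \<omega>) \<in> D} \<partial>base Y)"
  proof (rule nn_integral_cong)
    fix \<omega> assume "\<omega> \<in> space (base Y)"
    then have "(\<integral>\<^sup>+i. indicator ?V (i, \<omega>) * indicator ?S (i, \<omega>) \<partial>count_space UNIV) = (\<integral>\<^sup>+i. indicator
      {i \<in> mark_events Y k \<omega>. prior Y k (event_time Y i \<omega>) \<omega> \<le> n \<and> (event_time Y i \<omega>, \<omega>) \<in> D} i \<partial>count_space UNIV)"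
      by (intro nn_integral_cong) (auto simp: indicator_def space_pair_measure)
    then show "(\<integral>\<^sup>+i. indicator ?V (i, \<omega>) * indicator ?S (i, \<omega>) \<partial>count_space UNIV) = emeasure (count_space UNIV)
      {i \<in> mark_events Y k \<omega>. prior Y k (event_time Y i \<omega>) \<omega> \<le> n \<and> (event_time Y i \<omega>, \<omega>) \<in> D}"
      by simp
  qed
  finally show ?thesis .
qed

lemma emeasure_early_event_measure_le:
  assumes "nonexplosive Y" and D: "D \<in> sets (borel \<Otimes>\<^sub>M base Y)"
  shows "emeasure (early_event_measure Y k n) D \<le> of_nat (Suc n)"
proof -
  have "emeasure (early_event_measure Y k n) D \<le> (\<integral>\<^sup>+\<omega>. of_nat (Suc n) \<partial>base Y)"
    unfolding emeasure_early_event_measure[OF D]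
  proof (rule nn_integral_mono_AE)
    show "AE \<omega> in base Y. emeasure (count_space UNIV)
        {i \<in> mark_events Y k \<omega>. prior Y k (event_time Y i \<omega>) \<omega> \<le> n \<and> (event_time Y i \<omega>, \<omega>) \<in> D} \<le> of_nat (Suc n)"
      using assms(1)[unfolded nonexplosive_def]
    proof (rule AE_mp, intro AE_I2 impI)
      fix \<omega> assume \<omega>: "\<omega> \<in> space (base Y)" and fin: "finite {s. etime Y s \<omega> < \<infinity>}"
      let ?E = "{i \<in> mark_events Y k \<omega>. prior Y k (event_time Y i \<omega>) \<omega> \<le> n \<and> (event_time Y i \<omega>, \<omega>) \<in> D}"
      have "card ?E \<le> card {i \<in> mark_events Y k \<omega>. prior Y k (event_time Y i \<omega>) \<omega> \<le> n}"
        using finite_events[OF fin] by (intro card_mono) auto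
      also have "\<dots> \<le> Suc n"
        by (rule card_early_events[OF \<omega> fin])
      finally have "(of_nat (card ?E) :: ennreal) \<le> of_nat (Suc n)"
        by (rule of_nat_mono)
      moreover have "finite ?E"
        using finite_events[OF fin] by simp
      ultimately show "emeasure (count_space UNIV) ?E \<le> of_nat (Suc n)"
        by simp
    qed
  qed
  then show ?thesis
    by (simp add: emeasure_space_1)
qed

lemma intensity_jointly_measurable:
  assumes "intensity Y A k lam"
  shows "(\<lambda>x. indicator (horizon Y) (fst x) * lam (fst x) (snd x)) \<in> borel_measurable (lborel \<Otimes>\<^sub>M base Y)"
proof -
  interpret aug: augmented_filtration "base Y" "horizon Y" "history Y A"
    by (rule filtration)
  have "predictable (base Y) (horizon Y) (history Y A) lam"
    using assms by (simp add: intensity_def)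
  from aug.predictable_measurable_pair[OF this]
  have "(\<lambda>x. indicator (horizon Y) (fst x) * lam (fst x) (snd x)) \<in> borel_measurable (borel \<Otimes>\<^sub>M base Y)"
    by (simp add: case_prod_unfold)
  then show ?thesis
    by (subst measurable_cong_sets[OF sets_pair_measure_cong[OF sets_lborel refl] refl])
qed

lemma prior_measurable_lborel [measurable]:
  "(\<lambda>x. prior Y k (fst x) (snd x)) \<in> measurable (lborel \<Otimes>\<^sub>M base Y) (count_space UNIV)"
  using prior_measurable
  by (subst measurable_cong_sets[OF sets_pair_measure_cong[OF sets_lborel refl] refl])

lemma emeasure_early_intensity_measure:
  assumes lam: "intensity Y A k lam" and D: "D \<in> sets (borel \<Otimes>\<^sub>M base Y)"
  shows "emeasure (early_intensity_measure Y k n lam) D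
      = (\<integral>\<^sup>+x. ennreal (indicator (horizon Y) (fst x) * lam (fst x) (snd x)) *
          indicator {x. prior Y k (fst x) (snd x) \<le> n} x * indicator D x \<partial>(lborel \<Otimes>\<^sub>M base Y))"
    and "(\<lambda>x. ennreal (indicator (horizon Y) (fst x) * lam (fst x) (snd x)) *
          indicator {x. prior Y k (fst x) (snd x) \<le> n} x) \<in> borel_measurable (lborel \<Otimes>\<^sub>M base Y)"
proof -
  note intensity_jointly_measurable[OF lam, measurable]
  show meas: "(\<lambda>x. ennreal (indicator (horizon Y) (fst x) * lam (fst x) (snd x)) *
          indicator {x. prior Y k (fst x) (snd x) \<le> n} x) \<in> borel_measurable (lborel \<Otimes>\<^sub>M base Y)"
    by measurable
  have "D \<in> sets (lborel \<Otimes>\<^sub>M base Y)"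
    using D sets_pair_measure_cong[OF sets_lborel refl] by blast
  then show "emeasure (early_intensity_measure Y k n lam) D
      = (\<integral>\<^sup>+x. ennreal (indicator (horizon Y) (fst x) * lam (fst x) (snd x)) *
          indicator {x. prior Y k (fst x) (snd x) \<le> n} x * indicator D x \<partial>(lborel \<Otimes>\<^sub>M base Y))"
    unfolding early_intensity_measure_def by (rule emeasure_density[OF meas])
qed

text \<open>
  Let \<open>\<sigma>\<close> be the first time in \<open>[s, t]\<close> at which the count exceeds \<open>n\<close>, or \<open>t\<close>. The early events in
  \<open>(s, t]\<close> are those in \<open>(s, \<sigma>]\<close>, and likewise for the integral of the intensity, so the claim says that
  the compensated process has the same mean on \<open>B\<close> at \<open>\<sigma>\<close> and at \<open>s\<close>. As the stopped count is bounded,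
  the stopped compensator is integrable and the two parts can be separated.
\<close>

lemma early_measures_agree_on_rectangle:
  assumes nonexp: "nonexplosive Y" and kA: "k \<in> A" and lam: "intensity Y A k lam"
    and s: "s \<in> horizon Y" and t: "t \<in> horizon Y" and st: "s < t" and B: "B \<in> sets (history Y A s)"
  shows "emeasure (early_event_measure Y k n) ({s<..t} \<times> B)
       = emeasure (early_intensity_measure Y k n lam) ({s<..t} \<times> B)"
proof -
  interpret aug: augmented_filtration "base Y" "horizon Y" "history Y A"
    by (rule filtration)
  interpret pair: pair_sigma_finite lborel "base Y"
    by standard
  have BM [measurable]: "B \<in> sets (base Y)"
    using B aug.sets_F[OF s] by blast
  define \<Lambda> where "\<Lambda> r \<omega> = (LBINT u:{0..r}. lam u \<omega>)" for r \<omega>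
  define X where "X r \<omega> = real (counting Y k r \<omega>) - \<Lambda> r \<omega>" for r \<omega>
  have X: "martingale (base Y) (horizon Y) (history Y A) X"
    using lam by (simp add: intensity_def X_def[abs_def] \<Lambda>_def)
  have nonneg: "0 \<le> lam u \<omega>" if "u \<in> horizon Y" "\<omega> \<in> space (base Y)" for u \<omega>
    using lam that by (simp add: intensity_def)
  have st_horizon: "{s<..t} \<subseteq> horizon Y"
    using aug.nonneg_I[OF s] aug.downward_closed_I[OF t] by (auto intro: order_trans less_imp_le)
  define K where "K \<omega> = card {i \<in> mark_events Y k \<omega>. s < event_time Y i \<omega> \<and> event_time Y i \<omega> \<le> t \<and>
      prior Y k (event_time Y i \<omega>) \<omega> \<le> n}" for \<omega>
  define f where "f u \<omega> = indicator {s<..t} u * (indicator {x. prior Y k (fst x) (snd x) \<le> n} (u, \<omega>) *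
      (indicator (horizon Y) u * lam u \<omega>))" for u \<omega>
  define L where "L \<omega> = (LBINT u. f u \<omega>)" for \<omega>
  \<comment> \<open>The compensated process at \<open>\<sigma>\<close>, written without \<open>\<sigma>\<close>.\<close>
  define Z where "Z \<omega> = X s \<omega> + real (K \<omega>) - L \<omega>" for \<omega>
  have [measurable]: "K \<in> measurable (base Y) (count_space UNIV)"
    unfolding K_def by measurable
  have f [measurable]: "(\<lambda>x. f (fst x) (snd x)) \<in> borel_measurable (lborel \<Otimes>\<^sub>M base Y)"
  proof -
    note intensity_jointly_measurable[OF lam, measurable]
    show ?thesis
      unfolding f_def by measurable
  qed
  have f_nonneg: "0 \<le> f u \<omega>" if "\<omega> \<in> space (base Y)" for u \<omega>
    using nonneg[OF _ that, of u] by (auto simp: f_def indicator_def)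
  have [measurable]: "L \<in> borel_measurable (base Y)"
    unfolding L_def
    by (rule lborel.borel_measurable_lebesgue_integral) (use measurable_pair_swap[OF f] in \<open>simp add: case_prod_unfold\<close>)
  have Xs: "X s \<in> borel_measurable (base Y)" "integrable (base Y) (X s)"
    using X s by (auto simp: martingale_def intro: aug.measurable_F)
  have Z [measurable]: "Z \<in> borel_measurable (base Y)"
    unfolding Z_def using Xs(1) by measurable
  define N where "N \<omega> = (\<lambda>u. counting Y k u \<omega>)" for \<omega>
  have good: "AE \<omega> in base Y. finite {s. etime Y s \<omega> < \<infinity>} \<and> set_integrable lborel {0..t} (\<lambda>u. lam u \<omega>)"
    using nonexp[unfolded nonexplosive_def] lam t unfolding intensity_def by auto
  have pathwise: "AE \<omega> in base Y. integrable lborel (\<lambda>u. f u \<omega>) \<and>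
      (\<lambda>m. X (grid s t m (hitting_index (N \<omega>) n s t m)) \<omega>) \<longlonglongrightarrow> Z \<omega>"
    using good
  proof (rule AE_mp, intro AE_I2 impI)
    fix \<omega> assume \<omega>: "\<omega> \<in> space (base Y)"
      and *: "finite {s. etime Y s \<omega> < \<infinity>} \<and> set_integrable lborel {0..t} (\<lambda>u. lam u \<omega>)"
    then have int: "set_integrable lborel {0..t} (\<lambda>u. lam u \<omega>)" and fin: "finite (mark_events Y k \<omega>)"
      using finite_events by auto
    have N: "N \<omega> = (\<lambda>u. card {i \<in> mark_events Y k \<omega>. event_time Y i \<omega> \<le> u})"
      unfolding N_def by (rule ext) (rule counting_eq[OF \<omega>])
    obtain \<sigma> where \<sigma>: "s \<le> \<sigma>" "\<sigma> \<le> t"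
      "\<And>u. s < u \<Longrightarrow> u \<le> t \<Longrightarrow> prior Y k u \<omega> \<le> n \<longleftrightarrow> u \<le> \<sigma>"
      "K \<omega> + N \<omega> s = N \<omega> \<sigma>"
      "\<forall>\<^sub>F m in sequentially. N \<omega> (grid s t m (hitting_index (N \<omega>) n s t m)) = N \<omega> \<sigma>"
      "(\<lambda>m. grid s t m (hitting_index (N \<omega>) n s t m)) \<longlonglongrightarrow> \<sigma>"
      using finite_points_hitting_time[OF fin st, of "\<lambda>i. event_time Y i \<omega>" n]
      unfolding N K_def prior_eq[OF \<omega>] by blast
    let ?r = "\<lambda>m. grid s t m (hitting_index (N \<omega>) n s t m)"
    have s0: "0 \<le> s"
      using aug.nonneg_I[OF s] .
    have sub: "set_integrable lborel {a..b} (\<lambda>u. lam u \<omega>)" "set_integrable lborel {a<..b} (\<lambda>u. lam u \<omega>)"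
      if "0 \<le> a" "b \<le> t" for a b
      by (rule set_integrable_subset[OF int]; use that in auto)+
    have f_eq: "f u \<omega> = indicator {s<..\<sigma>} u *\<^sub>R lam u \<omega>" for u
      using \<sigma>(2) \<sigma>(3)[of u] subsetD[OF st_horizon, of u] by (auto simp: f_def indicator_def)
    have f_int: "integrable lborel (\<lambda>u. f u \<omega>)"
      using sub(2)[OF s0 \<sigma>(2)] by (simp add: f_eq set_integrable_def)
    have "{0..\<sigma>} = {0..s} \<union> {s<..\<sigma>}"
      using s0 \<sigma>(1) by auto
    then have "\<Lambda> \<sigma> \<omega> = (LBINT u:{0..s} \<union> {s<..\<sigma>}. lam u \<omega>)"
      by (simp add: \<Lambda>_def)
    also have "\<dots> = \<Lambda> s \<omega> + L \<omega>"
      unfolding \<Lambda>_def L_def f_eq set_lebesgue_integral_def[symmetric]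
      by (rule set_integral_Un) (use sub(1)[of 0 s] sub(2)[OF s0 \<sigma>(2)] \<sigma> st in auto)
    finally have L_eq: "L \<omega> = \<Lambda> \<sigma> \<omega> - \<Lambda> s \<omega>"
      by simp
    have "(\<lambda>m. \<Lambda> (?r m) \<omega>) \<longlonglongrightarrow> \<Lambda> \<sigma> \<omega>"
      unfolding \<Lambda>_def
    proof (rule indefinite_integral_tendsto[OF int _ \<sigma>(6)])
      show "?r m \<in> {0..t}" for m
        using grid_bounds[of s t "hitting_index (N \<omega>) n s t m" m] hitting_index_le st s0 by auto
      show "\<sigma> \<in> {0..t}"
        using \<sigma> s0 by auto
    qed
    moreover have "(\<lambda>m. real (N \<omega> (?r m))) \<longlonglongrightarrow> real (N \<omega> \<sigma>)"
      by (rule tendsto_eventually) (use \<sigma>(5) in eventually_elim, simp)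
    ultimately have "(\<lambda>m. real (N \<omega> (?r m)) - \<Lambda> (?r m) \<omega>) \<longlonglongrightarrow> real (N \<omega> \<sigma>) - \<Lambda> \<sigma> \<omega>"
      by (intro tendsto_diff)
    moreover have "real (N \<omega> \<sigma>) - \<Lambda> \<sigma> \<omega> = Z \<omega>"
      using \<sigma>(4)[symmetric] by (simp add: Z_def X_def L_eq N_def)
    ultimately have "(\<lambda>m. X (?r m) \<omega>) \<longlonglongrightarrow> Z \<omega>"
      by (simp add: X_def N_def)
    with f_int show "integrable lborel (\<lambda>u. f u \<omega>) \<and> (\<lambda>m. X (?r m) \<omega>) \<longlonglongrightarrow> Z \<omega>"
      by simp
  qed
  have stop: "integrable (base Y) Z"
    "(\<integral>\<omega>. indicator B \<omega> * Z \<omega> \<partial>base Y) = (\<integral>\<omega>. indicator B \<omega> * X s \<omega> \<partial>base Y)"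
  proof -
    have r: "s \<le> grid s t m i \<and> grid s t m i \<le> t" if "i \<le> Suc m" for m i
      using grid_bounds[OF _ that, of s t] st by simp
    have idx: "{\<omega> \<in> space (base Y). hitting_index (N \<omega>) n s t m = i} \<in> sets (history Y A (grid s t m i))"
      if i: "i \<le> Suc m" for m i
    proof -
      have rI: "grid s t m j \<in> horizon Y" if "j \<le> i" for j
        using aug.downward_closed_I[OF t, of "grid s t m j"] r[of j m] that i aug.nonneg_I[OF s] by auto
      have count: "counting Y k (grid s t m j) \<in> measurable (history Y A (grid s t m i)) (count_space UNIV)" if "j \<le> i" for j
      proof (rule measurable_from_subalg[OF _ counting_adapted[OF kA rI[OF that]]])
        have "grid s t m j \<le> grid s t m i"
          unfolding grid_def using st that by (intro add_left_mono mult_left_mono divide_right_mono) auto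
        then show "subalgebra (history Y A (grid s t m i)) (history Y A (grid s t m j))"
          using history_mono[of A A] by (simp add: subalgebra_def)
      qed
      have level: "{\<omega> \<in> space (history Y A (grid s t m i)). counting Y k (grid s t m j) \<omega> \<in> S}
          \<in> sets (history Y A (grid s t m i))" if "j \<le> i" for j S
        using measurable_sets[OF count[OF that], of S] by (simp add: vimage_def Int_def conj_commute)
      have "{\<omega> \<in> space (history Y A (grid s t m i)).
          (\<forall>j\<in>{..<i}. counting Y k (grid s t m j) \<omega> \<le> n) \<and> (i = Suc m \<or> n < counting Y k (grid s t m i) \<omega>)}
          \<in> sets (history Y A (grid s t m i))"
        by (intro sets.sets_Collect_conj sets.sets_Collect_finite_All sets.sets_Collect_disj sets.sets_Collect_const)
           (use level[of _ "{..n}"] level[of i "{n<..}"] in auto)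
      moreover have "{\<omega> \<in> space (base Y). hitting_index (N \<omega>) n s t m = i} = {\<omega> \<in> space (history Y A (grid s t m i)).
          (\<forall>j\<in>{..<i}. counting Y k (grid s t m j) \<omega> \<le> n) \<and> (i = Suc m \<or> n < counting Y k (grid s t m i) \<omega>)}"
        using hitting_index_eq_iff[OF i] by (auto simp: N_def)
      ultimately show ?thesis
        by simp
    qed
    have lim: "AE \<omega> in base Y. (\<lambda>m. X (grid s t m (hitting_index (N \<omega>) n s t m)) \<omega>) \<longlonglongrightarrow> Z \<omega>"
      using pathwise by eventually_elim simp
    show "integrable (base Y) Z"
      "(\<integral>\<omega>. indicator B \<omega> * Z \<omega> \<partial>base Y) = (\<integral>\<omega>. indicator B \<omega> * X s \<omega> \<partial>base Y)"
      using aug.limit_stopping[OF X s t less_imp_le[OF st] B, of Suc "grid s t" "\<lambda>m \<omega>. hitting_index (N \<omega>) n s t m" Z,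
          OF r hitting_index_le idx Z lim] by auto
  qed
  have K_bdd: "AE \<omega> in base Y. K \<omega> \<le> Suc n \<and> finite (mark_events Y k \<omega>)"
    using good
  proof (rule AE_mp, intro AE_I2 impI)
    fix \<omega> assume \<omega>: "\<omega> \<in> space (base Y)"
      and "finite {s. etime Y s \<omega> < \<infinity>} \<and> set_integrable lborel {0..t} (\<lambda>u. lam u \<omega>)"
    then have fin: "finite {s. etime Y s \<omega> < \<infinity>}" by simp
    have "K \<omega> \<le> card {i \<in> mark_events Y k \<omega>. prior Y k (event_time Y i \<omega>) \<omega> \<le> n}"
      unfolding K_def using finite_events[OF fin] by (intro card_mono) auto
    then show "K \<omega> \<le> Suc n \<and> finite (mark_events Y k \<omega>)"
      using card_early_events[OF \<omega> fin, of k n] finite_events[OF fin] by auto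
  qed
  have K_int: "integrable (base Y) (\<lambda>\<omega>. real (K \<omega>))"
    by (rule integrable_const_bound[of _ "real (Suc n)"]) (use K_bdd in \<open>auto elim!: eventually_mono\<close>)
  have L_int: "integrable (base Y) L"
  proof -
    have "integrable (base Y) (\<lambda>\<omega>. X s \<omega> + real (K \<omega>) - Z \<omega>)"
      using Xs(2) K_int stop(1) by auto
    then show ?thesis
      by (simp add: Z_def)
  qed
  have BK: "integrable (base Y) (\<lambda>\<omega>. indicator B \<omega> * real (K \<omega>))"
    and BL: "integrable (base Y) (\<lambda>\<omega>. indicator B \<omega> * L \<omega>)"
    and BX: "integrable (base Y) (\<lambda>\<omega>. indicator B \<omega> * X s \<omega>)"
    using integrable_mult_indicator[OF BM K_int] integrable_mult_indicator[OF BM L_int]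
      integrable_mult_indicator[OF BM Xs(2)] by auto
  have "(\<integral>\<omega>. indicator B \<omega> * Z \<omega> \<partial>base Y) = (\<integral>\<omega>. indicator B \<omega> * X s \<omega> + indicator B \<omega> * real (K \<omega>) - indicator B \<omega> * L \<omega> \<partial>base Y)"
    by (simp add: Z_def algebra_simps)
  also have "\<dots> = (\<integral>\<omega>. indicator B \<omega> * X s \<omega> \<partial>base Y) + (\<integral>\<omega>. indicator B \<omega> * real (K \<omega>) \<partial>base Y)
      - (\<integral>\<omega>. indicator B \<omega> * L \<omega> \<partial>base Y)"
    using BK BL BX by simp
  finally have KL: "(\<integral>\<omega>. indicator B \<omega> * real (K \<omega>) \<partial>base Y) = (\<integral>\<omega>. indicator B \<omega> * L \<omega> \<partial>base Y)"
    using stop(2) by simp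
  have rect: "{s<..t} \<times> B \<in> sets (borel \<Otimes>\<^sub>M base Y)"
    by measurable
  have "emeasure (early_event_measure Y k n) ({s<..t} \<times> B) = (\<integral>\<^sup>+\<omega>. ennreal (indicator B \<omega> * real (K \<omega>)) \<partial>base Y)"
    unfolding emeasure_early_event_measure[OF rect]
  proof (rule nn_integral_cong_AE)
    show "AE \<omega> in base Y. emeasure (count_space UNIV) {i \<in> mark_events Y k \<omega>. prior Y k (event_time Y i \<omega>) \<omega> \<le> n \<and>
        (event_time Y i \<omega>, \<omega>) \<in> {s<..t} \<times> B} = ennreal (indicator B \<omega> * real (K \<omega>))"
      using K_bdd
    proof eventually_elim
      case (elim \<omega>)
      show ?case
      proof (cases "\<omega> \<in> B")
        case True
        then have eq: "{i \<in> mark_events Y k \<omega>. prior Y k (event_time Y i \<omega>) \<omega> \<le> n \<and>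
            (event_time Y i \<omega>, \<omega>) \<in> {s<..t} \<times> B} = {i \<in> mark_events Y k \<omega>. s < event_time Y i \<omega> \<and> event_time Y i \<omega> \<le> t \<and>
            prior Y k (event_time Y i \<omega>) \<omega> \<le> n}"
          by auto
        show ?thesis
          unfolding eq using True elim by (simp add: K_def ennreal_of_nat_eq_real_of_nat)
      qed simp
    qed
  qed
  also have "\<dots> = ennreal (\<integral>\<omega>. indicator B \<omega> * real (K \<omega>) \<partial>base Y)"
    using BK by (rule nn_integral_eq_integral) auto
  also have "\<dots> = ennreal (\<integral>\<omega>. indicator B \<omega> * L \<omega> \<partial>base Y)"
    by (simp add: KL)
  also have "\<dots> = (\<integral>\<^sup>+\<omega>. ennreal (indicator B \<omega> * L \<omega>) \<partial>base Y)"
    by (rule nn_integral_eq_integral[symmetric, OF BL])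
       (auto simp: L_def intro!: AE_I2 mult_nonneg_nonneg integral_nonneg_AE f_nonneg)
  also have "\<dots> = (\<integral>\<^sup>+\<omega>. (\<integral>\<^sup>+u. ennreal (indicator B \<omega> * f u \<omega>) \<partial>lborel) \<partial>base Y)"
  proof (rule nn_integral_cong_AE)
    show "AE \<omega> in base Y. ennreal (indicator B \<omega> * L \<omega>) = (\<integral>\<^sup>+u. ennreal (indicator B \<omega> * f u \<omega>) \<partial>lborel)"
      using pathwise
    proof (rule AE_mp, intro AE_I2 impI)
      fix \<omega> assume \<omega>: "\<omega> \<in> space (base Y)"
        and "integrable lborel (\<lambda>u. f u \<omega>) \<and> (\<lambda>m. X (grid s t m (hitting_index (N \<omega>) n s t m)) \<omega>) \<longlonglongrightarrow> Z \<omega>"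
      then have "integrable lborel (\<lambda>u. indicator B \<omega> * f u \<omega>)"
        by simp
      from nn_integral_eq_integral[OF this] f_nonneg[OF \<omega>]
      show "ennreal (indicator B \<omega> * L \<omega>) = (\<integral>\<^sup>+u. ennreal (indicator B \<omega> * f u \<omega>) \<partial>lborel)"
        by (simp add: L_def)
    qed
  qed
  also have "\<dots> = (\<integral>\<^sup>+x. ennreal (indicator B (snd x) * f (fst x) (snd x)) \<partial>(lborel \<Otimes>\<^sub>M base Y))"
  proof -
    have "(\<lambda>x. indicator B (snd x) * f (fst x) (snd x)) \<in> borel_measurable (lborel \<Otimes>\<^sub>M base Y)"
      by (rule borel_measurable_times[OF _ f]) measurable
    then have "(\<lambda>x. ennreal (indicator B (snd x) * f (fst x) (snd x))) \<in> borel_measurable (lborel \<Otimes>\<^sub>M base Y)"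
      by (rule measurable_compose[OF _ measurable_ennreal])
    from pair.nn_integral_snd[OF this] show ?thesis
      by simp
  qed
  also have "\<dots> = emeasure (early_intensity_measure Y k n lam) ({s<..t} \<times> B)"
    unfolding emeasure_early_intensity_measure(1)[OF lam rect]
    by (rule nn_integral_cong) (auto simp: f_def indicator_def)
  finally show ?thesis .
qed

lemma early_measures_agree:
  assumes nonexp: "nonexplosive Y" and kA: "k \<in> A" and lam: "intensity Y A k lam"
    and D: "D \<in> sets (predictable_sigma (base Y) (horizon Y) (history Y A))"
  shows "emeasure (early_event_measure Y k n) D = emeasure (early_intensity_measure Y k n lam) D"
proof -
  interpret aug: augmented_filtration "base Y" "horizon Y" "history Y A"
    by (rule filtration)
  interpret pair: pair_sigma_finite lborel "base Y"
    by standard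
  show ?thesis
  proof (rule aug.predictable_emeasure_eqI[OF _ _ _ _ _ D])
    fix B assume "B \<in> sets (history Y A 0)"
    then have BM: "B \<in> sets (base Y)"
      using aug.sets_F[OF aug.zero_in_I] by blast
    then have Z: "{0 :: real} \<times> B \<in> sets (borel \<Otimes>\<^sub>M base Y)"
      by (intro pair_measureI) auto
    have "emeasure (early_event_measure Y k n) ({0} \<times> B) = (\<integral>\<^sup>+\<omega>. 0 \<partial>base Y)"
      unfolding emeasure_early_event_measure[OF Z]
    proof (rule nn_integral_cong)
      fix \<omega> assume "\<omega> \<in> space (base Y)"
      from etime_ereal(2)[OF this]
      have "{i \<in> mark_events Y k \<omega>. prior Y k (event_time Y i \<omega>) \<omega> \<le> n \<and> (event_time Y i \<omega>, \<omega>) \<in> {0} \<times> B} = {}"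
        by (fastforce simp: mark_events_def)
      then show "emeasure (count_space UNIV) {i \<in> mark_events Y k \<omega>. prior Y k (event_time Y i \<omega>) \<omega> \<le> n \<and>
          (event_time Y i \<omega>, \<omega>) \<in> {0} \<times> B} = 0"
        by (simp only: emeasure_empty)
    qed
    moreover have "emeasure (early_intensity_measure Y k n lam) ({0} \<times> B) = 0"
    proof -
      have "{0 :: real} \<times> B \<in> null_sets (lborel \<Otimes>\<^sub>M base Y)"
        using BM by (intro null_setsI) (auto simp: emeasure_pair_measure_Times)
      then have "AE x in lborel \<Otimes>\<^sub>M base Y. x \<notin> {0 :: real} \<times> B"
        by (rule AE_not_in)
      then have "emeasure (early_intensity_measure Y k n lam) ({0} \<times> B) = (\<integral>\<^sup>+x. 0 \<partial>((lborel :: real measure) \<Otimes>\<^sub>M base Y))"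
        unfolding emeasure_early_intensity_measure(1)[OF lam Z]
        by (intro nn_integral_cong_AE) (auto elim!: eventually_mono simp: indicator_def)
      then show ?thesis by simp
    qed
    ultimately show "emeasure (early_event_measure Y k n) ({0} \<times> B) = emeasure (early_intensity_measure Y k n lam) ({0} \<times> B)"
      by simp
  next
    fix s t B assume *: "s \<in> horizon Y" "t \<in> horizon Y" "s \<le> t" "B \<in> sets (history Y A s)"
    show "emeasure (early_event_measure Y k n) ({s<..t} \<times> B) = emeasure (early_intensity_measure Y k n lam) ({s<..t} \<times> B)"
    proof (cases "s < t")
      case True
      then show ?thesis
        using early_measures_agree_on_rectangle[OF nonexp kA lam *(1,2) _ *(4)] by blast
    next
      case False
      then show ?thesis by simp
    qed
  next
    have "horizon Y \<times> space (base Y) \<in> sets (borel \<Otimes>\<^sub>M base Y)"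
      using aug.borel_I by measurable
    from emeasure_early_event_measure_le[OF nonexp this]
    show "emeasure (early_event_measure Y k n) (horizon Y \<times> space (base Y)) < \<infinity>"
      by (rule order_le_less_trans) (simp add: of_nat_less_top)
  qed auto
qed

section \<open>Uniqueness of intensities\<close>

text \<open>
  The event side of the compensator identity does not mention the intensity. Hence \<open>lam\<close> and \<open>lam'\<close> have
  the same finite integral over the early part of \<open>D\<close>, although \<open>lam < lam'\<close> there; so \<open>D\<close> is null. The
  identity for \<open>D\<close> itself then shows that the expected number of events in \<open>D\<close> is zero.
\<close>

lemma intensity_not_less:
  assumes nonexp: "nonexplosive Y" and kA: "k \<in> A"
    and lam: "intensity Y A k lam" and lam': "intensity Y A k lam'"
  defines "D \<equiv> {x \<in> horizon Y \<times> space (base Y). lam (fst x) (snd x) < lam' (fst x) (snd x)}"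
  shows "D \<in> sets (lborel \<Otimes>\<^sub>M base Y)" "AE x in lborel \<Otimes>\<^sub>M base Y. x \<notin> D"
    and "AE \<omega> in base Y. \<forall>i\<in>mark_events Y k \<omega>. (event_time Y i \<omega>, \<omega>) \<notin> D"
proof -
  interpret aug: augmented_filtration "base Y" "horizon Y" "history Y A"
    by (rule filtration)
  interpret pair: pair_sigma_finite lborel "base Y"
    by standard
  have DP: "D \<in> sets aug.\<P>"
  proof -
    have [measurable]: "(\<lambda>x. lam (fst x) (snd x)) \<in> borel_measurable aug.\<P>" "(\<lambda>x. lam' (fst x) (snd x)) \<in> borel_measurable aug.\<P>"
      using lam lam' by (simp_all add: intensity_def predictable_def case_prod_unfold)
    have "{x \<in> space aug.\<P>. lam (fst x) (snd x) < lam' (fst x) (snd x)} \<in> sets aug.\<P>"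
      by measurable
    then show ?thesis
      by (simp only: D_def aug.space_predictable)
  qed
  have "D \<inter> (UNIV \<times> space (base Y)) \<in> sets (borel \<Otimes>\<^sub>M base Y)"
    by (rule aug.predictable_slice[OF DP]) (use aug.sets_F in auto)
  moreover have "D \<inter> (UNIV \<times> space (base Y)) = D"
    by (auto simp: D_def)
  ultimately have DB: "D \<in> sets (borel \<Otimes>\<^sub>M base Y)"
    by simp
  then show DM [measurable]: "D \<in> sets (lborel \<Otimes>\<^sub>M base Y)"
    using sets_pair_measure_cong[OF sets_lborel refl] by blast
  have null: "AE x in lborel \<Otimes>\<^sub>M base Y. prior Y k (fst x) (snd x) \<le> n \<longrightarrow> x \<notin> D" for n
  proof -
    define w where "w \<mu> x = ennreal (indicator (horizon Y) (fst x) * \<mu> (fst x) (snd x)) *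
          indicator {x. prior Y k (fst x) (snd x) \<le> n} x * indicator D x" for \<mu> and x
    have w [measurable]: "w \<mu> \<in> borel_measurable (lborel \<Otimes>\<^sub>M base Y)" if "intensity Y A k \<mu>" for \<mu>
      unfolding w_def by (intro borel_measurable_times_ennreal emeasure_early_intensity_measure(2)[OF that DB] borel_measurable_indicator DM)
    have int_w: "integral\<^sup>N (lborel \<Otimes>\<^sub>M base Y) (w \<mu>) = emeasure (early_event_measure Y k n) D" if "intensity Y A k \<mu>" for \<mu>
      unfolding early_measures_agree[OF nonexp kA that DP] emeasure_early_intensity_measure(1)[OF that DB] w_def ..
    have fin: "integral\<^sup>N (lborel \<Otimes>\<^sub>M base Y) (w lam) \<noteq> \<infinity>"
      using emeasure_early_event_measure_le[OF nonexp DB, of k n] unfolding int_w[OF lam]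
      by (metis ennreal_of_nat_neq_top infinity_ennreal_def top.extremum_uniqueI)
    have le: "w lam x \<le> w lam' x" for x
      by (auto simp: w_def D_def indicator_def intro!: ennreal_leI)
    have "(\<integral>\<^sup>+x. w lam' x - w lam x \<partial>(lborel \<Otimes>\<^sub>M base Y))
        = integral\<^sup>N (lborel \<Otimes>\<^sub>M base Y) (w lam') - integral\<^sup>N (lborel \<Otimes>\<^sub>M base Y) (w lam)"
      by (rule nn_integral_diff[OF w[OF lam'] w[OF lam] fin]) (use le in auto)
    also have "\<dots> = 0"
      using fin unfolding int_w[OF lam] int_w[OF lam'] by (simp add: ennreal_diff_self)
    finally have "AE x in lborel \<Otimes>\<^sub>M base Y. w lam' x - w lam x = 0"
      using w[OF lam] w[OF lam'] by (subst (asm) nn_integral_0_iff_AE) auto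
    then show ?thesis
    proof (rule AE_mp, intro AE_I2 impI)
      fix x assume x: "w lam' x - w lam x = 0" "prior Y k (fst x) (snd x) \<le> n"
      show "x \<notin> D"
      proof
        assume xD: "x \<in> D"
        then have hx: "fst x \<in> horizon Y" "snd x \<in> space (base Y)" "lam (fst x) (snd x) < lam' (fst x) (snd x)"
          by (auto simp: D_def)
        then have "0 \<le> lam (fst x) (snd x)"
          using lam by (simp add: intensity_def)
        moreover have "w lam x = ennreal (lam (fst x) (snd x))" "w lam' x = ennreal (lam' (fst x) (snd x))"
          using hx xD x(2) by (auto simp: w_def)
        ultimately show False
          using x(1) hx(3) by (simp add: ennreal_minus)
      qed
    qed
  qed
  then have "AE x in lborel \<Otimes>\<^sub>M base Y. \<forall>n. prior Y k (fst x) (snd x) \<le> n \<longrightarrow> x \<notin> D"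
    unfolding AE_all_countable using null by blast
  then show AE_D: "AE x in lborel \<Otimes>\<^sub>M base Y. x \<notin> D"
    by eventually_elim blast
  have "AE \<omega> in base Y. \<forall>n. {i \<in> mark_events Y k \<omega>. prior Y k (event_time Y i \<omega>) \<omega> \<le> n \<and> (event_time Y i \<omega>, \<omega>) \<in> D} = {}"
    unfolding AE_all_countable
  proof
    fix n
    let ?E = "\<lambda>\<omega>. {i \<in> mark_events Y k \<omega>. prior Y k (event_time Y i \<omega>) \<omega> \<le> n \<and> (event_time Y i \<omega>, \<omega>) \<in> D}"
    have "emeasure (early_event_measure Y k n) D = (\<integral>\<^sup>+x. 0 \<partial>((lborel :: real measure) \<Otimes>\<^sub>M base Y))"
      unfolding early_measures_agree[OF nonexp kA lam DP] emeasure_early_intensity_measure(1)[OF lam DB]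
      by (rule nn_integral_cong_AE) (use AE_D in \<open>auto elim!: eventually_mono simp: indicator_def\<close>)
    then have zero: "(\<integral>\<^sup>+\<omega>. emeasure (count_space UNIV) (?E \<omega>) \<partial>base Y) = 0"
      using emeasure_early_event_measure[OF DB, of k n] by simp
    have single: "AE \<omega> in base Y. i \<notin> ?E \<omega>" for i
    proof -
      have ev [measurable]: "Measurable.pred (base Y) (\<lambda>\<omega>. i \<in> ?E \<omega>)"
      proof -
        have "(\<lambda>\<omega>. (event_time Y i \<omega>, \<omega>)) -` D \<inter> space (base Y) \<in> sets (base Y)"
          by (rule measurable_sets[OF _ DB]) measurable
        then have [measurable]: "Measurable.pred (base Y) (\<lambda>\<omega>. (event_time Y i \<omega>, \<omega>) \<in> D)"
          by (simp add: pred_def vimage_def Int_def conj_commute)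
        show ?thesis
          by simp measurable
      qed
      have "(\<integral>\<^sup>+\<omega>. indicator {\<omega>. i \<in> ?E \<omega>} \<omega> \<partial>base Y) \<le> (\<integral>\<^sup>+\<omega>. emeasure (count_space UNIV) (?E \<omega>) \<partial>base Y)"
      proof (rule nn_integral_mono)
        fix \<omega>
        show "indicator {\<omega>. i \<in> ?E \<omega>} \<omega> \<le> emeasure (count_space UNIV) (?E \<omega>)"
        proof (cases "i \<in> ?E \<omega>")
          case True
          then have "emeasure (count_space UNIV) {i} \<le> emeasure (count_space UNIV) (?E \<omega>)"
            by (intro emeasure_mono) auto
          then show ?thesis
            using True by simp
        qed simp
      qed
      then have "(\<integral>\<^sup>+\<omega>. indicator {\<omega>. i \<in> ?E \<omega>} \<omega> \<partial>base Y) = 0"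
        using zero by simp
      moreover have "(indicator {\<omega>. i \<in> ?E \<omega>} :: _ \<Rightarrow> ennreal) \<in> borel_measurable (base Y)"
        by (rule borel_measurable_indicator') (use ev[unfolded pred_def] in simp)
      ultimately have "AE \<omega> in base Y. (indicator {\<omega>. i \<in> ?E \<omega>} \<omega> :: ennreal) = 0"
        by (subst (asm) nn_integral_0_iff_AE)
      then show ?thesis
        by eventually_elim (auto simp: indicator_def split: if_splits)
    qed
    have "AE \<omega> in base Y. \<forall>i. i \<notin> ?E \<omega>"
      unfolding AE_all_countable using single by blast
    then show "AE \<omega> in base Y. ?E \<omega> = {}"
      by eventually_elim blast
  qed
  then show "AE \<omega> in base Y. \<forall>i\<in>mark_events Y k \<omega>. (event_time Y i \<omega>, \<omega>) \<notin> D"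
    by eventually_elim blast
qed

lemma intensity_unique:
  assumes nonexp: "nonexplosive Y" and kA: "k \<in> A"
    and lam: "intensity Y A k lam" and lam': "intensity Y A k lam'"
  shows "AE u in lborel. AE \<omega> in base Y. u \<in> horizon Y \<longrightarrow> lam u \<omega> = lam' u \<omega>"
    and "AE \<omega> in base Y. AE u in lborel. u \<in> horizon Y \<longrightarrow> lam u \<omega> = lam' u \<omega>"
    and "AE \<omega> in base Y. \<forall>i\<in>mark_events Y k \<omega>. lam (event_time Y i \<omega>) \<omega> = lam' (event_time Y i \<omega>) \<omega>"
proof -
  interpret pair: pair_sigma_finite lborel "base Y"
    by standard
  define D where "D = {x \<in> horizon Y \<times> space (base Y). lam (fst x) (snd x) < lam' (fst x) (snd x)}"
  define D' where "D' = {x \<in> horizon Y \<times> space (base Y). lam' (fst x) (snd x) < lam (fst x) (snd x)}"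
  note less = intensity_not_less[OF nonexp kA lam lam', folded D_def]
  note less' = intensity_not_less[OF nonexp kA lam' lam, folded D'_def]
  note [measurable] = less(1) less'(1)
  have "AE x in lborel \<Otimes>\<^sub>M base Y. x \<notin> D \<union> D'"
    using less(2) less'(2) by eventually_elim blast
  then have 1: "AE u in lborel. AE \<omega> in base Y. (u, \<omega>) \<notin> D \<union> D'"
    by (rule pair.AE_pair)
  have "{x \<in> space (lborel \<Otimes>\<^sub>M base Y). (fst x, snd x) \<notin> D \<union> D'} \<in> sets (lborel \<Otimes>\<^sub>M base Y)"
  proof -
    have "space (lborel \<Otimes>\<^sub>M base Y) - (D \<union> D') \<in> sets (lborel \<Otimes>\<^sub>M base Y)"
      by (intro sets.Diff sets.top sets.Un less(1) less'(1))
    moreover have "{x \<in> space (lborel \<Otimes>\<^sub>M base Y). (fst x, snd x) \<notin> D \<union> D'} = space (lborel \<Otimes>\<^sub>M base Y) - (D \<union> D')"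
      by auto
    ultimately show ?thesis by simp
  qed
  from pair.AE_commute[OF this] 1 have 2: "AE \<omega> in base Y. AE u in lborel. (u, \<omega>) \<notin> D \<union> D'"
    by blast
  have eq: "lam u \<omega> = lam' u \<omega>" if "(u, \<omega>) \<notin> D \<union> D'" "u \<in> horizon Y" "\<omega> \<in> space (base Y)" for u \<omega>
    using that by (auto simp: D_def D'_def not_less intro: antisym)
  show "AE u in lborel. AE \<omega> in base Y. u \<in> horizon Y \<longrightarrow> lam u \<omega> = lam' u \<omega>"
  proof (rule AE_mp[OF 1], rule AE_I2, rule impI)
    fix u assume "AE \<omega> in base Y. (u, \<omega>) \<notin> D \<union> D'"
    then show "AE \<omega> in base Y. u \<in> horizon Y \<longrightarrow> lam u \<omega> = lam' u \<omega>"
    proof (rule AE_mp, intro AE_I2 impI)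
      show "lam u \<omega> = lam' u \<omega>" if "\<omega> \<in> space (base Y)" "(u, \<omega>) \<notin> D \<union> D'" "u \<in> horizon Y" for \<omega>
        using eq that by blast
    qed
  qed
  show "AE \<omega> in base Y. AE u in lborel. u \<in> horizon Y \<longrightarrow> lam u \<omega> = lam' u \<omega>"
  proof (rule AE_mp[OF 2], rule AE_I2, rule impI)
    fix \<omega> assume \<omega>: "\<omega> \<in> space (base Y)" and "AE u in lborel. (u, \<omega>) \<notin> D \<union> D'"
    from this(2) show "AE u in lborel. u \<in> horizon Y \<longrightarrow> lam u \<omega> = lam' u \<omega>"
    proof (rule AE_mp, intro AE_I2 impI)
      show "lam u \<omega> = lam' u \<omega>" if "(u, \<omega>) \<notin> D \<union> D'" "u \<in> horizon Y" for u
        using eq that \<omega> by blast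
    qed
  qed
  have "AE \<omega> in base Y. \<forall>i\<in>mark_events Y k \<omega>. (event_time Y i \<omega>, \<omega>) \<notin> D \<union> D'"
    using less(3) less'(3) by eventually_elim blast
  then show "AE \<omega> in base Y. \<forall>i\<in>mark_events Y k \<omega>. lam (event_time Y i \<omega>) \<omega> = lam' (event_time Y i \<omega>) \<omega>"
  proof (rule AE_mp, intro AE_I2 impI ballI)
    fix \<omega> i assume "\<omega> \<in> space (base Y)" "\<forall>i\<in>mark_events Y k \<omega>. (event_time Y i \<omega>, \<omega>) \<notin> D \<union> D'" "i \<in> mark_events Y k \<omega>"
    then show "lam (event_time Y i \<omega>) \<omega> = lam' (event_time Y i \<omega>) \<omega>"
      using etime_ereal(3)[of \<omega> i] by (intro eq) (auto simp: mark_events_def)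
  qed
qed

section \<open>Intensities with respect to the history of the parents\<close>

lemma predictable_history_mono:
  assumes "C \<subseteq> A" "predictable (base Y) (horizon Y) (history Y C) g"
  shows "predictable (base Y) (horizon Y) (history Y A) g"
proof -
  interpret C: augmented_filtration "base Y" "horizon Y" "history Y C"
    by (rule filtration)
  interpret A: augmented_filtration "base Y" "horizon Y" "history Y A"
    by (rule filtration)
  have sub: "sets (history Y C s) \<subseteq> sets (history Y A s)" for s
    by (rule history_mono[OF assms(1) order_refl])
  have "sets C.\<P> \<subseteq> sets A.\<P>"
    unfolding C.sets_predictable A.sets_predictable
    by (rule sigma_sets_mono') (use sub in fast)
  then have "subalgebra A.\<P> C.\<P>"
    by (simp add: subalgebra_def)
  then show ?thesis
    using assms(2) measurable_from_subalg unfolding predictable_def by blast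
qed

text \<open>
  The compensated process is literally unchanged, path by path, when the intensity is modified on a null
  set of times. It is adapted to the smaller history because \<open>g\<close> is predictable for that history, and
  the martingale property descends by the tower property.
\<close>

lemma intensity_restrict:
  assumes lam: "intensity Y A k lam" and CA: "C \<subseteq> A" and kC: "k \<in> C"
    and g: "predictable (base Y) (horizon Y) (history Y C) g"
    and nonneg: "\<And>t \<omega>. 0 \<le> g t \<omega>"
    and eq: "\<And>\<omega>. \<omega> \<in> space (base Y) \<Longrightarrow> AE u in lborel. u \<in> horizon Y \<longrightarrow> g u \<omega> = lam u \<omega>"
  shows "intensity Y C k g"
proof -
  interpret C: augmented_filtration "base Y" "horizon Y" "history Y C"
    by (rule filtration)
  interpret A: augmented_filtration "base Y" "horizon Y" "history Y A"
    by (rule filtration)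
  have lamP: "predictable (base Y) (horizon Y) (history Y A) lam"
    using lam by (simp add: intensity_def)
  note path = C.path_integral_cong[OF C.path_measurable[OF g] A.path_measurable[OF lamP] eq]
  define X where "X t \<omega> = real (counting Y k t \<omega>) - (LBINT u:{0..t}. lam u \<omega>)" for t \<omega>
  define X' where "X' t \<omega> = real (counting Y k t \<omega>) - (LBINT u:{0..t}. g u \<omega>)" for t \<omega>
  have X: "martingale (base Y) (horizon Y) (history Y A) X"
    using lam by (simp add: intensity_def X_def[abs_def])
  have XX': "X' t \<omega> = X t \<omega>" if "t \<in> horizon Y" "\<omega> \<in> space (base Y)" for t \<omega>
    using path(2)[OF that(2) that(2) that(2) that(1)] by (simp add: X_def X'_def)
  have X_int: "integrable (base Y) (X t)" if "t \<in> horizon Y" for t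
    using X that by (simp add: martingale_def)
  have X'_int: "integrable (base Y) (X' t)" if "t \<in> horizon Y" for t
    using X_int[OF that] XX'[OF that] Bochner_Integration.integrable_cong[OF refl, of "base Y" "X' t" "X t"] by blast
  have X'_F: "X' t \<in> borel_measurable (history Y C t)" if "t \<in> horizon Y" for t
  proof -
    have "(\<lambda>\<omega>. real (counting Y k t \<omega>)) \<in> borel_measurable (history Y C t)"
      by (rule measurable_compose[OF counting_adapted[OF kC that]]) simp
    then show ?thesis
      unfolding X'_def using C.predictable_time_integral[OF g that] by (rule borel_measurable_diff)
  qed
  have cond: "AE \<omega> in base Y. real_cond_exp (base Y) (history Y C s) (X' t) \<omega> = X' s \<omega>"
    if s: "s \<in> horizon Y" and t: "t \<in> horizon Y" and "s \<le> t" for s t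
  proof -
    interpret S: sigma_finite_subalgebra "base Y" "history Y C s"
      by (rule C.sigma_finite_subalgebra_F[OF s])
    have sub: "subalgebra (history Y A s) (history Y C s)"
      using history_mono[OF CA order_refl] by (simp add: subalgebra_def)
    have "AE \<omega> in base Y. real_cond_exp (base Y) (history Y C s) (X' t) \<omega>
        = real_cond_exp (base Y) (history Y C s) (X t) \<omega>"
      by (rule S.real_cond_exp_cong) (use X_int[OF t] X'_int[OF t] XX'[OF t] in auto)
    moreover have "AE \<omega> in base Y. real_cond_exp (base Y) (history Y C s) (real_cond_exp (base Y) (history Y A s) (X t)) \<omega>
        = real_cond_exp (base Y) (history Y C s) (X t) \<omega>"
      by (rule S.real_cond_exp_nested_subalg[OF A.subalgebra[OF s] sub X_int[OF t]])
    moreover have "AE \<omega> in base Y. real_cond_exp (base Y) (history Y C s) (real_cond_exp (base Y) (history Y A s) (X t)) \<omega>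
        = real_cond_exp (base Y) (history Y C s) (X' s) \<omega>"
    proof (rule S.real_cond_exp_cong)
      have "AE \<omega> in base Y. real_cond_exp (base Y) (history Y A s) (X t) \<omega> = X s \<omega>"
        using X s t \<open>s \<le> t\<close> by (simp add: martingale_def)
      then show "AE \<omega> in base Y. real_cond_exp (base Y) (history Y A s) (X t) \<omega> = X' s \<omega>"
        by (rule AE_mp) (intro AE_I2 impI, simp add: XX'[OF s])
    qed (use X'_int[OF s] in auto)
    moreover have "AE \<omega> in base Y. real_cond_exp (base Y) (history Y C s) (X' s) \<omega> = X' s \<omega>"
      by (rule S.real_cond_exp_F_meas[OF X'_int[OF s] X'_F[OF s]])
    ultimately show ?thesis
      by eventually_elim simp
  qed
  have "AE \<omega> in base Y. \<forall>t\<in>horizon Y. set_integrable lborel {0..t} (\<lambda>u. lam u \<omega>)"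
    using lam by (simp add: intensity_def)
  then have "AE \<omega> in base Y. \<forall>t\<in>horizon Y. set_integrable lborel {0..t} (\<lambda>u. g u \<omega>)"
    by (rule AE_mp) (intro AE_I2 impI ballI, use path(1) in blast)
  moreover have "martingale (base Y) (horizon Y) (history Y C) X'"
    unfolding martingale_def using X'_F X'_int cond by blast
  ultimately show ?thesis
    using g nonneg by (simp add: intensity_def X'_def[abs_def])
qed

lemma finite_marks [simp]: "finite (marks Y)"
  by (simp add: marks_def)

text \<open>
  The statement is only about almost every time: an intensity may be altered at any fixed time, and the
  versions given by local independence agree with \<open>lam\<close> only outside a null set of times.
\<close>

lemma intensity_parents_adapted:
  assumes nonexp: "nonexplosive Y" and k: "k \<in> marks Y" and lam: "intensity Y (marks Y) k lam"
    and graph: "local_independence_graph Y E"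
    and inter: "\<forall>A B t. A \<subseteq> marks Y \<longrightarrow> B \<subseteq> marks Y \<longrightarrow> t \<in> horizon Y \<longrightarrow>
           sets (history Y A t) \<inter> sets (history Y B t) = sets (history Y (A \<inter> B) t)"
  shows "AE u in lborel. u \<in> horizon Y \<longrightarrow> lam u \<in> borel_measurable (history Y (cl E k) u)"
proof -
  interpret V: augmented_filtration "base Y" "horizon Y" "history Y (marks Y)"
    by (rule filtration)
  define J where "J = marks Y - cl E k"
  have lamP: "predictable (base Y) (horizon Y) (history Y (marks Y)) lam"
    using lam by (simp add: intensity_def)
  have single: "AE u in lborel. u \<in> horizon Y \<longrightarrow> lam u \<in> borel_measurable (history Y (marks Y - {j}) u)"
    if j: "j \<in> J" for j
  proof -
    interpret W: augmented_filtration "base Y" "horizon Y" "history Y (marks Y - {j})"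
      by (rule filtration)
    have jk: "j \<in> marks Y" "j \<noteq> k" "(j, k) \<notin> E"
      using j by (auto simp: J_def cl_def pa_def)
    then have "locally_independent Y {j} {k} (marks Y - {j, k})"
      using graph k by (simp add: local_independence_graph_def)
    moreover have "{j} \<union> {k} \<union> (marks Y - {j, k}) = marks Y" "{k} \<union> (marks Y - {j, k}) = marks Y - {j}"
      using jk k by auto
    ultimately obtain lam' where lam': "intensity Y (marks Y) k lam'"
      "\<And>t. t \<in> horizon Y \<Longrightarrow> lam' t \<in> borel_measurable (history Y (marks Y - {j}) t)"
      unfolding locally_independent_def by auto
    show ?thesis
      using intensity_unique(1)[OF nonexp k lam'(1) lam]
    proof (rule AE_mp, intro AE_I2 impI)
      fix u assume eq: "AE \<omega> in base Y. u \<in> horizon Y \<longrightarrow> lam' u \<omega> = lam u \<omega>" and u: "u \<in> horizon Y"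
      show "lam u \<in> borel_measurable (history Y (marks Y - {j}) u)"
      proof (rule W.measurable_F_AE_eq[OF u lam'(2)[OF u]])
        show "lam u \<in> borel_measurable (base Y)"
          by (rule V.measurable_F[OF u V.predictable_adapted[OF lamP u]])
      qed (use eq u in simp)
    qed
  qed
  have "finite J"
    by (simp add: J_def)
  then have "AE u in lborel. \<forall>j\<in>J. u \<in> horizon Y \<longrightarrow> lam u \<in> borel_measurable (history Y (marks Y - {j}) u)"
    by (rule AE_finite_allI) (rule single)
  then show ?thesis
  proof (rule AE_mp, intro AE_I2 impI)
    fix u assume all: "\<forall>j\<in>J. u \<in> horizon Y \<longrightarrow> lam u \<in> borel_measurable (history Y (marks Y - {j}) u)"
      and u: "u \<in> horizon Y"
    show "lam u \<in> borel_measurable (history Y (cl E k) u)"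
    proof (rule measurableI)
      fix S :: "real set" assume S: "S \<in> sets borel"
      let ?S = "lam u -` S \<inter> space (base Y)"
      have "?S \<in> sets (history Y (marks Y - J') u)" if "finite J'" "J' \<subseteq> J" for J'
        using that
      proof (induction J' rule: finite_induct)
        case empty
        then show ?case
          using measurable_sets[OF V.predictable_adapted[OF lamP u] S] by simp
      next
        case (insert j J')
        have "lam u \<in> borel_measurable (history Y (marks Y - {j}) u)"
          using all u insert.prems by blast
        from measurable_sets[OF this S] have "?S \<in> sets (history Y (marks Y - {j}) u)"
          by (simp only: space_history)
        moreover have "?S \<in> sets (history Y (marks Y - J') u)"
          using insert.IH insert.prems by (simp only: insert_subset)
        ultimately have "?S \<in> sets (history Y (marks Y - J') u) \<inter> sets (history Y (marks Y - {j}) u)"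
          by (intro IntI)
        also have "\<dots> = sets (history Y ((marks Y - J') \<inter> (marks Y - {j})) u)"
          by (rule inter[rule_format, OF _ _ u]) auto
        also have "(marks Y - J') \<inter> (marks Y - {j}) = marks Y - insert j J'"
          by auto
        finally show ?case .
      qed
      from this[OF \<open>finite J\<close> order_refl] have "?S \<in> sets (history Y (marks Y - J) u)" .
      moreover have "marks Y - J = cl E k"
        using graph k by (auto simp: J_def cl_def pa_def local_independence_graph_def)
      ultimately show "lam u -` S \<inter> space (history Y (cl E k) u) \<in> sets (history Y (cl E k) u)"
        by simp
    qed simp
  qed
qed

text \<open>
  One process serves as intensity for both histories; it is the link between the full intensity and
  any intensity with respect to the history of the parents.
\<close>

lemma intensity_parents:
  assumes nonexp: "nonexplosive Y" and k: "k \<in> marks Y" and lam: "intensity Y (marks Y) k lam"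
    and graph: "local_independence_graph Y E"
    and inter: "\<forall>A B t. A \<subseteq> marks Y \<longrightarrow> B \<subseteq> marks Y \<longrightarrow> t \<in> horizon Y \<longrightarrow>
           sets (history Y A t) \<inter> sets (history Y B t) = sets (history Y (A \<inter> B) t)"
  shows "\<exists>g. intensity Y (cl E k) k g \<and> intensity Y (marks Y) k g"
proof -
  interpret C: augmented_filtration "base Y" "horizon Y" "history Y (cl E k)"
    by (rule filtration)
  have "\<exists>g. predictable (base Y) (horizon Y) (history Y (cl E k)) g \<and> (\<forall>t \<omega>. 0 \<le> g t \<omega>) \<and>
      (\<forall>\<omega>\<in>space (base Y). AE t in lborel. t \<in> horizon Y \<longrightarrow> g t \<omega> = lam t \<omega>)"
  proof (rule C.predictable_version)
    show "(\<lambda>(s, \<omega>). indicator (horizon Y) s * lam s \<omega>) \<in> borel_measurable (lborel \<Otimes>\<^sub>M base Y)"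
      using intensity_jointly_measurable[OF lam] by (simp add: case_prod_unfold)
    show "0 \<le> lam s \<omega>" if "s \<in> horizon Y" "\<omega> \<in> space (base Y)" for s \<omega>
      using lam that by (simp add: intensity_def)
    show "AE s in lborel. s \<in> horizon Y \<longrightarrow> lam s \<in> borel_measurable (history Y (cl E k) s)"
      by (rule intensity_parents_adapted[OF assms])
  qed
  then obtain g where g: "predictable (base Y) (horizon Y) (history Y (cl E k)) g" "\<And>t \<omega>. 0 \<le> g t \<omega>"
    "\<And>\<omega>. \<omega> \<in> space (base Y) \<Longrightarrow> AE t in lborel. t \<in> horizon Y \<longrightarrow> g t \<omega> = lam t \<omega>"
    by blast
  have cl: "cl E k \<subseteq> marks Y" "k \<in> cl E k"
    using graph k by (auto simp: cl_def pa_def local_independence_graph_def)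
  have "intensity Y (cl E k) k g"
    by (rule intensity_restrict[OF lam cl g])
  moreover have "intensity Y (marks Y) k g"
    by (rule intensity_restrict[OF lam order_refl k predictable_history_mono[OF cl(1) g(1)] g(2,3)])
  ultimately show ?thesis by blast
qed

section \<open>Factorisation of the likelihood\<close>

lemma likelihood_factorises_pathwise:
  assumes \<omega>: "\<omega> \<in> space (base Y)" and fin: "finite {s. etime Y s \<omega> < \<infinity>}"
    and int: "\<And>k. k \<in> marks Y \<Longrightarrow> set_integrable lborel {0..t} (\<lambda>u. lam k u \<omega>)"
    and eq_int: "\<And>k. k \<in> marks Y \<Longrightarrow> (LBINT u:{0..t}. lam k u \<omega>) = (LBINT u:{0..t}. \<mu> k u \<omega>)"
    and eq: "\<And>k i. k \<in> marks Y \<Longrightarrow> i \<in> mark_events Y k \<omega> \<Longrightarrow>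
      lam k (event_time Y i \<omega>) \<omega> = \<mu> k (event_time Y i \<omega>) \<omega>"
  shows "likelihood Y lam t \<omega> = (\<Prod>k\<in>marks Y. mark_likelihood Y k (\<mu> k) t \<omega>)"
proof -
  let ?S = "{s. etime Y s \<omega> \<le> ereal t}"
  let ?index = "\<lambda>s. the_inv_into (marks Y) (mark Y) (emark Y s \<omega>)"
  have S: "finite ?S"
    using fin by (rule rev_finite_subset) (auto simp: etime_le_iff[OF \<omega>])
  have emark: "emark Y s \<omega> \<in> mark Y ` marks Y" for s
    using measurable_space[OF emark_measurable \<omega>] by simp
  have index: "?index ` ?S \<subseteq> marks Y"
    using the_inv_into_into[OF inj_mark emark] by auto
  have index_iff: "?index s = k \<longleftrightarrow> emark Y s \<omega> = mark Y k" if "k \<in> marks Y" for s k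
    using f_the_inv_into_f[OF inj_mark emark] the_inv_into_f_eq[OF inj_mark _ that] by metis
  have "(\<Prod>s\<in>?S. lam (?index s) (real_of_ereal (etime Y s \<omega>)) \<omega>)
      = (\<Prod>k\<in>marks Y. \<Prod>s\<in>{s \<in> ?S. ?index s = k}. lam (?index s) (real_of_ereal (etime Y s \<omega>)) \<omega>)"
    by (rule prod.group[symmetric, OF S finite_marks index])
  also have "\<dots> = (\<Prod>k\<in>marks Y. \<Prod>s\<in>{s. etime Y s \<omega> \<le> ereal t \<and> emark Y s \<omega> = mark Y k}. \<mu> k (real_of_ereal (etime Y s \<omega>)) \<omega>)"
  proof (intro prod.cong refl)
    fix k assume k: "k \<in> marks Y"
    show "{s \<in> ?S. ?index s = k} = {s. etime Y s \<omega> \<le> ereal t \<and> emark Y s \<omega> = mark Y k}"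
      using index_iff[OF k] by auto
    fix s assume s: "s \<in> {s. etime Y s \<omega> \<le> ereal t \<and> emark Y s \<omega> = mark Y k}"
    then have "?index s = k"
      using index_iff[OF k, of s] by blast
    moreover have "s \<in> mark_events Y k \<omega>"
      using s by (auto simp: mark_events_def etime_le_iff[OF \<omega>])
    ultimately show "lam (?index s) (real_of_ereal (etime Y s \<omega>)) \<omega> = \<mu> k (real_of_ereal (etime Y s \<omega>)) \<omega>"
      using eq[OF k] by (simp add: event_time_def)
  qed
  finally have jumps: "(\<Prod>s\<in>?S. lam (?index s) (real_of_ereal (etime Y s \<omega>)) \<omega>)
      = (\<Prod>k\<in>marks Y. \<Prod>s\<in>{s. etime Y s \<omega> \<le> ereal t \<and> emark Y s \<omega> = mark Y k}. \<mu> k (real_of_ereal (etime Y s \<omega>)) \<omega>)" .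
  have "(LBINT u:{0..t}. \<Sum>k\<in>marks Y. lam k u \<omega>) = (\<Sum>k\<in>marks Y. LBINT u:{0..t}. lam k u \<omega>)"
    unfolding set_lebesgue_integral_def scaleR_sum_right
    by (rule Bochner_Integration.integral_sum) (use int in \<open>simp add: set_integrable_def\<close>)
  then have "exp (- (LBINT u:{0..t}. \<Sum>k\<in>marks Y. lam k u \<omega>)) = (\<Prod>k\<in>marks Y. exp (- (LBINT u:{0..t}. \<mu> k u \<omega>)))"
    by (simp add: eq_int exp_sum[symmetric] sum_negf[symmetric] del: sum_negf)
  then show ?thesis
    unfolding likelihood_def mark_likelihood_def prod.distrib jumps by simp
qed

end

theorem mainTheorem3:
  fixes Y :: "('w, 'e) mpp"
    and E :: "(nat \<times> nat) set"
    and lam :: "nat \<Rightarrow> real \<Rightarrow> 'w \<Rightarrow> real"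
  assumes "marked_point_process Y"
    and "nonexplosive Y"
    and "\<forall>k\<in>marks Y. intensity Y (marks Y) k (lam k)"
    and "local_independence_graph Y E"
    and "\<forall>A B t. A \<subseteq> marks Y \<longrightarrow> B \<subseteq> marks Y \<longrightarrow> t \<in> horizon Y \<longrightarrow>
           sets (history Y A t) \<inter> sets (history Y B t) = sets (history Y (A \<inter> B) t)"
  shows "(\<forall>k\<in>marks Y. \<exists>\<mu>. intensity Y (cl E k) k \<mu>) \<and>
    (\<forall>\<mu>. (\<forall>k\<in>marks Y. intensity Y (cl E k) k (\<mu> k)) \<longrightarrow>
      (AE \<omega> in base Y. \<forall>t\<in>horizon Y.
         likelihood Y lam t \<omega> = (\<Prod>k\<in>marks Y. mark_likelihood Y k (\<mu> k) t \<omega>)))"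
proof -
  interpret marked_point_process Y
    by fact
  have common: "\<exists>g. intensity Y (cl E k) k g \<and> intensity Y (marks Y) k g" if "k \<in> marks Y" for k
    using intensity_parents[OF assms(2) that _ assms(4,5)] assms(3) that by blast
  show ?thesis
  proof (intro conjI ballI allI impI)
    show "\<exists>\<mu>. intensity Y (cl E k) k \<mu>" if "k \<in> marks Y" for k
      using common[OF that] by blast
  next
    fix \<mu> assume \<mu>: "\<forall>k\<in>marks Y. intensity Y (cl E k) k (\<mu> k)"
    have same: "AE \<omega> in base Y.
        (\<forall>t\<in>horizon Y. set_integrable lborel {0..t} (\<lambda>u. lam k u \<omega>)) \<and>
        (\<forall>t\<in>horizon Y. (LBINT u:{0..t}. lam k u \<omega>) = (LBINT u:{0..t}. \<mu> k u \<omega>)) \<and>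
        (\<forall>i\<in>mark_events Y k \<omega>. lam k (event_time Y i \<omega>) \<omega> = \<mu> k (event_time Y i \<omega>) \<omega>)" if k: "k \<in> marks Y" for k
    proof -
      interpret C: augmented_filtration "base Y" "horizon Y" "history Y (cl E k)"
        by (rule filtration)
      interpret V: augmented_filtration "base Y" "horizon Y" "history Y (marks Y)"
        by (rule filtration)
      have lam_k: "intensity Y (marks Y) k (lam k)" and \<mu>_k: "intensity Y (cl E k) k (\<mu> k)"
        using assms(3) \<mu> k by auto
      obtain g where g: "intensity Y (cl E k) k g" "intensity Y (marks Y) k g"
        using common[OF k] by blast
      have "k \<in> cl E k"
        by (simp add: cl_def)
      note u1 = intensity_unique[OF assms(2) this \<mu>_k g(1)]
      note u2 = intensity_unique[OF assms(2) k lam_k g(2)]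
      have "AE \<omega> in base Y. \<forall>t\<in>horizon Y. set_integrable lborel {0..t} (\<lambda>u. lam k u \<omega>)"
        using lam_k by (simp add: intensity_def)
      moreover have "AE \<omega> in base Y. \<forall>t\<in>horizon Y. (LBINT u:{0..t}. lam k u \<omega>) = (LBINT u:{0..t}. \<mu> k u \<omega>)"
      proof (rule AE_mp[OF u1(2)], rule AE_mp[OF u2(2)], rule AE_I2, intro impI ballI)
        fix \<omega> t assume \<omega>: "\<omega> \<in> space (base Y)" and t: "t \<in> horizon Y"
          and a: "AE u in lborel. u \<in> horizon Y \<longrightarrow> lam k u \<omega> = g u \<omega>"
          and b: "AE u in lborel. u \<in> horizon Y \<longrightarrow> \<mu> k u \<omega> = g u \<omega>"
        from a b have "AE u in lborel. u \<in> horizon Y \<longrightarrow> lam k u \<omega> = \<mu> k u \<omega>"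
          by eventually_elim simp
        then show "(LBINT u:{0..t}. lam k u \<omega>) = (LBINT u:{0..t}. \<mu> k u \<omega>)"
          using lam_k \<mu>_k
          by (intro C.path_integral_cong(2)[OF V.path_measurable[OF _ \<omega>] C.path_measurable[OF _ \<omega>] _ t])
             (simp_all add: intensity_def)
      qed
      moreover have "AE \<omega> in base Y. \<forall>i\<in>mark_events Y k \<omega>. lam k (event_time Y i \<omega>) \<omega> = \<mu> k (event_time Y i \<omega>) \<omega>"
        using u1(3) u2(3) by eventually_elim simp
      ultimately show ?thesis
        by eventually_elim blast
    qed
    have all: "AE \<omega> in base Y. \<forall>k\<in>marks Y.
        (\<forall>t\<in>horizon Y. set_integrable lborel {0..t} (\<lambda>u. lam k u \<omega>)) \<and>
        (\<forall>t\<in>horizon Y. (LBINT u:{0..t}. lam k u \<omega>) = (LBINT u:{0..t}. \<mu> k u \<omega>)) \<and>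
        (\<forall>i\<in>mark_events Y k \<omega>. lam k (event_time Y i \<omega>) \<omega> = \<mu> k (event_time Y i \<omega>) \<omega>)"
      by (rule AE_finite_allI[OF finite_marks same])
    show "AE \<omega> in base Y. \<forall>t\<in>horizon Y. likelihood Y lam t \<omega> = (\<Prod>k\<in>marks Y. mark_likelihood Y k (\<mu> k) t \<omega>)"
    proof (rule AE_mp[OF all], rule AE_mp[OF assms(2)[unfolded nonexplosive_def]], rule AE_I2, intro impI ballI)
      fix \<omega> t assume \<omega>: "\<omega> \<in> space (base Y)" and fin: "finite {s. etime Y s \<omega> < \<infinity>}" and t: "t \<in> horizon Y"
        and all: "\<forall>k\<in>marks Y.
          (\<forall>t\<in>horizon Y. set_integrable lborel {0..t} (\<lambda>u. lam k u \<omega>)) \<and>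
          (\<forall>t\<in>horizon Y. (LBINT u:{0..t}. lam k u \<omega>) = (LBINT u:{0..t}. \<mu> k u \<omega>)) \<and>
          (\<forall>i\<in>mark_events Y k \<omega>. lam k (event_time Y i \<omega>) \<omega> = \<mu> k (event_time Y i \<omega>) \<omega>)"
      show "likelihood Y lam t \<omega> = (\<Prod>k\<in>marks Y. mark_likelihood Y k (\<mu> k) t \<omega>)"
        by (rule likelihood_factorises_pathwise[OF \<omega> fin]) (use all t in auto)
    qed
  qed
qed

end
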